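(* Let $X=G(2,N)$ be the Grassmannian of $2$-planes in $\mathbb C^N$, $\hat G=SL_N\times\mathbb G_m$, $V=\Gamma(X,\omega_X^{-1})^*$, $\hat X\subset V$ the cone over $X\subset\mathbb P V$. At the hyperplane section $f=x_{1,2}x_{2,3}\cdots x_{N-1,N}x_{N,1}\in\Gamma(X,\omega_X^{-1})$, where the $x_{ij}$ are the Plücker coordinates of $X$, the rank of the solution sheaf of $\mathcal M:=\tau(\hat X,V,\hat G,(0;1))$ is $1$, i.e. $\dim\mathrm{Hom}_{\mathcal D}(\mathcal M,\mathcal O_f)=1$.
   Context: Tautological system. Let $V$ be a finite dimensional complex vector space, $\hat G$ a complex Lie group, $Z:\hat G\to\mathrm{Aut}\,V$ a holomorphic representation whose image contains $\mathbb C^\times 1_V$, and $Z:\hat{\mathfrak g}\to\mathrm{End}\,V$ the induced Lie algebra representation. Let $\hat X\subset V$ be a $\hat G$-stable closed subvariety with vanishing ideal $I(\hat X,V)\subset\mathbb C[V]$ and $\beta:\hat{\mathfrak g}\to\mathbb C$ a Lie algebra homomorphism. Choose a basis $a_i$ of $V$ (linear coordinates on $V^*$) with dual basis $a_i^*$ of $V^*$, and let $\mathcal D=\mathbb C[a][\partial/\partial a_1,\partial/\partial a_2,\dots]$ be the Weyl algebra on $V^*$. View $Z(x)$ as the operator $\sum_{i,j}x_{ji}a_j\partial/\partial a_i$, where $Z(x)a_i=\sum_j x_{ji}a_j$. For $p\in\mathbb C[V]=\mathbb C[a^*]$ let $p(\partial)$ be obtained by substituting $\partial/\partial a_i$ for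 $a_i^*$. Then $\tau(\hat X,V,\hat G,\beta)=\mathcal D/\big(\sum_{x}\mathcal D(Z(x)+\beta(x))+\sum_{p\in I(\hat X,V)}\mathcal D\,p(\partial)\big)$. For $f\in V^*$, $\mathcal O_f$ denotes the $\mathcal D$-module of convergent power series at $f$. Here $SL_N$ acts naturally on $X$, $\omega_X^{-1}$ and $V$; $\mathbb G_m$ acts on $V$ by scaling (so $1\in\mathbb C=\mathrm{Lie}(\mathbb G_m)$ acts as the identity); $\beta=(0;1)$ means $\beta|_{\mathfrak{sl}_N}=0$, $\beta(1)=1$. One has $\omega_X^{-1}\cong\mathcal O_X(N)$ for the Plücker embedding $X\subset\mathbb P(\bigwedge^2\mathbb C^N)$, so $\Gamma(X,\omega_X^{-1})$ is the space of degree $N$ polynomials in the Plücker coordinates $x_{ij}=-x_{ji}$ modulo Plücker relations. *)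

theory Defs
  imports
    "HOL-Analysis.Analysis"
    "HOL-Library.Poly_Mapping"
    "HOL-Library.Function_Algebras"
    "Jordan_Normal_Form.Matrix"
begin

section \<open>Commutative polynomials\<close>

abbreviation "keys \<equiv> Poly_Mapping.keys"

abbreviation "lookup \<equiv> Poly_Mapping.lookup"

type_synonym 'v mpoly = "('v \<Rightarrow>\<^sub>0 nat) \<Rightarrow>\<^sub>0 complex"

definition Const :: "complex \<Rightarrow> 'v mpoly" where
  "Const c = Poly_Mapping.single 0 c"

definition Var :: "'v \<Rightarrow> 'v mpoly" where
  "Var v = Poly_Mapping.single (Poly_Mapping.single v 1) 1"

definition mdeg :: "('v \<Rightarrow>\<^sub>0 nat) \<Rightarrow> nat" where
  "mdeg m = (\<Sum>v\<in>keys m. lookup m v)"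

definition poly_subst :: "(complex \<Rightarrow> 'r) \<Rightarrow> ('v \<Rightarrow> 'r) \<Rightarrow> 'v mpoly \<Rightarrow> 'r::comm_semiring_1" where
  "poly_subst h s p = (\<Sum>m\<in>keys p. h (lookup p m) * (\<Prod>v\<in>keys m. s v ^ lookup m v))"

abbreviation poly_eval :: "('v \<Rightarrow> complex) \<Rightarrow> 'v mpoly \<Rightarrow> complex" where
  "poly_eval \<equiv> poly_subst (\<lambda>c. c)"


section \<open>Function spaces as complex vector spaces\<close>

definition fscale :: "complex \<Rightarrow> ('x \<Rightarrow> complex) \<Rightarrow> 'x \<Rightarrow> complex" where
  "fscale c v = (\<lambda>x. c * v x)"

definition fscale2 :: "complex \<Rightarrow> ('y \<Rightarrow> 'x \<Rightarrow> complex) \<Rightarrow> 'y \<Rightarrow> 'x \<Rightarrow> complex" where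
  "fscale2 c h = (\<lambda>y. fscale c (h y))"

global_interpretation fvec: vector_space "fscale :: complex \<Rightarrow> ('x \<Rightarrow> complex) \<Rightarrow> 'x \<Rightarrow> complex"
  by unfold_locales (auto simp: fscale_def fun_eq_iff algebra_simps)

global_interpretation fvec2: vector_space
  "fscale2 :: complex \<Rightarrow> ('y \<Rightarrow> 'x \<Rightarrow> complex) \<Rightarrow> 'y \<Rightarrow> 'x \<Rightarrow> complex"
  by unfold_locales (auto simp: fscale2_def fscale_def fun_eq_iff algebra_simps)


section \<open>The Weyl algebra\<close>

text \<open>The Weyl algebra on coordinates \<open>a\<^sub>i\<close>, \<open>i :: 'b\<close>, by generators and relations: the free
  algebra on letters \<open>a\<^sub>i\<close>, \<open>\<partial>\<^sub>i\<close> (finitely supported maps from words to coefficients) modulo the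
  two-sided ideal of the Heisenberg relations.\<close>

datatype 'b wletter = LCoord 'b | LPartial 'b

datatype 'b wword = WWord (letters: "'b wletter list")

instantiation wword :: (type) monoid_add
begin
definition zero_wword :: "'a wword" where "0 = WWord []"
definition plus_wword :: "'a wword \<Rightarrow> 'a wword \<Rightarrow> 'a wword" where
  "v + w = WWord (letters v @ letters w)"
instance by standard (auto simp: zero_wword_def plus_wword_def)
end

type_synonym 'b wfree = "'b wword \<Rightarrow>\<^sub>0 complex"

definition fgen :: "'b wletter \<Rightarrow> 'b wfree" where
  "fgen l = Poly_Mapping.single (WWord [l]) 1"

definition fcoord :: "'b \<Rightarrow> 'b wfree" where "fcoord i = fgen (LCoord i)"

definition fpartial :: "'b \<Rightarrow> 'b wfree" where "fpartial i = fgen (LPartial i)"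

inductive_set weyl_relations :: "'b wfree set" where
  coord_coord: "fcoord i * fcoord j - fcoord j * fcoord i \<in> weyl_relations"
| partial_partial: "fpartial i * fpartial j - fpartial j * fpartial i \<in> weyl_relations"
| partial_coord: "fpartial i * fcoord j - fcoord j * fpartial i - (if i = j then 1 else 0)
    \<in> weyl_relations"
| add: "p \<in> weyl_relations \<Longrightarrow> q \<in> weyl_relations \<Longrightarrow> p + q \<in> weyl_relations"
| mult: "p \<in> weyl_relations \<Longrightarrow> r * p * s \<in> weyl_relations"

lemma weyl_relations_zero: "0 \<in> weyl_relations"
  using weyl_relations.coord_coord[of undefined undefined] by simp

lemma weyl_relations_left: "p \<in> weyl_relations \<Longrightarrow> r * p \<in> weyl_relations"
  using weyl_relations.mult[of p r 1] by simp

lemma weyl_relations_right: "p \<in> weyl_relations \<Longrightarrow> p * r \<in> weyl_relations"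
  using weyl_relations.mult[of p 1 r] by simp

lemma weyl_relations_uminus: "p \<in> weyl_relations \<Longrightarrow> - p \<in> weyl_relations"
  using weyl_relations_left[of p "- 1"] by simp

definition weyl_equiv :: "'b wfree \<Rightarrow> 'b wfree \<Rightarrow> bool" where
  "weyl_equiv p q \<longleftrightarrow> p - q \<in> weyl_relations"

lemma weyl_equiv_equivp: "equivp (weyl_equiv :: 'a wfree \<Rightarrow> _)"
proof (rule equivpI)
  show "reflp (weyl_equiv :: 'a wfree \<Rightarrow> _)"
    by (rule reflpI) (simp add: weyl_equiv_def weyl_relations_zero)
  show "symp (weyl_equiv :: 'a wfree \<Rightarrow> _)"
  proof (rule sympI)
    fix p q :: "'a wfree" assume "weyl_equiv p q"
    then show "weyl_equiv q p"
      using weyl_relations_uminus[of "p - q"] by (simp add: weyl_equiv_def)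
  qed
  show "transp (weyl_equiv :: 'a wfree \<Rightarrow> _)"
  proof (rule transpI)
    fix p q r :: "'a wfree" assume "weyl_equiv p q" "weyl_equiv q r"
    then show "weyl_equiv p r"
      using weyl_relations.add[of "p - q" "q - r"] by (simp add: weyl_equiv_def)
  qed
qed

quotient_type 'b weyl = "'b wfree" / weyl_equiv
  by (rule weyl_equiv_equivp)


subsection \<open>Action on power series\<close>

text \<open>A power series at \<open>f\<close> is the family \<open>c\<close> of coefficients of
  \<open>\<Sum>\<^sub>m c\<^sub>m (a - f)\<^sup>m\<close>, with \<open>m\<close> running over the multi-indices; so \<open>a\<^sub>i\<close> acts as multiplication by
  \<open>f\<^sub>i + (a\<^sub>i - f\<^sub>i)\<close>.\<close>

type_synonym 'b series = "('b \<Rightarrow>\<^sub>0 nat) \<Rightarrow> complex"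

fun letter_act :: "('b \<Rightarrow> complex) \<Rightarrow> 'b wletter \<Rightarrow> 'b series \<Rightarrow> 'b series" where
  "letter_act f (LCoord i) c = (\<lambda>m. f i * c m +
     (if lookup m i = 0 then 0 else c (m - Poly_Mapping.single i 1)))"
| "letter_act f (LPartial i) c =
     (\<lambda>m. of_nat (lookup m i + 1) * c (m + Poly_Mapping.single i 1))"

definition word_act :: "('b \<Rightarrow> complex) \<Rightarrow> 'b wword \<Rightarrow> 'b series \<Rightarrow> 'b series" where
  "word_act f w c = foldr (letter_act f) (letters w) c"

definition free_act :: "('b \<Rightarrow> complex) \<Rightarrow> 'b wfree \<Rightarrow> 'b series \<Rightarrow> 'b series" where
  "free_act f p c = (\<lambda>m. \<Sum>w\<in>keys p. lookup p w * word_act f w c m)"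

lemma letter_act_add: "letter_act f l (c + d) = letter_act f l c + letter_act f l d"
  by (cases l) (auto simp: fun_eq_iff algebra_simps)

lemma letter_act_scale: "letter_act f l (fscale k c) = fscale k (letter_act f l c)"
  by (cases l) (auto simp: fun_eq_iff fscale_def algebra_simps)

lemma word_act_add: "word_act f w (c + d) = word_act f w c + word_act f w d"
proof -
  have "foldr (letter_act f) ls (c + d) = foldr (letter_act f) ls c + foldr (letter_act f) ls d" for ls
    by (induction ls) (simp_all only: foldr.simps id_apply o_apply letter_act_add)
  then show ?thesis by (simp add: word_act_def)
qed

lemma word_act_scale: "word_act f w (fscale k c) = fscale k (word_act f w c)"
proof -
  have "foldr (letter_act f) ls (fscale k c) = fscale k (foldr (letter_act f) ls c)" for ls
    by (induction ls) (simp_all add: letter_act_scale)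
  then show ?thesis by (simp add: word_act_def)
qed

lemma word_act_plus: "word_act f (v + w) c = word_act f v (word_act f w c)"
  by (simp add: word_act_def plus_wword_def)

lemma free_act_superset:
  assumes "finite A" "keys p \<subseteq> A"
  shows "free_act f p c = (\<lambda>m. \<Sum>w\<in>A. lookup p w * word_act f w c m)"
  unfolding free_act_def
  by (intro ext sum.mono_neutral_left) (use assms in \<open>auto simp: in_keys_iff\<close>)

lemma free_act_add: "free_act f (p + q) c = free_act f p c + free_act f q c"
proof -
  let ?A = "keys p \<union> keys q"
  have A: "finite ?A" "keys (p + q) \<subseteq> ?A" "keys p \<subseteq> ?A" "keys q \<subseteq> ?A"
    using Poly_Mapping.keys_add[of p q] by auto
  show ?thesis
    unfolding free_act_superset[OF A(1,2)] free_act_superset[OF A(1,3)]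
      free_act_superset[OF A(1,4)]
    by (simp add: fun_eq_iff lookup_add algebra_simps sum.distrib)
qed

lemma free_act_zero: "free_act f 0 c = 0"
  by (simp add: free_act_def fun_eq_iff)

lemma free_act_uminus: "free_act f (- p) c = - free_act f p c"
  using free_act_add[of f p "- p" c] by (simp add: free_act_zero eq_neg_iff_add_eq_0 add.commute)

lemma free_act_diff: "free_act f (p - q) c = free_act f p c - free_act f q c"
  using free_act_add[of f p "- q" c] by (simp add: free_act_uminus)

lemma free_act_sum: "free_act f (\<Sum>x\<in>A. p x) c = (\<Sum>x\<in>A. free_act f (p x) c)"
  by (induction A rule: infinite_finite_induct) (simp_all add: free_act_zero free_act_add)

lemma free_act_single: "free_act f (Poly_Mapping.single w k) c = fscale k (word_act f w c)"
  using free_act_superset[of "{w}" "Poly_Mapping.single w k" f c]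
  by (simp add: fun_eq_iff fscale_def)

lemma free_act_series_add: "free_act f p (c + d) = free_act f p c + free_act f p d"
  by (simp add: free_act_def fun_eq_iff word_act_add algebra_simps sum.distrib)

lemma free_act_series_zero: "free_act f p 0 = 0"
  using free_act_series_add[of f p 0 0] by simp

lemma free_act_series_scale: "free_act f p (fscale k c) = fscale k (free_act f p c)"
  by (simp add: free_act_def fun_eq_iff word_act_scale) (simp add: fscale_def sum_distrib_left algebra_simps)

lemma free_act_series_sum: "free_act f p (\<Sum>x\<in>A. c x) = (\<Sum>x\<in>A. free_act f p (c x))"
  by (induction A rule: infinite_finite_induct)
    (simp_all only: sum.infinite sum.empty sum.insert free_act_series_zero free_act_series_add
      not_False_eq_True)

lemma wfree_decompose:
  fixes p :: "'b wfree"
  shows "p = (\<Sum>w\<in>keys p. Poly_Mapping.single w (lookup p w))"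
  by (rule poly_mapping_eqI) (auto simp: lookup_sum lookup_single when_def in_keys_iff)

lemma free_act_mult: "free_act f (p * q) c = free_act f p (free_act f q c)"
proof -
  have s: "free_act f (Poly_Mapping.single v j * q) c = free_act f (Poly_Mapping.single v j) (free_act f q c)"
    for v j
  proof -
    have "free_act f (Poly_Mapping.single v j * q) c =
      (\<Sum>w\<in>keys q. free_act f (Poly_Mapping.single v j * Poly_Mapping.single w (lookup q w)) c)"
      by (subst (1) wfree_decompose[of q]) (simp add: sum_distrib_left free_act_sum)
    also have "\<dots> = (\<Sum>w\<in>keys q. free_act f (Poly_Mapping.single v j)
        (free_act f (Poly_Mapping.single w (lookup q w)) c))"
      by (intro sum.cong refl)
        (simp add: mult_single free_act_single word_act_plus word_act_scale)
    also have "\<dots> = free_act f (Poly_Mapping.single v j) (free_act f q c)"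
      by (subst (3) wfree_decompose[of q]) (simp add: free_act_sum free_act_series_sum)
    finally show ?thesis .
  qed
  have "free_act f (p * q) c =
      (\<Sum>v\<in>keys p. free_act f (Poly_Mapping.single v (lookup p v) * q) c)"
    by (subst (1) wfree_decompose[of p]) (simp add: sum_distrib_right free_act_sum)
  also have "\<dots> = (\<Sum>v\<in>keys p. free_act f (Poly_Mapping.single v (lookup p v)) (free_act f q c))"
    by (simp only: s)
  also have "\<dots> = free_act f p (free_act f q c)"
    by (subst (3) wfree_decompose[of p]) (simp add: free_act_sum)
  finally show ?thesis .
qed

lemma free_act_one: "free_act f 1 c = c"
proof -
  have "free_act f (Poly_Mapping.single 0 1) c = c"
    by (simp only: free_act_single) (simp add: word_act_def zero_wword_def fscale_def)
  then show ?thesis by simp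
qed

lemma free_act_gen: "free_act f (fgen l) c = letter_act f l c"
  by (simp add: fgen_def free_act_single word_act_def fscale_def)

lemma minus_single_add:
  fixes m :: "'b \<Rightarrow>\<^sub>0 nat"
  shows "lookup m i \<noteq> 0 \<Longrightarrow> Poly_Mapping.single i 1 + (m - Poly_Mapping.single i 1) = m"
  by (rule poly_mapping_eqI) (auto simp: lookup_add lookup_minus lookup_single when_def)

lemma minus_single_commute:
  fixes m :: "'b \<Rightarrow>\<^sub>0 nat"
  shows "i \<noteq> j \<Longrightarrow> Poly_Mapping.single j 1 + (m - Poly_Mapping.single i 1)
    = m + Poly_Mapping.single j 1 - Poly_Mapping.single i 1"
  by (rule poly_mapping_eqI) (auto simp: lookup_add lookup_minus lookup_single when_def)

lemma minus_single_swap: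
  fixes m :: "'b \<Rightarrow>\<^sub>0 nat"
  shows "m - Poly_Mapping.single i 1 - Poly_Mapping.single j 1
    = m - Poly_Mapping.single j 1 - Poly_Mapping.single i 1"
  by (rule poly_mapping_eqI) (auto simp: lookup_minus)

lemma free_act_relations: "p \<in> weyl_relations \<Longrightarrow> free_act f p c = 0"
proof (induction arbitrary: c rule: weyl_relations.induct)
  case (coord_coord i j)
  show ?case
    by (simp add: free_act_diff free_act_mult fcoord_def free_act_gen fun_eq_iff)
      (auto simp: algebra_simps lookup_minus lookup_single when_def minus_single_swap[of _ i j]
        split: if_splits)
next
  case (partial_partial i j)
  show ?case
    by (simp add: free_act_diff free_act_mult fpartial_def free_act_gen fun_eq_iff)
      (auto simp: algebra_simps lookup_add lookup_single when_def)
next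
  case (partial_coord i j)
  show ?case
  proof (cases "i = j")
    case True
    then show ?thesis
      by (simp add: free_act_diff free_act_mult fpartial_def fcoord_def free_act_gen free_act_one
          fun_eq_iff lookup_add lookup_minus)
        (auto simp: algebra_simps minus_single_add[simplified] of_nat_diff)
  next
    case False
    then show ?thesis
      by (simp add: free_act_diff free_act_mult fpartial_def fcoord_def free_act_gen free_act_zero
          fun_eq_iff lookup_add lookup_minus)
        (auto simp: algebra_simps lookup_single when_def minus_single_commute[simplified])
  qed
next
  case (add p q)
  then show ?case by (simp add: free_act_add)
next
  case (mult p r s)
  then show ?case by (simp only: free_act_mult free_act_series_zero)
qed

lift_definition weyl_act :: "('b \<Rightarrow> complex) \<Rightarrow> 'b weyl \<Rightarrow> 'b series \<Rightarrow> 'b series" is free_act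
proof -
  fix f :: "'b \<Rightarrow> complex" and p q :: "'b wfree"
  assume "weyl_equiv p q"
  then have "free_act f (p - q) c = 0" for c
    by (simp add: weyl_equiv_def free_act_relations)
  then show "free_act f p = free_act f q"
    by (simp add: fun_eq_iff[of "free_act f p"] free_act_diff)
qed


subsection \<open>Ring structure\<close>

instantiation weyl :: (type) ring_1
begin

lift_definition zero_weyl :: "'a weyl" is 0 .

lift_definition one_weyl :: "'a weyl" is 1 .

lift_definition plus_weyl :: "'a weyl \<Rightarrow> 'a weyl \<Rightarrow> 'a weyl" is "(+)"
proof -
  fix p q r s :: "'a wfree"
  assume "weyl_equiv p q" "weyl_equiv r s"
  moreover have "(p + r) - (q + s) = (p - q) + (r - s)" by (simp add: algebra_simps)
  ultimately show "weyl_equiv (p + r) (q + s)"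
    unfolding weyl_equiv_def by (metis weyl_relations.add)
qed

lift_definition uminus_weyl :: "'a weyl \<Rightarrow> 'a weyl" is uminus
proof -
  fix p q :: "'a wfree"
  assume "weyl_equiv p q"
  moreover have "(- p) - (- q) = - (p - q)" by simp
  ultimately show "weyl_equiv (- p) (- q)"
    unfolding weyl_equiv_def by (metis weyl_relations_uminus)
qed

lift_definition minus_weyl :: "'a weyl \<Rightarrow> 'a weyl \<Rightarrow> 'a weyl" is "(-)"
proof -
  fix p q r s :: "'a wfree"
  assume "weyl_equiv p q" "weyl_equiv r s"
  moreover have "(p - r) - (q - s) = (p - q) + - (r - s)" by (simp add: algebra_simps)
  ultimately show "weyl_equiv (p - r) (q - s)"
    unfolding weyl_equiv_def by (metis weyl_relations.add weyl_relations_uminus)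
qed

lift_definition times_weyl :: "'a weyl \<Rightarrow> 'a weyl \<Rightarrow> 'a weyl" is "(*)"
proof -
  fix p q r s :: "'a wfree"
  assume "weyl_equiv p q" "weyl_equiv r s"
  moreover have "p * r - q * s = (p - q) * r + q * (r - s)" by (simp add: algebra_simps)
  ultimately show "weyl_equiv (p * r) (q * s)"
    unfolding weyl_equiv_def
    by (metis weyl_relations.add weyl_relations_left weyl_relations_right)
qed

instance
proof
  fix a b c :: "'a weyl"
  have refl: "weyl_equiv p q" if "p = q" for p q :: "'a wfree"
    using that by (simp add: weyl_equiv_def weyl_relations_zero)
  show "a + b + c = a + (b + c)" by transfer (rule refl, simp add: algebra_simps)
  show "a + b = b + a" by transfer (rule refl, simp add: algebra_simps)
  show "0 + a = a" by transfer (rule refl, simp)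
  show "- a + a = 0" by transfer (rule refl, simp)
  show "a - b = a + - b" by transfer (rule refl, simp)
  show "a * b * c = a * (b * c)" by transfer (rule refl, simp add: algebra_simps)
  show "1 * a = a" by transfer (rule refl, simp)
  show "a * 1 = a" by transfer (rule refl, simp)
  show "(a + b) * c = a * c + b * c" by transfer (rule refl, simp add: algebra_simps)
  show "a * (b + c) = a * b + a * c" by transfer (rule refl, simp add: algebra_simps)
  show "(0 :: 'a weyl) \<noteq> 1"
  proof
    assume "(0 :: 'a weyl) = 1"
    then have "weyl_equiv (0 :: 'a wfree) 1" by transfer
    then have "free_act (\<lambda>_. 0) (0 - 1 :: 'a wfree) (\<lambda>_. 1) = 0"
      unfolding weyl_equiv_def by (rule free_act_relations)
    then show False by (simp add: free_act_uminus free_act_one fun_eq_iff)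
  qed
qed

end

lift_definition wconst :: "complex \<Rightarrow> 'b weyl" is "\<lambda>c. Poly_Mapping.single 0 c" .

lift_definition wcoord :: "'b \<Rightarrow> 'b weyl" is fcoord .

lift_definition wpartial :: "'b \<Rightarrow> 'b weyl" is fpartial .

lemma weyl_act_mult: "weyl_act f (P * Q) c = weyl_act f P (weyl_act f Q c)"
  by transfer (rule free_act_mult)

lemma weyl_act_add: "weyl_act f (P + Q) c = weyl_act f P c + weyl_act f Q c"
  by transfer (rule free_act_add)

lemma weyl_act_one: "weyl_act f 1 c = c"
  by transfer (rule free_act_one)

lemma weyl_act_series_add: "weyl_act f P (c + d) = weyl_act f P c + weyl_act f P d"
  by transfer (rule free_act_series_add)

lemma weyl_act_const: "weyl_act f (wconst k) c = fscale k c"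
  by transfer (simp add: free_act_single word_act_def zero_wword_def)

lemma weyl_act_coord: "weyl_act f (wcoord i) c = letter_act f (LCoord i) c"
  by transfer (simp add: fcoord_def free_act_gen)

lemma weyl_act_partial: "weyl_act f (wpartial i) c = letter_act f (LPartial i) c"
  by transfer (simp add: fpartial_def free_act_gen)

lemma wpartial_commute: "wpartial i * wpartial j = wpartial j * wpartial i"
  by transfer (simp add: weyl_equiv_def weyl_relations.partial_partial)

text \<open>\<open>p(\<partial>)\<close>: the product over the variables of a monomial does not depend on the order since
  the \<open>\<partial>\<^sub>i\<close> commute.\<close>

definition wpartial_monom :: "('b \<Rightarrow>\<^sub>0 nat) \<Rightarrow> 'b weyl" where
  "wpartial_monom m = Finite_Set.fold (\<lambda>i P. wpartial i ^ lookup m i * P) 1 (keys m)"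

definition poly_partial :: "'b mpoly \<Rightarrow> 'b weyl" where
  "poly_partial p = (\<Sum>m\<in>keys p. wconst (lookup p m) * wpartial_monom m)"

lemma wpartial_monom_comp_fun_commute:
  fixes m :: "'b \<Rightarrow>\<^sub>0 nat"
  shows "comp_fun_commute (\<lambda>i P. wpartial i ^ lookup m i * P)"
proof
  fix i j :: 'b
  have pc: "x * y ^ n = y ^ n * x" if "x * y = y * x" for x y :: "'b weyl" and n
    using that by (metis power_commuting_commutes)
  have "wpartial i ^ k * wpartial j ^ l = wpartial j ^ l * wpartial i ^ k" for k l
    by (intro pc pc[symmetric] wpartial_commute)
  then show "(\<lambda>P. wpartial j ^ lookup m j * P) \<circ> (\<lambda>P. wpartial i ^ lookup m i * P) =
      (\<lambda>P. wpartial i ^ lookup m i * P) \<circ> (\<lambda>P. wpartial j ^ lookup m j * P)"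
    by (simp add: fun_eq_iff flip: mult.assoc)
qed


section \<open>Left modules and solutions\<close>

inductive_set left_ideal :: "'r::ring_1 set \<Rightarrow> 'r set" for S where
  zero: "0 \<in> left_ideal S"
| gen: "s \<in> S \<Longrightarrow> s \<in> left_ideal S"
| add: "p \<in> left_ideal S \<Longrightarrow> q \<in> left_ideal S \<Longrightarrow> p + q \<in> left_ideal S"
| mult: "p \<in> left_ideal S \<Longrightarrow> r * p \<in> left_ideal S"

definition left_coset :: "'r::ring_1 set \<Rightarrow> 'r \<Rightarrow> 'r set" where
  "left_coset J P = {P + Q | Q. Q \<in> J}"

definition quotient_module :: "'r::ring_1 set \<Rightarrow> 'r set set" where
  "quotient_module J = range (left_coset J)"

text \<open>Convergent power series: absolute convergence on a polydisc of some radius \<open>r > 0\<close>.\<close>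

definition conv_series :: "'b series set" where
  "conv_series = {c. \<exists>r>0. (\<lambda>m. norm (c m) * r ^ mdeg m) summable_on UNIV}"

text \<open>\<open>Hom\<^sub>D(D/J, O\<^sub>f)\<close>. The maps are set to \<open>0\<close> off the carrier \<open>D/J\<close>, so that
  distinct elements of the Hom space are distinct functions.\<close>

definition Hom_D :: "'b weyl set \<Rightarrow> ('b \<Rightarrow> complex) \<Rightarrow> ('b weyl set \<Rightarrow> 'b series) set" where
  "Hom_D J f = {h.
     (\<forall>m. m \<notin> quotient_module J \<longrightarrow> h m = 0) \<and>
     (\<forall>m\<in>quotient_module J. h m \<in> conv_series) \<and>
     (\<forall>P Q. h (left_coset J (P + Q)) = h (left_coset J P) + h (left_coset J Q)) \<and>
     (\<forall>P Q. h (left_coset J (P * Q)) = weyl_act f P (h (left_coset J Q)))}"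


section \<open>Tautological systems\<close>

text \<open>Below, \<open>V\<close> is a space of functions with basis \<open>(a\<^sub>i)\<close>, and the \<open>a\<^sub>i\<close> are the coordinates
  on \<open>V\<^sup>*\<close> on which the Weyl algebra is built.\<close>

definition is_basis :: "('b \<Rightarrow> 'x \<Rightarrow> complex) \<Rightarrow> ('x \<Rightarrow> complex) set \<Rightarrow> bool" where
  "is_basis a V \<longleftrightarrow> inj a \<and> fvec.independent (range a) \<and> fvec.span (range a) = V"

text \<open>\<open>dual_basis a j\<close> is \<open>a\<^sub>j\<^sup>*\<close>, the \<open>j\<close>-th coordinate function on \<open>V\<close>.\<close>

definition dual_basis :: "('b \<Rightarrow> 'x \<Rightarrow> complex) \<Rightarrow> 'b \<Rightarrow> ('x \<Rightarrow> complex) \<Rightarrow> complex" where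
  "dual_basis a j v = fvec.representation (range a) v (a j)"

text \<open>The vanishing ideal of \<open>X \<subseteq> V\<close>, with \<open>\<complex>[V] = \<complex>[a\<^sup>*]\<close>.\<close>

definition vanishing_ideal :: "('b \<Rightarrow> 'x \<Rightarrow> complex) \<Rightarrow> ('x \<Rightarrow> complex) set \<Rightarrow> 'b mpoly set" where
  "vanishing_ideal a X = {p. \<forall>v\<in>X. poly_eval (\<lambda>i. dual_basis a i v) p = 0}"

text \<open>The operator \<open>\<Sum>\<^sub>i\<^sub>j x\<^sub>j\<^sub>i a\<^sub>j \<partial>\<^sub>i\<close> of \<open>T \<in> End V\<close>, where \<open>T a\<^sub>i = \<Sum>\<^sub>j x\<^sub>j\<^sub>i a\<^sub>j\<close>.\<close>

definition lin_operator ::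
  "('b::finite \<Rightarrow> 'x \<Rightarrow> complex) \<Rightarrow> (('x \<Rightarrow> complex) \<Rightarrow> 'x \<Rightarrow> complex) \<Rightarrow> 'b weyl" where
  "lin_operator a T =
     (\<Sum>i\<in>UNIV. \<Sum>j\<in>UNIV. wconst (dual_basis a j (T (a i))) * wcoord j * wpartial i)"

text \<open>The left ideal \<open>J\<close> with \<open>\<tau> = D/J\<close>; \<open>g\<close> is the Lie algebra, \<open>Z\<close> its representation on \<open>V\<close>
  and \<open>\<beta>\<close> its character.\<close>

definition tautological_ideal ::
  "('b::finite \<Rightarrow> 'x \<Rightarrow> complex) \<Rightarrow> ('x \<Rightarrow> complex) set \<Rightarrow>
   'g set \<Rightarrow> ('g \<Rightarrow> ('x \<Rightarrow> complex) \<Rightarrow> 'x \<Rightarrow> complex) \<Rightarrow> ('g \<Rightarrow> complex) \<Rightarrow> 'b weyl set" where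
  "tautological_ideal a X g Z \<beta> = left_ideal
     ((\<lambda>x. lin_operator a (Z x) + wconst (\<beta> x)) ` g \<union> poly_partial ` vanishing_ideal a X)"


section \<open>The Grassmannian of 2-planes\<close>

text \<open>Indices run over \<open>0, \<dots>, N - 1\<close>. The polynomial variables are \<open>x\<^sub>i\<^sub>j\<close> with \<open>i < j\<close>.\<close>

type_synonym plpoly = "(nat \<times> nat) mpoly"

definition pl :: "nat \<Rightarrow> nat \<Rightarrow> plpoly" where
  "pl i j = (if i < j then Var (i, j) else if j < i then - Var (j, i) else 0)"

definition plucker_relations :: "nat \<Rightarrow> plpoly set" where
  "plucker_relations N = {pl i j * pl k l - pl i k * pl j l + pl i l * pl j k | i j k l.
     i < N \<and> j < N \<and> k < N \<and> l < N}"

definition plucker_ideal :: "nat \<Rightarrow> plpoly set" where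
  "plucker_ideal N = left_ideal (plucker_relations N)"

definition pl_forms :: "nat \<Rightarrow> plpoly set" where
  "pl_forms N = {P. \<forall>m\<in>keys P. keys m \<subseteq> {(i, j). i < j \<and> j < N} \<and> mdeg m = N}"

text \<open>\<open>\<Gamma>(X, \<omega>\<^sub>X\<^sup>-\<^sup>1) = \<Gamma>(X, O(N))\<close> consists of the degree \<open>N\<close> forms modulo the Pluecker ideal. Its dual
  \<open>V\<close> consists of the linear functionals on the degree \<open>N\<close> forms that kill the Pluecker
  ideal (extended by \<open>0\<close> to other polynomials).\<close>

definition V_space :: "nat \<Rightarrow> (plpoly \<Rightarrow> complex) set" where
  "V_space N = {v.
     (\<forall>P. P \<notin> pl_forms N \<longrightarrow> v P = 0) \<and>
     (\<forall>P\<in>pl_forms N. \<forall>Q\<in>pl_forms N. v (P + Q) = v P + v Q) \<and>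
     (\<forall>c. \<forall>P\<in>pl_forms N. v (Const c * P) = c * v P) \<and>
     (\<forall>P\<in>pl_forms N \<inter> plucker_ideal N. v P = 0)}"

definition plane_basis :: "nat \<Rightarrow> complex Matrix.vec \<Rightarrow> complex Matrix.vec \<Rightarrow> complex Matrix.vec set \<Rightarrow> bool" where
  "plane_basis N u w W \<longleftrightarrow> u \<in> carrier_vec N \<and> w \<in> carrier_vec N \<and>
     (\<forall>s t. s \<cdot>\<^sub>v u + t \<cdot>\<^sub>v w = 0\<^sub>v N \<longrightarrow> s = 0 \<and> t = 0) \<and>
     W = {s \<cdot>\<^sub>v u + t \<cdot>\<^sub>v w | s t. True}"

definition grassmannian2 :: "nat \<Rightarrow> complex Matrix.vec set set" where
  "grassmannian2 N = {W. \<exists>u w. plane_basis N u w W}"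

text \<open>Evaluation of forms at the Pluecker vector of \<open>u \<and> w\<close>. As a point of \<open>V\<close>, it spans the line
  in \<open>V\<close> which is the image of the plane spanned by \<open>u\<close>, \<open>w\<close> under \<open>X \<rightarrow> \<P>V\<close>.\<close>

definition ev :: "nat \<Rightarrow> complex Matrix.vec \<Rightarrow> complex Matrix.vec \<Rightarrow> plpoly \<Rightarrow> complex" where
  "ev N u w P = (if P \<in> pl_forms N then
     poly_eval (\<lambda>(i, j). vec_index u i * vec_index w j - vec_index u j * vec_index w i) P else 0)"

definition plucker_cone :: "nat \<Rightarrow> (plpoly \<Rightarrow> complex) set" where
  "plucker_cone N = {fscale c (ev N u w) | c u w. \<exists>W\<in>grassmannian2 N. plane_basis N u w W}"

text \<open>The group \<open>SL\<^sub>N \<times> \<complex>\<^sup>*\<close> acts on \<open>V\<close> by \<open>(g, t) \<cdot> v = t v(P \<circ> g)\<close>, where \<open>P \<circ> g\<close> substitutes the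
  Pluecker coordinate \<open>x\<^sub>i\<^sub>j(g p) = \<Sum>\<^sub>k\<^sub>l g\<^sub>i\<^sub>k g\<^sub>j\<^sub>l p\<^sub>k \<otimes> p\<^sub>l\<close> for \<open>x\<^sub>i\<^sub>j\<close>; this sends the evaluation
  at \<open>u \<and> w\<close> to \<open>t\<close> times the one at \<open>g u \<and> g w\<close>.\<close>

definition pl_act :: "nat \<Rightarrow> complex mat \<Rightarrow> plpoly \<Rightarrow> plpoly" where
  "pl_act N g = poly_subst Const
     (\<lambda>(i, j). \<Sum>k<N. \<Sum>l<N. Const (g $$ (i, k) * g $$ (j, l)) * pl k l)"

definition group_rep ::
  "nat \<Rightarrow> complex mat \<times> complex \<Rightarrow> (plpoly \<Rightarrow> complex) \<Rightarrow> plpoly \<Rightarrow> complex" where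
  "group_rep N = (\<lambda>(g, t) v P. if P \<in> pl_forms N then t * v (pl_act N g P) else 0)"

definition mat_exp :: "nat \<Rightarrow> complex mat \<Rightarrow> complex mat" where
  "mat_exp N x = mat N N (\<lambda>(i, j). suminf (\<lambda>k. (x ^\<^sub>m k) $$ (i, j) / fact k))"

text \<open>The Lie algebra \<open>sl\<^sub>N \<oplus> \<complex>\<close>, and the representation induced by the group representation,
  the derivative at \<open>z = 0\<close> of the action of \<open>exp (z (x, s)) \<in> SL\<^sub>N \<times> \<complex>\<^sup>*\<close>.\<close>

definition lie_alg :: "nat \<Rightarrow> (complex mat \<times> complex) set" where
  "lie_alg N = {(x, s). x \<in> carrier_mat N N \<and> (\<Sum>i<N. x $$ (i, i)) = 0}"

definition lie_rep ::
  "nat \<Rightarrow> complex mat \<times> complex \<Rightarrow> (plpoly \<Rightarrow> complex) \<Rightarrow> plpoly \<Rightarrow> complex" where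
  "lie_rep N = (\<lambda>(x, s) v P.
     deriv (\<lambda>z. group_rep N (mat_exp N (z \<cdot>\<^sub>m x), exp (z * s)) v P) 0)"

definition beta :: "complex mat \<times> complex \<Rightarrow> complex" where
  "beta = (\<lambda>(x, s). s)"

text \<open>In one-based indexing this is \<open>x\<^sub>1\<^sub>2 x\<^sub>2\<^sub>3 \<dots> x\<^sub>N\<^sub>-\<^sub>1\<^sub>,\<^sub>N x\<^sub>N\<^sub>1\<close>, where \<open>x\<^sub>N\<^sub>1 = - x\<^sub>1\<^sub>N\<close>. As a point
  of \<open>V\<^sup>*\<close> it has the coordinates \<open>a\<^sub>i(f)\<close>.\<close>

definition cyclic_section :: "nat \<Rightarrow> plpoly" where
  "cyclic_section N = (\<Prod>i<N. pl i ((i + 1) mod N))"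

end

theory Submission
  imports Defs "HOL-Library.Multiset"
begin

text \<open>Expanding at \<open>f\<close> turns a solution \<open>\<Sum>\<^sub>m c\<^sub>m (a - f)\<^sup>m\<close> into the functional \<open>a\<^sup>*\<^sup>m \<mapsto> m! c\<^sub>m\<close> on \<open>\<complex>[V]\<close>.
  It kills the ideal of \<open>X\<close>, and sending \<open>p / f\<^sup>k\<^sup>+\<^sup>1\<close> to \<open>(-1)\<^sup>k / k!\<close> times its value on a form \<open>p\<close> of degree
  \<open>k\<close> defines a functional \<open>J\<close> on the regular functions of degree \<open>-N\<close> on the complement of \<open>f = 0\<close>;
  the Lie algebra equations say exactly that \<open>J\<close> is \<open>sl\<^sub>N\<close>-invariant.

  Uniqueness: by the Pluecker relations the noncrossing bracket monomials span. If such a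
  monomial contains a diagonal, take a shortest one; invariance under the torus makes all sides cut off
  by it occur with exponent \<open>-1\<close>, and moving one of its end points towards the neighbouring vertex off
  the arc shortens the arc, so that \<open>J\<close> vanishes by induction. Hence \<open>J\<close> is determined by \<open>J(1 / f)\<close>.

  Existence: on a torus chart of the Grassmannian \<open>f\<close> is a monomial. Taking the constant term of a
  function times \<open>f\<close> is invariant by integration by parts, and the resulting series
  converges as constant terms are bounded by the sum of the absolute values of the coefficients.\<close>

section \<open>Brackets\<close>

text \<open>The model is a period integral. Expanding at \<open>f\<close> the integral over a cycle
  of the volume form divided by a section makes \<open>m! c_m\<close> equal to
  \<open>(-1)^k k!\<close> times the integral of the monomial \<open>m\<close> over
  \<open>f^(k+1)\<close>; this is the origin of the factors. That the value does not depend on how a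
  fraction is written is the Euler equation, in which \<open>beta = 1\<close> makes multiplication
  by \<open>f\<close> act as \<open>-(k + 1)\<close>.

  The obstacle to shortening an arc is that every bracket at the moved vertex \<open>a\<close>
  contributes a term to the derivative. By the Plucker relation they are first expressed through the
  brackets of \<open>a\<close> with \<open>a - 1\<close> and \<open>a - 2\<close>. Moving
  \<open>a\<close> along \<open>a - 1\<close> fixes the first of these, so that only a power of the
  second and the arc factor are differentiated.

  Functions on the cone are kept as functions of two vectors and compared by values, which suits an
  ideal defined by values; no basis of the coordinate ring enters.

  For existence, the group does not preserve the normal form of the matrices in the torus chart.
  Each vector field is corrected by a row operation in \<open>sl_2\<close>, which brackets do not
  see.\<close>

type_synonym pfun = "(nat \<Rightarrow> complex) \<Rightarrow> (nat \<Rightarrow> complex) \<Rightarrow> complex"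

definition br :: "nat \<Rightarrow> nat \<Rightarrow> pfun" where
  "br i j u w = u i * w j - u j * w i"

definition cyc :: "nat \<Rightarrow> pfun" where
  "cyc N u w = (\<Prod>i<N. br i (Suc i mod N) u w)"

text \<open>The path is affine in \<open>t\<close> rather than \<open>exp (t X) u\<close>: only its
  derivative at \<open>t = 0\<close> enters, and there the two agree.\<close>

definition flow :: "nat \<Rightarrow> (nat \<Rightarrow> nat \<Rightarrow> complex) \<Rightarrow> complex \<Rightarrow> (nat \<Rightarrow> complex) \<Rightarrow> nat \<Rightarrow> complex" where
  "flow N X t u = (\<lambda>i. u i + t * (\<Sum>k<N. X i k * u k))"

lemma br_plucker: "br i k u w * br j l u w = br i j u w * br k l u w + br i l u w * br j k u w"
  by (simp add: br_def algebra_simps)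

lemma br_swap: "br j i u w = - br i j u w"
  by (simp add: br_def)

lemma br_self [simp]: "br i i u w = 0"
  by (simp add: br_def)

text \<open>Scalar multiples of bracket monomials: \<open>d\<close> is the degree counted in
  brackets, \<open>I\<close> holds the indices allowed in numerators, and \<open>S\<close> the sides
  that may be inverted, each named by its first vertex. A zero scalar is allowed, so
  \<open>d\<close> need not be determined by the function.\<close>

inductive brp :: "nat \<Rightarrow> nat set \<Rightarrow> nat set \<Rightarrow> int \<Rightarrow> pfun \<Rightarrow> bool" for N I S where
  const: "brp N I S 0 (\<lambda>u w. c)"
| br: "i \<in> I \<Longrightarrow> j \<in> I \<Longrightarrow> brp N I S d g \<Longrightarrow> brp N I S (d + 1) (\<lambda>u w. br i j u w * g u w)"
| inv: "i \<in> S \<Longrightarrow> brp N I S d g \<Longrightarrow> brp N I S (d - 1) (\<lambda>u w. g u w / br i (Suc i mod N) u w)"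

lemma brp_mono: "brp N I S d g \<Longrightarrow> I \<subseteq> I' \<Longrightarrow> S \<subseteq> S' \<Longrightarrow> brp N I' S' d g"
  by (induction rule: brp.induct) (auto intro: brp.intros)

lemma brp_scale: "brp N I S d g \<Longrightarrow> brp N I S d (\<lambda>u w. c * g u w)"
proof (induction rule: brp.induct)
  case (const k)
  show ?case by (rule brp.const)
next
  case (br i j d g)
  then show ?case using brp.br[OF br(1,2,4)] by (simp add: mult_ac)
next
  case (inv i d g)
  then show ?case using brp.inv[OF inv(1,3)] by simp
qed

lemma brp_mult:
  assumes "brp N I S d g" "brp N I S e h"
  shows "brp N I S (d + e) (\<lambda>u w. g u w * h u w)"
  using assms(1)
proof (induction rule: brp.induct)
  case (const k)
  show ?case using brp_scale[OF assms(2)] by simp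
next
  case (br i j d g)
  then show ?case using brp.br[OF br(1,2,4)] by (simp add: mult_ac add_ac)
next
  case (inv i d g)
  then show ?case using brp.inv[OF inv(1,3)] by (simp add: algebra_simps)
qed

lemma brp_br: "i \<in> I \<Longrightarrow> j \<in> I \<Longrightarrow> brp N I S 1 (br i j)"
  using brp.br[OF _ _ brp.const[of N I S 1], of i j] by simp

lemma brp_inv: "i \<in> S \<Longrightarrow> brp N I S (-1) (\<lambda>u w. 1 / br i (Suc i mod N) u w)"
  using brp.inv[OF _ brp.const[of N I S 1], of i] by simp

lemma brp_power: "brp N I S d g \<Longrightarrow> brp N I S (int n * d) (\<lambda>u w. g u w ^ n)"
proof (induction n)
  case 0
  show ?case using brp.const[of N I S 1] by simp
next
  case (Suc n)
  then show ?case using brp_mult[OF Suc.prems Suc.IH[OF Suc.prems]] by (simp add: algebra_simps)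
qed

lemma brp_prod:
  "finite A \<Longrightarrow> (\<And>x. x \<in> A \<Longrightarrow> brp N I S (d x) (g x)) \<Longrightarrow>
    brp N I S (\<Sum>x\<in>A. d x) (\<lambda>u w. \<Prod>x\<in>A. g x u w)"
proof (induction rule: finite_induct)
  case empty
  then show ?case using brp.const[of N I S 1] by simp
next
  case (insert x A)
  then show ?case using brp_mult[of N I S "d x" "g x"] by simp
qed

lemma brp_power_int:
  assumes "n \<ge> 0 \<Longrightarrow> i \<in> I \<and> Suc i mod N \<in> I" "n < 0 \<Longrightarrow> i \<in> S"
  shows "brp N I S n (\<lambda>u w. br i (Suc i mod N) u w powi n)"
proof (cases "n \<ge> 0")
  case True
  then show ?thesis
    using brp_power[OF brp_br[of i I "Suc i mod N" N S], of "nat n"] assms(1)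
    by (simp add: power_int_def)
next
  case False
  then show ?thesis
    using brp_power[OF brp_inv[of i S N I], of "nat (-n)"] assms(2)
    by (simp add: power_int_def power_one_over inverse_eq_divide)
qed

text \<open>This holds a coefficient fixed while the single vertex \<open>x\<close> moves.\<close>

lemma brp_independent:
  assumes "brp N I S d g" "x \<notin> I" "\<And>i. i \<in> S \<Longrightarrow> i \<noteq> x \<and> Suc i mod N \<noteq> x"
    and "\<And>i. i \<noteq> x \<Longrightarrow> u' i = u i \<and> w' i = w i"
  shows "g u' w' = g u w"
  using assms(1)
proof (induction rule: brp.induct)
  case (br i j d g)
  then have "i \<noteq> x" "j \<noteq> x" using assms(2) by auto
  then show ?case using br assms(4) by (simp add: br_def)
next
  case (inv i d g)
  then show ?case using assms(3)[OF inv(1)] assms(4) by (simp add: br_def)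
qed simp

lemma cyc_nonzero: "cyc N u w \<noteq> 0 \<Longrightarrow> i < N \<Longrightarrow> br i (Suc i mod N) u w \<noteq> 0"
  by (auto simp: cyc_def)

text \<open>Multiplying numerator and denominator by the other \<open>N - 1\<close> sides turns an
  inverted side into an inverted cyclic product.\<close>

lemma brp_normal_form:
  assumes "brp N {..<N} {..<N} d g" "N > 0"
  shows "\<exists>c ps k. set ps \<subseteq> {..<N} \<times> {..<N} \<and> int (length ps) = d + int (k * N) \<and>
    (\<forall>u w. cyc N u w \<noteq> 0 \<longrightarrow> g u w = c * (\<Prod>(i, j)\<leftarrow>ps. br i j u w) / cyc N u w ^ k)"
  using assms(1)
proof (induction rule: brp.induct)
  case (const c)
  show ?case by (intro exI[of _ c] exI[of _ "[]"] exI[of _ 0]) auto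
next
  case (br i j d g)
  then obtain c ps k where "set ps \<subseteq> {..<N} \<times> {..<N}" "int (length ps) = d + int (k * N)"
    "\<forall>u w. cyc N u w \<noteq> 0 \<longrightarrow> g u w = c * (\<Prod>(i, j)\<leftarrow>ps. br i j u w) / cyc N u w ^ k"
    by auto
  then show ?case using br(1,2)
    by (intro exI[of _ c] exI[of _ "(i, j) # ps"] exI[of _ k]) auto
next
  case (inv l d g)
  then obtain c ps k where *: "set ps \<subseteq> {..<N} \<times> {..<N}" "int (length ps) = d + int (k * N)"
    "\<forall>u w. cyc N u w \<noteq> 0 \<longrightarrow> g u w = c * (\<Prod>(i, j)\<leftarrow>ps. br i j u w) / cyc N u w ^ k"
    by auto
  define qs where "qs = map (\<lambda>i. (i, Suc i mod N)) (remove1 l [0..<N])"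
  have l: "l < N" using inv by simp
  have len: "length qs = N - 1" using l by (simp add: qs_def length_remove1)
  have set: "set qs \<subseteq> {..<N} \<times> {..<N}" using assms(2) by (auto simp: qs_def)
  have pr: "(\<Prod>(i, j)\<leftarrow>qs. br i j u w) * br l (Suc l mod N) u w = cyc N u w" for u w
  proof -
    have "(\<Prod>(i, j)\<leftarrow>qs. br i j u w) = (\<Prod>i\<leftarrow>remove1 l [0..<N]. br i (Suc i mod N) u w)"
      by (simp add: qs_def o_def)
    also have "\<dots> = (\<Prod>i\<in>{..<N} - {l}. br i (Suc i mod N) u w)"
      by (subst prod.distinct_set_conv_list[symmetric]) (auto simp: set_remove1_eq lessThan_atLeast0)
    finally show ?thesis
      using l by (simp add: cyc_def prod.remove[of "{..<N}" l] mult.commute)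
  qed
  show ?case
  proof (intro exI conjI allI impI)
    show "set (ps @ qs) \<subseteq> {..<N} \<times> {..<N}" using * set by auto
    show "int (length (ps @ qs)) = d - 1 + int (Suc k * N)"
      using * len assms(2) by (simp add: of_nat_diff)
    fix u w assume c: "cyc N u w \<noteq> 0"
    let ?Q = "\<Prod>(i, j)\<leftarrow>qs. br i j u w"
    have "?Q \<noteq> 0" using c pr[of u w] by auto
    then have "g u w / br l (Suc l mod N) u w =
        c * (\<Prod>(i, j)\<leftarrow>ps. br i j u w) / cyc N u w ^ k * (?Q / (?Q * br l (Suc l mod N) u w))"
      using *(3) c by simp
    then show "g u w / br l (Suc l mod N) u w =
        c * (\<Prod>(i, j)\<leftarrow>ps @ qs. br i j u w) / cyc N u w ^ Suc k"
      unfolding pr by (simp add: mult_ac)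
  qed
qed

text \<open>Since the side starting at \<open>a\<close> is not inverted, \<open>a\<close> occurs in
  denominators only through the preceding side \<open>[p, a]\<close>. The integer power of that side
  is collected in \<open>n\<close>; the remaining brackets at \<open>a\<close> are numerators and go
  to \<open>js\<close>.\<close>

lemma brp_extract:
  assumes "brp N I S d F" "a < N" "a \<notin> S" "S \<subseteq> {..<N}"
  defines "p \<equiv> (a + N - 1) mod N"
  shows "\<exists>c e n js. brp N (I - {a}) (S - {p}) e c \<and> set js \<subseteq> I \<and> d = e + n + int (length js) \<and>
    (\<forall>u w. cyc N u w \<noteq> 0 \<longrightarrow> F u w = c u w * br p a u w powi n * (\<Prod>j\<leftarrow>js. br j a u w))"
  using assms(1)
proof (induction rule: brp.induct)
  case (const c)
  show ?case
    by (intro exI[of _ "\<lambda>u w. c"] exI[of _ 0] exI[of _ "0::int"] exI[of _ "[]"]) (auto intro: brp.const)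
next
  case (br i j d g)
  then obtain c e n js where *: "brp N (I - {a}) (S - {p}) e c" "set js \<subseteq> I" "d = e + n + int (length js)"
    "\<forall>u w. cyc N u w \<noteq> 0 \<longrightarrow> g u w = c u w * br p a u w powi n * (\<Prod>j\<leftarrow>js. br j a u w)"
    by blast
  consider "j = a" | "i = a" | "i \<noteq> a" "j \<noteq> a" by auto
  then show ?case
  proof cases
    case 1
    then show ?thesis using * br(1)
      by (intro exI[of _ c] exI[of _ e] exI[of _ n] exI[of _ "i # js"]) (auto simp: mult_ac)
  next
    case 2
    then show ?thesis using * br(2) brp_scale[OF *(1), of "-1"]
      by (intro exI[of _ "\<lambda>u w. - 1 * c u w"] exI[of _ e] exI[of _ n] exI[of _ "j # js"])
        (auto simp: mult_ac br_swap[of a j])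
  next
    case 3
    then show ?thesis using * brp.br[OF _ _ *(1), of i j] br(1,2)
      by (intro exI[of _ "\<lambda>u w. br i j u w * c u w"] exI[of _ "e + 1"] exI[of _ n] exI[of _ js])
        (auto simp: mult_ac)
  qed
next
  case (inv i d g)
  then obtain c e n js where *: "brp N (I - {a}) (S - {p}) e c" "set js \<subseteq> I" "d = e + n + int (length js)"
    "\<forall>u w. cyc N u w \<noteq> 0 \<longrightarrow> g u w = c u w * br p a u w powi n * (\<Prod>j\<leftarrow>js. br j a u w)"
    by blast
  show ?case
  proof (cases "i = p")
    case True
    have "p < N" using assms(2) by (simp add: p_def)
    have "Suc p mod N = a" using assms(2) unfolding p_def by (simp add: mod_Suc_eq)
    moreover have "br p a u w \<noteq> 0" if "cyc N u w \<noteq> 0" for u w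
      using cyc_nonzero[OF that \<open>p < N\<close>] calculation by simp
    ultimately show ?thesis using * True
      by (intro exI[of _ c] exI[of _ e] exI[of _ "n - 1"] exI[of _ js])
        (auto simp: power_int_diff)
  next
    case False
    then show ?thesis using * brp.inv[OF _ *(1), of i] inv(1)
      by (intro exI[of _ "\<lambda>u w. c u w / br i (Suc i mod N) u w"] exI[of _ "e - 1"] exI[of _ n] exI[of _ js])
        auto
  qed
qed

section \<open>Invariant functionals on the complement of the cyclic section\<close>

text \<open>These are the properties of \<open>J\<close> that the reduction to
  \<open>1 / cyc\<close> needs, separated from the differential system they come from. Values at
  zeros of the section are left free by \<open>cong\<close>, and \<open>invariant\<close> also says
  that derivatives along the flow stay in the domain \<open>A\<close>.\<close>

locale invariant_functional =
  fixes N :: nat and A :: "pfun set" and J :: "pfun \<Rightarrow> complex"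
  assumes N2: "N \<ge> 2"
    and brackets: "\<And>k ps. length ps = k * N \<Longrightarrow> set ps \<subseteq> {..<N} \<times> {..<N} \<Longrightarrow>
      (\<lambda>u w. (\<Prod>(i, j)\<leftarrow>ps. br i j u w) / cyc N u w ^ Suc k) \<in> A"
    and cong: "\<And>g h. g \<in> A \<Longrightarrow> (\<And>u w. cyc N u w \<noteq> 0 \<Longrightarrow> g u w = h u w) \<Longrightarrow> h \<in> A \<and> J h = J g"
    and add: "\<And>g h. g \<in> A \<Longrightarrow> h \<in> A \<Longrightarrow>
      (\<lambda>u w. g u w + h u w) \<in> A \<and> J (\<lambda>u w. g u w + h u w) = J g + J h"
    and scale: "\<And>g c. g \<in> A \<Longrightarrow> (\<lambda>u w. c * g u w) \<in> A \<and> J (\<lambda>u w. c * g u w) = c * J g"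
    and invariant: "\<And>g h X. g \<in> A \<Longrightarrow> (\<Sum>i<N. X i i) = 0 \<Longrightarrow>
      (\<And>u w. cyc N u w \<noteq> 0 \<Longrightarrow>
        ((\<lambda>t. g (flow N X t u) (flow N X t w)) has_field_derivative h u w) (at 0)) \<Longrightarrow> h \<in> A \<and> J h = 0"
begin

lemma brp_in: 
  assumes "brp N I S (- int N) g" "I \<subseteq> {..<N}" "S \<subseteq> {..<N}"
  shows "g \<in> A"
proof -
  have "brp N {..<N} {..<N} (- int N) g" using brp_mono[OF assms] .
  then obtain c ps k where *: "set ps \<subseteq> {..<N} \<times> {..<N}" "int (length ps) = - int N + int (k * N)"
    "\<forall>u w. cyc N u w \<noteq> 0 \<longrightarrow> g u w = c * (\<Prod>(i, j)\<leftarrow>ps. br i j u w) / cyc N u w ^ k"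
    using brp_normal_form[of N "- int N" g] N2 by auto
  obtain k' where k: "k = Suc k'" using *(2) N2 by (cases k) auto
  have "length ps = k' * N" using *(2) k by (simp flip: of_nat_mult)
  then have "(\<lambda>u w. c * ((\<Prod>(i, j)\<leftarrow>ps. br i j u w) / cyc N u w ^ Suc k')) \<in> A"
    using brackets[of ps k'] *(1) scale by blast
  then show ?thesis by (rule cong[THEN conjunct1]) (use * k in auto)
qed

lemma J_cong: "g \<in> A \<Longrightarrow> (\<And>u w. cyc N u w \<noteq> 0 \<Longrightarrow> g u w = h u w) \<Longrightarrow> J h = J g"
  using cong by blast

lemma flow_elementary:
  assumes "a < N" "p < N"
  shows "flow N (\<lambda>i k. if i = a \<and> k = p then 1 else 0) t u = u(a := u a + t * u p)"
proof
  fix i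
  have "(\<Sum>k<N. (if i = a \<and> k = p then 1 else 0) * u k) = (if i = a then u p else 0)"
    using assms(2) by (cases "i = a") (simp_all add: if_distribR if_distrib[where f="\<lambda>x. x * _"] cong: if_cong)
  then show "flow N (\<lambda>i k. if i = a \<and> k = p then 1 else 0) t u i = (u(a := u a + t * u p)) i"
    by (simp add: flow_def)
qed

section \<open>Shortening an arc\<close>

definition arc_int :: "nat \<Rightarrow> nat \<Rightarrow> nat set" where
  "arc_int a l = (\<lambda>k. (a + k) mod N) ` {0<..<l}"

definition arc_sides :: "nat \<Rightarrow> nat \<Rightarrow> nat set" where
  "arc_sides a l = (\<lambda>k. (a + k) mod N) ` {..<l}"

lemma residue_eq_iff: "k < N \<Longrightarrow> k' < N \<Longrightarrow> (a + k) mod N = (a + k') mod N \<longleftrightarrow> k = k'"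
proof -
  have "False" if "k < k'" "k' < N" "(a + k) mod N = (a + k') mod N" for k k'
  proof -
    have "N dvd (a + k') - (a + k)" using that by (metis mod_eq_dvd_iff_nat add_le_mono le_refl less_imp_le)
    then show False using that by (auto dest: dvd_imp_le)
  qed
  then show "k < N \<Longrightarrow> k' < N \<Longrightarrow> (a + k) mod N = (a + k') mod N \<longleftrightarrow> k = k'"
    by (metis linorder_neqE_nat)
qed

text \<open>Moving the vertex \<open>a\<close> of the arc from \<open>a\<close> to \<open>a + l\<close> in the direction of the vertex \<open>a - 1\<close>
  differentiates the arc factor into one for the shorter arc from \<open>a + 1\<close> to \<open>a + l\<close>.\<close>

lemma arc_zero:
  assumes "1 \<le> l" "l + 2 \<le> N"
    and "brp N ({..<N} - arc_int a l) ({..<N} - arc_sides a l) (int l - 1 - int N) F"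
  shows "J (\<lambda>u w. F u w * (br (a mod N) ((a + l) mod N) u w /
    (\<Prod>k<l. br ((a + k) mod N) (Suc (a + k) mod N) u w))) = 0"
  using assms
proof (induction l arbitrary: a F)
  case 0
  then show ?case by simp
next
  case (Suc l)
  define r where "r k = (a + k) mod N" for k
  define I where "I = {..<N} - arc_int a (Suc l)"
  define S where "S = {..<N} - arc_sides a (Suc l)"
  \<comment> \<open>These are the vertices \<open>a - 1\<close> and \<open>a - 2\<close>. The bound
    on the length keeps \<open>p2\<close> from lying inside the arc; it may coincide with the far
    end \<open>r (Suc l)\<close>.\<close>
  define p1 where "p1 = r (N - 1)"
  define p2 where "p2 = r (N - 2)"
  define I' where "I' = I - {r 0}"
  define S' where "S' = S - {p1}"
  define P' where "P' u w = (\<Prod>k<l. br (r (Suc k)) (r (Suc (Suc k))) u w)" for u w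
  define T where "T u w = br (r 0) (r (Suc l)) u w / (br (r 0) (r 1) u w * P' u w)" for u w
  have rN: "r k < N" for k using N2 by (simp add: r_def)
  have sr: "Suc (r k) mod N = r (Suc k)" for k by (simp add: r_def mod_Suc_eq)
  have rr: "r k = r k' \<longleftrightarrow> k = k'" if "k < N" "k' < N" for k k'
    unfolding r_def by (rule residue_eq_iff[OF that])
  have rNN: "r N = r 0" by (simp add: r_def)
  have N3: "3 \<le> N" and lN: "Suc l + 2 \<le> N" using Suc.prems by auto
  have Im: "r k \<in> I \<longleftrightarrow> k = 0 \<or> Suc l \<le> k" if "k < N" for k
    using that lN rN by (auto simp: I_def arc_int_def r_def[symmetric] rr)
  have Sm: "r k \<in> S \<longleftrightarrow> Suc l \<le> k" if "k < N" for k
    using that lN rN by (auto simp: S_def arc_sides_def r_def[symmetric] rr)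
  have sp1: "Suc p1 mod N = r 0" using N3 by (simp add: p1_def sr rNN)
  have sp2: "Suc p2 mod N = p1" using N3 by (simp add: p1_def p2_def sr Suc_diff_Suc numeral_2_eq_2)
  have p1N: "p1 < N" "p2 < N" by (simp_all add: p1_def p2_def rN)
  have pI: "p1 \<in> I'" "p2 \<in> I'" "p2 \<in> S'" "r 0 \<in> I" "r 0 \<notin> I'" "r 0 \<notin> S'" "p1 \<notin> S'" "r 0 \<notin> S"
    "p1 \<in> S"
    using N3 lN by (auto simp: I'_def S'_def p1_def p2_def Im Sm rr)
  have II: "I' \<subseteq> {..<N}" "S' \<subseteq> {..<N}" "I \<subseteq> {..<N}" "S \<subseteq> {..<N}" "I' \<subseteq> I" "S' \<subseteq> S"
    by (auto simp: I'_def S'_def I_def S_def)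
  have T: "brp N {..<N} {..<N} (- int l) T"
  proof -
    have "brp N {..<N} {..<N} (\<Sum>k<l. -1) (\<lambda>u w. \<Prod>k<l. 1 / br (r (Suc k)) (Suc (r (Suc k)) mod N) u w)"
      by (intro brp_prod brp_inv) (auto simp: rN)
    moreover have "brp N {..<N} {..<N} (1 + -1) (\<lambda>u w. br (r 0) (r (Suc l)) u w * (1 / br (r 0) (Suc (r 0) mod N) u w))"
      by (intro brp_mult brp_br brp_inv) (auto simp: rN)
    ultimately have "brp N {..<N} {..<N} (1 + -1 + (\<Sum>k<l. -1)) 
      (\<lambda>u w. br (r 0) (r (Suc l)) u w * (1 / br (r 0) (Suc (r 0) mod N) u w) *
        (\<Prod>k<l. 1 / br (r (Suc k)) (Suc (r (Suc k)) mod N) u w))"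
      by (rule brp_mult[rotated])
    then show ?thesis by (simp add: T_def[abs_def] P'_def sr prod_dividef)
  qed
  \<comment> \<open>Normal form with respect to the moved vertex \<open>r 0\<close>:
    \<open>c\<close> will not involve it, \<open>n\<close> may be negative, and \<open>js\<close>
    lists the brackets at \<open>r 0\<close> not yet expressed through \<open>p1\<close> and
    \<open>p2\<close>.\<close>
  define R where "R c n m js u w = c u w * br p1 (r 0) u w powi n * br p2 (r 0) u w ^ m *
    (\<Prod>j\<leftarrow>js. br j (r 0) u w) * T u w" for c :: pfun and n :: int and m js u w
  have R: "R c n m js \<in> A"
    if c: "brp N I' S' e c" and js: "set js \<subseteq> I" and d: "e + n + int m + int (length js) = int l - int N"
    for c e n m js
  proof -
    have jsp: "brp N {..<N} {..<N} (int (length js)) (\<lambda>u w. \<Prod>j\<leftarrow>js. br j (r 0) u w)"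
      using js
    proof (induction js)
      case Nil
      then show ?case using brp.const[of N _ _ 1] by simp
    next
      case (Cons j js)
      then have "j < N" using II by auto
      moreover have "brp N {..<N} {..<N} (int (length js)) (\<lambda>u w. \<Prod>j\<leftarrow>js. br j (r 0) u w)"
        using Cons by simp
      ultimately have "brp N {..<N} {..<N} (int (length js) + 1)
          (\<lambda>u w. br j (r 0) u w * (\<Prod>j\<leftarrow>js. br j (r 0) u w))"
        using rN by (intro brp.br) auto
      then show ?case by (simp add: add_ac)
    qed
    have "brp N {..<N} {..<N} (e + n + int m * 1 + int (length js) + - int l) (R c n m js)"
      unfolding R_def using p1N rN
      by (intro brp_mult T jsp brp_power brp_br brp_mono[OF c II(1,2)]
          brp_power_int[of n p1 "{..<N}" N, unfolded sp1]) auto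
    moreover have "e + n + int m * 1 + int (length js) + - int l = - int N" using d by simp
    ultimately have "brp N {..<N} {..<N} (- int N) (R c n m js)" by (simp only:)
    then show ?thesis by (rule brp_in) auto
  qed
  \<comment> \<open>Insert a factor \<open>[p2, r 0] / [p2, p1]\<close> and move \<open>r 0\<close>
    along \<open>p1\<close>. Differentiating the power of \<open>[p2, r 0]\<close> returns
    \<open>m + 1\<close> copies of the wanted function, a nonzero number even for
    \<open>m = 0\<close>; differentiating the arc factor gives \<open>W\<close>, which belongs to
    the shorter arc.\<close>
  have main: "J (R c n m []) = 0"
    if c: "brp N I' S' e c" and d: "e + n + int m = int l - int N" for c e n m
  proof -
    define c' where "c' u w = c u w / br p2 p1 u w" for u w
    have c': "brp N I' S' (e - 1) c'"
      unfolding c'_def using brp.inv[OF pI(3) c] by (simp add: sp2)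
    define K where "K u w = c' u w * br p1 (r 0) u w powi n" for u w
    define W where "W u w = (- 1 * c' u w * br p1 (r 0) u w powi (n + 1) * br p2 (r 0) u w ^ Suc m *
        (1 / br (r 0) (r 1) u w) ^ 2) * (br (r 1) (r (Suc l)) u w / P' u w)" for u w
    have Y: "R c' n (Suc m) [] \<in> A" by (rule R[OF c']) (use d in auto)
    \<comment> \<open>For \<open>l = 0\<close> the shorter arc is a point and \<open>W\<close>
      vanishes because \<open>[r 1, r 1] = 0\<close>. Otherwise the induction hypothesis applies to
      the arc starting at \<open>a + 1\<close>.\<close>
    have W0: "J W = 0 \<and> W \<in> A"
    proof (cases "l = 0")
      case True
      have "W = (\<lambda>u w. 0 * R c' n (Suc m) [] u w)" by (simp add: W_def[abs_def] True)
      then show ?thesis using scale[OF Y, of 0] by simp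
    next
      case False
      have eq1: "(Suc a + k) mod N = r (Suc k)" for k by (simp add: r_def)
      have AI: "arc_int (Suc a) l = (\<lambda>k. r (Suc k)) ` {0<..<l}" "arc_int a (Suc l) = r ` {0<..<Suc l}"
        unfolding arc_int_def eq1 by (simp_all add: r_def)
      have AS: "arc_sides (Suc a) l = (\<lambda>k. r (Suc k)) ` {..<l}" "arc_sides a (Suc l) = r ` {..<Suc l}"
        unfolding arc_sides_def eq1 by (simp_all add: r_def)
      \<comment> \<open>The new factors in \<open>W\<close> belong to the sides
        \<open>[p1, r 0]\<close> and \<open>[r 0, r 1]\<close>. They are admissible for the shorter
        arc: both sides lie outside it, and \<open>r 1\<close> is now one of its end points.\<close>
      have sub: "I' \<union> {r 0, r 1} \<subseteq> {..<N} - arc_int (Suc a) l"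
        using lN rN by (auto simp: AI I'_def I_def rr)
      have sub': "S' \<union> {r 0, p1} \<subseteq> {..<N} - arc_sides (Suc a) l"
        using lN rN p1N by (auto simp: AS S'_def S_def p1_def rr)
      have "brp N (I' \<union> {r 0, r 1}) (S' \<union> {r 0, p1}) (e - 1 + (n + 1) + int (Suc m) * 1 + int 2 * -1)
        (\<lambda>u w. - 1 * c' u w * br p1 (r 0) u w powi (n + 1) * br p2 (r 0) u w ^ Suc m *
          (1 / br (r 0) (r 1) u w) ^ 2)"
        using pI
        by (intro brp_mult brp_power brp_br brp_scale[where c="-1"] brp_mono[OF c']
            brp_power_int[of "n + 1" p1 _ N, unfolded sp1] brp_inv[of "r 0" _ N, unfolded sr, folded One_nat_def]) auto
      note brp_mono[OF this sub sub']
      moreover have "e - 1 + (n + 1) + int (Suc m) * 1 + int 2 * -1 = int l - 1 - int N" using d by simp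
      ultimately have "brp N ({..<N} - arc_int (Suc a) l) ({..<N} - arc_sides (Suc a) l) (int l - 1 - int N)
        (\<lambda>u w. - 1 * c' u w * br p1 (r 0) u w powi (n + 1) * br p2 (r 0) u w ^ Suc m *
          (1 / br (r 0) (r 1) u w) ^ 2)" by (simp only:)
      from Suc.IH[OF _ _ this] False lN
      have J: "J W = 0"
        by (simp add: W_def[abs_def] P'_def r_def)
      have P: "brp N {..<N} {..<N} (\<Sum>k<l. -1) (\<lambda>u w. \<Prod>k<l. 1 / br (r (Suc k)) (Suc (r (Suc k)) mod N) u w)"
        by (intro brp_prod brp_inv) (auto simp: rN)
      let ?d = "(e - 1 + (n + 1) + int (Suc m) * 1 + int 2 * -1) + (1 + (\<Sum>k<l. -1))"
      have "brp N {..<N} {..<N} ?d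
        (\<lambda>u w. (- 1 * c' u w * br p1 (r 0) u w powi (n + 1) * br p2 (r 0) u w ^ Suc m *
          (1 / br (r 0) (r 1) u w) ^ 2) *
          (br (r 1) (r (Suc l)) u w * (\<Prod>k<l. 1 / br (r (Suc k)) (Suc (r (Suc k)) mod N) u w)))"
        using p1N rN II
        by (intro brp_mult brp_power brp_br P brp_scale[where c="-1"] brp_mono[OF c']
            brp_power_int[of "n + 1" p1 _ N, unfolded sp1] brp_inv[of "r 0" _ N, unfolded sr, folded One_nat_def]) auto
      moreover have "?d = - int N" using d by simp
      moreover have "(\<lambda>u w. (- 1 * c' u w * br p1 (r 0) u w powi (n + 1) * br p2 (r 0) u w ^ Suc m *
          (1 / br (r 0) (r 1) u w) ^ 2) *
          (br (r 1) (r (Suc l)) u w * (\<Prod>k<l. 1 / br (r (Suc k)) (Suc (r (Suc k)) mod N) u w))) = W"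
        by (simp add: W_def[abs_def] P'_def sr prod_dividef)
      ultimately have "brp N {..<N} {..<N} (- int N) W" by (simp only:)
      then show ?thesis using J brp_in by blast
    qed
    define h where "h u w = of_nat (Suc m) * R c n m [] u w + W u w" for u w
    define X where "X = (\<lambda>i k. if i = r 0 \<and> k = p1 then 1 else (0::complex))"
    have X0: "(\<Sum>i<N. X i i) = 0" using pI by (intro sum.neutral) (auto simp: X_def)
    have "h \<in> A \<and> J h = 0"
    proof (rule invariant[OF Y, where X=X, OF X0])
      fix u w assume om: "cyc N u w \<noteq> 0"
      define u' where "u' t = u(r 0 := u (r 0) + t * u p1)" for t
      define w' where "w' t = w(r 0 := w (r 0) + t * w p1)" for t
      have fl: "flow N X t u = u' t" "flow N X t w = w' t" for t
        unfolding X_def u'_def w'_def by (rule flow_elementary; simp add: rN p1N)+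
      have pr1: "i = p1" if "i < N" "Suc i mod N = r 0" for i
        using that p1N sp1 by (auto simp: mod_Suc split: if_splits)
      have nz: "br (r 0) (r 1) u w \<noteq> 0" using cyc_nonzero[OF om rN, of 0] by (simp add: sr)
      have nz2: "br p2 p1 u w \<noteq> 0" using cyc_nonzero[OF om p1N(2)] by (simp add: sp2)
      have nz3: "br p1 (r 0) u w \<noteq> 0" using cyc_nonzero[OF om p1N(1)] by (simp add: sp1)
      have nzP: "P' u w \<noteq> 0" unfolding P'_def using cyc_nonzero[OF om rN] by (simp add: sr)
      have ci: "c' (u' t) (w' t) = c' u w" for t
        by (rule brp_independent[OF c', of "r 0"])
          (use pI pr1 II in \<open>auto simp: u'_def w'_def\<close>)
      have b0: "br p1 (r 0) (u' t) (w' t) = br p1 (r 0) u w" for t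
        using pI by (auto simp: br_def u'_def w'_def algebra_simps)
      have b1: "br p2 (r 0) (u' t) (w' t) = br p2 (r 0) u w + t * br p2 p1 u w" for t
        using pI by (auto simp: br_def u'_def w'_def algebra_simps)
      have b2: "br (r 0) (r (Suc l)) (u' t) (w' t) = br (r 0) (r (Suc l)) u w + t * br p1 (r (Suc l)) u w" for t
        using lN by (auto simp: br_def u'_def w'_def algebra_simps rr)
      have b3: "br (r 0) (r 1) (u' t) (w' t) = br (r 0) (r 1) u w + t * br p1 (r 1) u w" for t
        using lN by (auto simp: br_def u'_def w'_def algebra_simps rr)
      have b4: "P' (u' t) (w' t) = P' u w" for t
        unfolding P'_def using lN by (intro prod.cong refl) (auto simp: br_def u'_def w'_def rr)
      have "R c' n (Suc m) [] (flow N X t u) (flow N X t w) =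
          K u w * (br p2 (r 0) u w + t * br p2 p1 u w) ^ Suc m *
          ((br (r 0) (r (Suc l)) u w + t * br p1 (r (Suc l)) u w) /
           ((br (r 0) (r 1) u w + t * br p1 (r 1) u w) * P' u w))" for t
        by (simp only: R_def T_def fl ci b0 b1 b2 b3 b4 K_def) simp
      moreover have "h u w = K u w * (of_nat (Suc m) * br p2 (r 0) u w ^ m * br p2 p1 u w) *
          (br (r 0) (r (Suc l)) u w / (br (r 0) (r 1) u w * P' u w)) +
          K u w * br p2 (r 0) u w ^ Suc m *
          ((br p1 (r (Suc l)) u w * br (r 0) (r 1) u w - br (r 0) (r (Suc l)) u w * br p1 (r 1) u w) /
           ((br (r 0) (r 1) u w)^2 * P' u w))"
      proof -
        \<comment> \<open>The numerator of the quotient rule collapses by the Plucker relation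
          between \<open>p1\<close>, \<open>r 0\<close>, \<open>r 1\<close> and
          \<open>r (Suc l)\<close>; here the shorter bracket appears.\<close>
        have e1: "br p1 (r (Suc l)) u w * br (r 0) (r 1) u w - br (r 0) (r (Suc l)) u w * br p1 (r 1) u w
          = - (br p1 (r 0) u w * br (r 1) (r (Suc l)) u w)"
          by (simp add: br_def algebra_simps)
        have e2: "c u w = c' u w * br p2 p1 u w" using nz2 by (simp add: c'_def)
        show ?thesis unfolding e1 h_def R_def W_def T_def K_def e2
          using nz nzP nz3 by (simp add: power_int_add power_one_over power2_eq_square field_simps)
      qed
      ultimately show "((\<lambda>t. R c' n (Suc m) [] (flow N X t u) (flow N X t w)) has_field_derivative h u w) (at 0)"
        using nz nzP
        by (simp only:) (rule derivative_eq_intros refl | simp add: field_simps power2_eq_square)+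
    qed
    then have "J h = 0" by simp
    moreover have "J h = of_nat (Suc m) * J (R c n m []) + J W"
    proof -
      have Rc: "R c n m [] \<in> A" by (rule R[OF c]) (use d in auto)
      show ?thesis
        unfolding h_def using add[OF scale[OF Rc, THEN conjunct1, of "of_nat (Suc m)"] W0[THEN conjunct2]]
          scale[OF Rc, of "of_nat (Suc m)"] by simp
    qed
    ultimately show ?thesis using W0 by (simp del: of_nat_Suc)
  qed
  \<comment> \<open>Each bracket \<open>[j, r 0]\<close> is a combination of
    \<open>[p1, r 0]\<close> and \<open>[p2, r 0]\<close> over \<open>[p2, p1]\<close>, a side that
    may be inverted. The induction trades one entry of \<open>js\<close> for a larger
    \<open>n\<close> or \<open>m\<close>.\<close>
  have gen: "J (R c n m js) = 0"
    if "brp N I' S' e c" "set js \<subseteq> I" "e + n + int m + int (length js) = int l - int N" for c e n m js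
    using that
  proof (induction js arbitrary: c e n m)
    case Nil
    then show ?case by (intro main) auto
  next
    case (Cons j js)
    show ?case
    proof (cases "j = r 0")
      case True
      have "R c n m (j # js) = (\<lambda>u w. 0 * R c n m (j # js) u w)"
        by (simp add: R_def[abs_def] True)
      moreover have "J (\<lambda>u w. 0 * R c n m (j # js) u w) = 0 * J (R c n m (j # js))"
        by (rule scale[THEN conjunct2], rule R[OF Cons.prems])
      ultimately show ?thesis by simp
    next
      case False
      then have jI: "j \<in> I'" using Cons.prems(2) by (simp add: I'_def)
      define c1 where "c1 u w = br j p1 u w * (c u w / br p2 p1 u w)" for u w
      define c2 where "c2 u w = - 1 * (br j p2 u w * (c u w / br p2 p1 u w))" for u w
      have ce: "brp N I' S' (e - 1) (\<lambda>u w. c u w / br p2 p1 u w)"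
        using brp.inv[OF pI(3) Cons.prems(1)] by (simp add: sp2)
      have c1: "brp N I' S' e c1" unfolding c1_def
        using brp.br[OF jI pI(1) ce] by simp
      have c2: "brp N I' S' e c2" unfolding c2_def
        using brp_scale[OF brp.br[OF jI pI(2) ce], of "-1"] by simp
      have d1: "e + n + int (Suc m) + int (length js) = int l - int N"
        "e + (n + 1) + int m + int (length js) = int l - int N"
        "set js \<subseteq> I"
        using Cons.prems by auto
      have "J (\<lambda>u w. R c1 n (Suc m) js u w + R c2 (n + 1) m js u w) = 0"
        using add[OF R[OF c1 d1(3,1)] R[OF c2 d1(3,2)]] Cons.IH[OF c1 d1(3,1)] Cons.IH[OF c2 d1(3,2)]
        by simp
      moreover have "J (R c n m (j # js)) = J (\<lambda>u w. R c1 n (Suc m) js u w + R c2 (n + 1) m js u w)"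
      proof (rule J_cong)
        show "(\<lambda>u w. R c1 n (Suc m) js u w + R c2 (n + 1) m js u w) \<in> A"
          using add[OF R[OF c1 d1(3,1)] R[OF c2 d1(3,2)]] by simp
        fix u w assume om: "cyc N u w \<noteq> 0"
        have nz2: "br p2 p1 u w \<noteq> 0" using cyc_nonzero[OF om p1N(2)] by (simp add: sp2)
        have nz3: "br p1 (r 0) u w \<noteq> 0" using cyc_nonzero[OF om p1N(1)] by (simp add: sp1)
        have "br j (r 0) u w * br p2 p1 u w =
            br j p1 u w * br p2 (r 0) u w - br j p2 u w * br p1 (r 0) u w"
          by (simp add: br_def algebra_simps)
        then have "br j (r 0) u w = (br j p1 u w * br p2 (r 0) u w - br j p2 u w * br p1 (r 0) u w) / br p2 p1 u w"
          using nz2 by (simp add: field_simps)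
        moreover have "R c1 n (Suc m) js u w + R c2 (n + 1) m js u w =
            c u w * br p1 (r 0) u w powi n * br p2 (r 0) u w ^ m *
            ((br j p1 u w * br p2 (r 0) u w - br j p2 u w * br p1 (r 0) u w) / br p2 p1 u w) *
            (\<Prod>j\<leftarrow>js. br j (r 0) u w) * T u w"
          using nz2 nz3 by (simp add: R_def c1_def c2_def power_int_add divide_simps) (simp add: algebra_simps)
        ultimately show "R c1 n (Suc m) js u w + R c2 (n + 1) m js u w = R c n m (j # js) u w"
          by (simp add: R_def mult_ac)
      qed
      ultimately show ?thesis by simp
    qed
  qed
  have F: "brp N I S (int l - int N) F" using Suc.prems(3) by (simp add: I_def S_def)
  have "(r 0 + N - 1) mod N = p1"
  proof -
    have "(r 0 + N - 1) mod N = (a mod N + (N - 1)) mod N" using N2 by (simp add: r_def)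
    then show ?thesis by (simp add: p1_def r_def mod_add_left_eq)
  qed
  from brp_extract[OF F rN pI(8) II(4), unfolded this]
  obtain c e n js where *: "brp N I' S' e c" "set js \<subseteq> I" "int l - int N = e + n + int (length js)"
    "\<forall>u w. cyc N u w \<noteq> 0 \<longrightarrow> F u w = c u w * br p1 (r 0) u w powi n * (\<Prod>j\<leftarrow>js. br j (r 0) u w)"
    unfolding I'_def S'_def by blast
  have dd: "e + n + int 0 + int (length js) = int l - int N" using * by simp
  have PP: "(\<Prod>k<Suc l. br ((a + k) mod N) (Suc (a + k) mod N) u w) = br (r 0) (r 1) u w * P' u w" for u w
    by (simp add: prod.lessThan_Suc_shift P'_def r_def del: prod.lessThan_Suc)
  have "J (\<lambda>u w. F u w * (br (r 0) (r (Suc l)) u w / (br (r 0) (r 1) u w * P' u w))) = J (R c n 0 js)"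
    by (rule J_cong[OF R[OF *(1,2) dd]]) (simp add: R_def T_def *(4) mult_ac)
  also have "\<dots> = 0" by (rule gen[OF *(1,2) dd])
  finally show ?case unfolding PP by (simp add: r_def)
qed

section \<open>Bracket monomials and their torus weights\<close>

definition mon :: "(nat \<times> nat) multiset \<Rightarrow> (nat \<Rightarrow> int) \<Rightarrow> pfun" where
  "mon D e u w = (\<Prod>(i, j)\<in>#D. br i j u w) * (\<Prod>i<N. br i (Suc i mod N) u w powi e i)"

text \<open>The eigenvalue of \<open>mon D e\<close> under the diagonal vector field with entries
  \<open>x\<close>.\<close>

definition wt :: "(nat \<times> nat) multiset \<Rightarrow> (nat \<Rightarrow> int) \<Rightarrow> (nat \<Rightarrow> complex) \<Rightarrow> complex" where
  "wt D e x = (\<Sum>(i, j)\<in>#D. x i + x j) + (\<Sum>i<N. of_int (e i) * (x i + x (Suc i mod N)))"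

lemma wt_diff: "wt D e (\<lambda>i. x i - y i) = wt D e x - wt D e y"
proof -
  have "(\<Sum>(i, j)\<in>#D. (x i - y i) + (x j - y j)) = (\<Sum>(i, j)\<in>#D. x i + x j) - (\<Sum>(i, j)\<in>#D. y i + y j)"
    by (induction D) (auto simp: algebra_simps)
  moreover have "(\<Sum>i<N. of_int (e i) * ((x i - y i) + (x (Suc i mod N) - y (Suc i mod N)))) =
      (\<Sum>i<N. of_int (e i) * (x i + x (Suc i mod N))) - (\<Sum>i<N. of_int (e i) * (y i + y (Suc i mod N)))"
    unfolding sum_subtractf[symmetric] by (intro sum.cong refl) (simp add: algebra_simps)
  ultimately show ?thesis by (simp add: wt_def)
qed

lemma brp_mon:
  assumes "\<And>p. p \<in># D \<Longrightarrow> fst p \<in> I \<and> snd p \<in> I"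
    and "\<And>i. i < N \<Longrightarrow> e i > 0 \<Longrightarrow> i \<in> I \<and> Suc i mod N \<in> I"
    and "\<And>i. i < N \<Longrightarrow> e i < 0 \<Longrightarrow> i \<in> S"
  shows "brp N I S (int (size D) + (\<Sum>i<N. e i)) (mon D e)"
proof -
  have "brp N I S (int (size D)) (\<lambda>u w. \<Prod>(i, j)\<in>#D. br i j u w)"
    using assms(1)
  proof (induction D)
    case empty
    then show ?case using brp.const[of N I S 1] by simp
  next
    case (add p D)
    obtain i j where p: "p = (i, j)" by fastforce
    have "brp N I S (int (size D) + 1) (\<lambda>u w. br i j u w * (\<Prod>(i, j)\<in>#D. br i j u w))"
      using add.prems[of p] add.IH add.prems p by (intro brp.br) auto
    then show ?case using p by (simp add: add_ac)
  qed
  moreover have "brp N I S (\<Sum>i<N. e i) (\<lambda>u w. \<Prod>i<N. br i (Suc i mod N) u w powi e i)"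
  proof (rule brp_prod)
    fix i assume i: "i \<in> {..<N}"
    show "brp N I S (e i) (\<lambda>u w. br i (Suc i mod N) u w powi e i)"
    proof (cases "e i = 0")
      case True
      then show ?thesis using brp.const[of N I S 1] by simp
    next
      case False
      then show ?thesis using assms(2,3)[of i] i by (intro brp_power_int) auto
    qed
  qed simp
  ultimately show ?thesis unfolding mon_def[abs_def] by (rule brp_mult)
qed

lemma mon_in:
  assumes "\<And>p. p \<in># D \<Longrightarrow> fst p < N \<and> snd p < N" "int (size D) + (\<Sum>i<N. e i) = - int N"
  shows "mon D e \<in> A"
  using brp_mon[of D "{..<N}" e "{..<N}"] assms N2 by (intro brp_in[of "{..<N}" "{..<N}"]) auto

lemma flow_diag:
  assumes "\<And>i. i \<ge> N \<Longrightarrow> x i = 0"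
  shows "flow N (\<lambda>i k. if i = k then x i else 0) t u = (\<lambda>i. (1 + t * x i) * u i)"
proof
  fix i
  have "(\<Sum>k<N. (if i = k then x i else 0) * u k) = x i * u i"
    using assms[of i] by (cases "i < N") (simp_all add: if_distrib[where f="\<lambda>x. x * _"] cong: if_cong)
  then show "flow N (\<lambda>i k. if i = k then x i else 0) t u i = (1 + t * x i) * u i"
    by (simp add: flow_def algebra_simps)
qed

lemma mon_diag_derivative:
  assumes "cyc N u w \<noteq> 0"
  shows "((\<lambda>t. mon D e (\<lambda>i. (1 + t * x i) * u i) (\<lambda>i. (1 + t * x i) * w i)) has_field_derivative
    wt D e x * mon D e u w) (at 0)"
proof -
  let ?u = "\<lambda>t i. (1 + t * x i) * u i" and ?w = "\<lambda>t i. (1 + t * x i) * w i"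
  have br: "br i j (?u t) (?w t) = (1 + t * x i) * (1 + t * x j) * br i j u w" for i j t
    by (simp add: br_def algebra_simps)
  have d: "((\<lambda>t. br i j (?u t) (?w t)) has_field_derivative (x i + x j) * br i j u w) (at 0)" for i j
    unfolding br by (auto intro!: derivative_eq_intros simp: algebra_simps)
  have "((\<lambda>t. \<Prod>(i, j)\<in>#D. br i j (?u t) (?w t)) has_field_derivative
      (\<Sum>(i, j)\<in>#D. x i + x j) * (\<Prod>(i, j)\<in>#D. br i j u w)) (at 0)"
  proof (induction D)
    case (add p D)
    obtain i j where p: "p = (i, j)" by fastforce
    show ?case unfolding p image_mset_add_mset prod_mset.add_mset sum_mset.add_mset prod.case
      by (rule DERIV_cong[OF DERIV_mult[OF d add]]) (simp add: algebra_simps)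
  qed simp
  moreover have "((\<lambda>t. \<Prod>i\<in>B. br i (Suc i mod N) (?u t) (?w t) powi e i) has_field_derivative
      (\<Sum>i\<in>B. of_int (e i) * (x i + x (Suc i mod N))) * (\<Prod>i\<in>B. br i (Suc i mod N) u w powi e i)) (at 0)"
    if "B \<subseteq> {..<N}" for B
    using finite_subset[OF that finite_lessThan] that
  proof (induction B rule: finite_induct)
    case (insert i B)
    let ?b = "br i (Suc i mod N)"
    have nz: "?b u w \<noteq> 0" using cyc_nonzero[OF assms] insert by auto
    have "((\<lambda>t. ?b (?u t) (?w t) powi e i) has_field_derivative
        of_int (e i) * (x i + x (Suc i mod N)) * ?b u w powi e i) (at 0)"
      by (rule DERIV_cong[OF DERIV_power_int[OF d]])
        (use nz in \<open>auto simp: power_int_diff\<close>)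
    from DERIV_mult[OF this insert.IH] insert show ?case
      by (simp add: algebra_simps)
  qed simp
  note this[OF order_refl]
  ultimately show ?thesis
    unfolding mon_def by (rule DERIV_cong[OF DERIV_mult]) (simp add: wt_def algebra_simps)
qed

text \<open>Traceless diagonal matrices force the weights at any two vertices to agree once the
  value is nonzero. Each bracket involves two vertices, so the \<open>N\<close> equal weights sum to
  twice the degree \<open>-N\<close>.\<close>

lemma wt_weight:
  assumes D: "\<And>p. p \<in># D \<Longrightarrow> fst p < N \<and> snd p < N" and d: "int (size D) + (\<Sum>i<N. e i) = - int N"
    and J: "J (mon D e) \<noteq> 0" and v: "v < N"
  shows "wt D e (\<lambda>i. if i = v then 1 else 0) = -2"
proof -
  let ?\<delta> = "\<lambda>v i. if i = v then 1 else (0::complex)"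
  have m: "mon D e \<in> A" using mon_in[OF D d] .
  have "wt D e (?\<delta> v) = wt D e (?\<delta> v')" if "v' < N" for v'
  proof -
    define x where "x i = ?\<delta> v i - ?\<delta> v' i" for i
    have x0: "x i = 0" if "i \<ge> N" for i using that v \<open>v' < N\<close> by (auto simp: x_def)
    have sx: "(\<Sum>i<N. x i) = 0" using v that by (simp add: x_def sum_subtractf)
    have "J (\<lambda>u w. wt D e x * mon D e u w) = 0"
      by (rule invariant[OF m, where X="\<lambda>i k. if i = k then x i else 0", THEN conjunct2])
        (simp_all add: flow_diag x0 mon_diag_derivative sx)
    then have "wt D e x = 0" using scale[OF m, of "wt D e x"] J by simp
    moreover have "wt D e x = wt D e (?\<delta> v) - wt D e (?\<delta> v')"
      unfolding x_def by (rule wt_diff)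
    ultimately show ?thesis by simp
  qed
  then have "(\<Sum>v'<N. wt D e (?\<delta> v')) = (\<Sum>v'<N. wt D e (?\<delta> v))"
    by (intro sum.cong) auto
  then have "(\<Sum>v'<N. wt D e (?\<delta> v')) = of_nat N * wt D e (?\<delta> v)" by simp
  moreover have "(\<Sum>v'<N. wt D e (?\<delta> v')) = - 2 * of_nat N"
  proof -
    have "(\<Sum>v'<N. \<Sum>(i, j)\<in>#D. ?\<delta> v' i + ?\<delta> v' j) = 2 * of_nat (size D)"
      using D
    proof (induction D)
      case (add p D)
      then show ?case by (simp add: case_prod_unfold sum.distrib)
    qed simp
    moreover have "(\<Sum>v'<N. \<Sum>i<N. of_int (e i) * (?\<delta> v' i + ?\<delta> v' (Suc i mod N))) = 2 * of_int (\<Sum>i<N. e i)"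
      by (subst sum.swap) (simp add: sum_distrib_left[symmetric] sum.distrib mult.commute sum_distrib_right[symmetric])
    ultimately have "(\<Sum>v'<N. wt D e (?\<delta> v')) = 2 * of_int (int (size D) + (\<Sum>i<N. e i))"
      by (simp add: wt_def sum.distrib)
    then show ?thesis using d by simp
  qed
  ultimately have "of_nat N * wt D e (?\<delta> v) = of_nat N * (-2)" by (simp add: mult.commute)
  then show ?thesis using N2 by (metis mult_cancel_left of_nat_eq_0_iff not_numeral_le_zero)
qed

lemma mon_add: "mon (add_mset (i, j) D) e u w = br i j u w * mon D e u w"
  by (simp add: mon_def)

lemma mon_absorb:
  assumes "cyc N u w \<noteq> 0" "i < N"
  shows "br i (Suc i mod N) u w * mon D e u w = mon D (e(i := e i + 1)) u w"
proof -
  have "br i (Suc i mod N) u w powi (e i + 1) = br i (Suc i mod N) u w powi e i * br i (Suc i mod N) u w"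
    using cyc_nonzero[OF assms] by (simp add: power_int_add)
  moreover have "(\<Prod>k\<in>{..<N} - {i}. br k (Suc k mod N) u w powi (e(i := e i + 1)) k) =
      (\<Prod>k\<in>{..<N} - {i}. br k (Suc k mod N) u w powi e k)"
    by (intro prod.cong) auto
  ultimately show ?thesis using assms(2) by (simp add: mon_def prod.remove[of "{..<N}" i])
qed

lemma sum_update:
  fixes e :: "nat \<Rightarrow> int"
  assumes "i < N"
  shows "(\<Sum>k<N. (e(i := c)) k) = (\<Sum>k<N. e k) - e i + c"
proof -
  have "(\<Sum>k\<in>{..<N} - {i}. (e(i := c)) k) = (\<Sum>k\<in>{..<N} - {i}. e k)"
    by (intro sum.cong) auto
  then show ?thesis using assms by (simp add: sum.remove[of "{..<N}" i])
qed

definition ordered_pairs :: "(nat \<times> nat) multiset \<Rightarrow> bool" where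
  "ordered_pairs D \<longleftrightarrow> (\<forall>p\<in>#D. fst p < snd p \<and> snd p < N)"

text \<open>A strictly concave function of the chord length, equal for the two arcs that the chord
  cuts off; concavity makes uncrossing lower the total. It is positive on sides as well, so that
  absorbing a side into the exponents also lowers the total.\<close>

definition weight :: "nat \<times> nat \<Rightarrow> nat" where
  "weight p = (snd p - fst p) * (N - (snd p - fst p))"

text \<open>In terms of the four arc lengths \<open>x\<close>, \<open>y\<close>, \<open>z\<close>,
  \<open>t\<close> around the polygon the differences are \<open>2 y t\<close> and
  \<open>2 x z\<close>.\<close>

lemma weight_crossing:
  assumes "i < j" "j < k" "k < l" "l < N"
  shows "weight (i, j) + weight (k, l) < weight (i, k) + weight (j, l)"
    and "weight (i, l) + weight (j, k) < weight (i, k) + weight (j, l)"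
proof -
  define x y z t where "x = int j - int i" and "y = int k - int j" and "z = int l - int k"
    and "t = int N - (int l - int i)"
  have p: "x > 0" "y > 0" "z > 0" "t > 0" using assms by (auto simp: x_def y_def z_def t_def)
  have w: "int (weight (a, b)) = (int b - int a) * (int N - (int b - int a))" if "a < b" "b < N" for a b
    using that by (simp add: weight_def of_nat_diff)
  have s: "int j - int i = x" "int l - int k = z" "int k - int i = x + y" "int l - int j = y + z"
    "int k - int j = y" "int l - int i = x + y + z" "int N = x + y + z + t"
    by (auto simp: x_def y_def z_def t_def)
  have "int (weight (i, k) + weight (j, l)) - int (weight (i, j) + weight (k, l)) = 2 * y * t"
    "int (weight (i, k) + weight (j, l)) - int (weight (i, l) + weight (j, k)) = 2 * x * z"
    using assms by (simp_all add: w s) (simp_all add: algebra_simps)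
  moreover have "2 * y * t > 0" "2 * x * z > 0" using p by auto
  ultimately show "weight (i, j) + weight (k, l) < weight (i, k) + weight (j, l)"
    "weight (i, l) + weight (j, k) < weight (i, k) + weight (j, l)"
    by linarith+
qed

lemma J_scale_cong:
  assumes "g \<in> A" "J g = 0" "\<And>u w. cyc N u w \<noteq> 0 \<Longrightarrow> h u w = c * g u w"
  shows "J h = 0"
  using J_cong[of "\<lambda>u w. c * g u w" h] scale[OF assms(1), of c] assms by auto

lemma mon_sides:
  assumes "\<And>i. i < N \<Longrightarrow> e i = -1"
  shows "mon {#} e u w = 1 / cyc N u w"
proof -
  have "(\<Prod>i<N. br i (Suc i mod N) u w powi e i) = (\<Prod>i<N. 1 / br i (Suc i mod N) u w)"
    using assms by (intro prod.cong) (auto simp: power_int_minus inverse_eq_divide)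
  then show ?thesis by (simp add: mon_def cyc_def prod_dividef)
qed

text \<open>For an arc of length 1 the arc factor is a side divided by itself, so
  \<open>arc_zero\<close> applies to the monomial as it is.\<close>

lemma nonneg_side_zero:
  assumes N3: "N \<ge> 3" and D: "ordered_pairs D" and d: "int (size D) + (\<Sum>i<N. e i) = - int N"
    and i: "i < N" "e i \<ge> 0"
  shows "J (mon D e) = 0"
proof -
  have ia: "arc_int i 1 = {}" "arc_sides i 1 = {i}" using i by (auto simp: arc_int_def arc_sides_def)
  have "brp N {..<N} ({..<N} - {i}) (int (size D) + (\<Sum>i<N. e i)) (mon D e)"
    using D i N2 by (intro brp_mon) (auto simp: ordered_pairs_def)
  then have "brp N ({..<N} - arc_int i 1) ({..<N} - arc_sides i 1) (int 1 - 1 - int N) (mon D e)"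
    using d by (simp add: ia[unfolded One_nat_def])
  from arc_zero[OF _ _ this] N3
  have z: "J (\<lambda>u w. mon D e u w * (br (i mod N) ((i + 1) mod N) u w /
     (\<Prod>k<1. br ((i + k) mod N) (Suc (i + k) mod N) u w))) = 0" by simp
  have m: "mon D e \<in> A" using D d by (intro mon_in) (auto simp: ordered_pairs_def)
  have "J (\<lambda>u w. mon D e u w * (br (i mod N) ((i + 1) mod N) u w /
     (\<Prod>k<1. br ((i + k) mod N) (Suc (i + k) mod N) u w))) = J (mon D e)"
    using cyc_nonzero[OF _ i(1)] i(1) by (intro J_cong[OF m]) auto
  then show ?thesis using z by simp
qed

text \<open>Induction on the total \<open>weight\<close> of \<open>D\<close>, which drops both when
  a side is absorbed into \<open>e\<close> and when a crossing is resolved. What then remains is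
  either \<open>1 / cyc\<close> or a monomial with an arc factor, which \<open>arc_zero\<close>
  kills without the induction hypothesis.\<close>

lemma mon_zero:
  assumes "J (\<lambda>u w. 1 / cyc N u w) = 0"
    and "ordered_pairs D" "int (size D) + (\<Sum>i<N. e i) = - int N"
  shows "J (mon D e) = 0"
  using assms(2,3)
proof (induction "\<Sum>p\<in>#D. weight p" arbitrary: D e rule: less_induct)
  case less
  have D: "fst p < snd p" "snd p < N" if "p \<in># D" for p
    using less.prems(1) that by (auto simp: ordered_pairs_def)
  have mA: "mon D e \<in> A" if "ordered_pairs D" "int (size D) + (\<Sum>i<N. e i) = - int N" for D e
    using that by (intro mon_in) (auto simp: ordered_pairs_def)
  have wp: "weight p > 0" if "p \<in># D" for p
    using D[OF that] by (simp add: weight_def)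
  have absorb: "J (mon D e) = 0"
    if p: "p \<in># D" and i: "i < N" and s: "\<And>u w. br (fst p) (snd p) u w = s * br i (Suc i mod N) u w" for p i s
  proof -
    define D' where "D' = D - {#p#}"
    have DD: "D = add_mset p D'" using p by (simp add: D'_def)
    have su: "(\<Sum>k<N. (e(i := e i + 1)) k) = (\<Sum>k<N. e k) + 1"
      using sum_update[OF i] by simp
    have o: "ordered_pairs D'" using less.prems(1) by (auto simp: ordered_pairs_def DD)
    have n: "int (size D') + (\<Sum>k<N. (e(i := e i + 1)) k) = - int N"
      using less.prems(2) su by (simp add: DD)
    have "J (mon D' (e(i := e i + 1))) = 0"
      by (rule less.hyps[OF _ o n]) (use wp[OF p] in \<open>simp add: DD\<close>)
    then show ?thesis
      by (rule J_scale_cong[OF mA[OF o n], where c=s])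
        (use DD s mon_add[of "fst p" "snd p" D' e] mon_absorb[OF _ i] in \<open>simp add: mult.assoc del: fun_upd_apply\<close>)
  qed
  show ?case
  proof (cases "\<exists>p\<in>#D. snd p = Suc (fst p) \<or> p = (0, N - 1)")
    case True
    then obtain p where p: "p \<in># D" "snd p = Suc (fst p) \<or> p = (0, N - 1)" by auto
    then show ?thesis
    proof (elim disjE)
      assume "snd p = Suc (fst p)"
      then show ?thesis using absorb[OF p(1), of "fst p" 1] D[OF p(1)] by simp
    next
      \<comment> \<open>This pair is the closing side, written against the cyclic orientation; hence
        the sign.\<close>
      assume "p = (0, N - 1)"
      then show ?thesis using absorb[OF p(1), of "N - 1" "-1"] N2 by (simp add: br_swap[of "N - Suc 0" 0])
    qed
  next
    case noside: False
    show ?thesis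
    proof (cases "N = 2")
      case True
      \<comment> \<open>The 2-gon has two sides but only one bracket up to sign, so each monomial of
        degree \<open>-2\<close> is a constant times \<open>1 / cyc\<close>. It is treated apart
        because already an arc of length 1 requires \<open>N \<ge> 3\<close> in
        \<open>arc_zero\<close>.\<close>
      have "D = {#}"
      proof (rule ccontr)
        assume "D \<noteq> {#}"
        then obtain p where "p \<in># D" by blast
        then show False using D[of p] noside True by auto
      qed
      have L2: "{..<2} = {0, 1 :: nat}" by auto
      have ee: "e 0 + e 1 = -2" using less.prems(2) \<open>D = {#}\<close> by (simp add: L2 True)
      have one: "(\<lambda>u w. 1 / cyc N u w) \<in> A" using brackets[of "[]" 0] by simp
      show ?thesis
      proof (rule J_scale_cong[OF one assms(1), where c="- ((-1) powi e 1)"])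
        fix u w assume "cyc N u w \<noteq> 0"
        then have nz: "br 0 1 u w \<noteq> 0" using cyc_nonzero[of N u w 0] True by simp
        have b: "br 1 0 u w = - 1 * br 0 1 u w" by (simp add: br_def)
        have "mon D e u w = br 0 1 u w powi e 0 * ((-1) powi e 1 * br 0 1 u w powi e 1)"
          unfolding power_int_mult_distrib[symmetric] b[symmetric] mon_def \<open>D = {#}\<close>
          using True by (simp add: L2)
        also have "\<dots> = (-1) powi e 1 * br 0 1 u w powi (e 0 + e 1)"
          using nz by (simp add: power_int_add)
        also have "\<dots> = - ((-1) powi e 1) * (1 / cyc N u w)"
          using True unfolding ee
          by (simp add: cyc_def L2 br_swap[of "Suc 0" 0] power_int_minus power2_eq_square inverse_eq_divide)
        finally show "mon D e u w = - ((-1) powi e 1) * (1 / cyc N u w)" .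
      qed
    next
      case False
      then have N3: "N \<ge> 3" using N2 by simp
      show ?thesis
      proof (rule ccontr)
        assume nz: "J (mon D e) \<noteq> 0"
        have neg: "e i \<le> -1" if "i < N" for i
          using nonneg_side_zero[OF N3 less.prems that] nz by fastforce
        have nocross: False if "(i, k) \<in># D" "(j, l) \<in># D" "i < j" "j < k" "k < l" for i j k l
        proof -
          note asm = that
          obtain D0 where D0: "D = add_mset (i, k) D0" using asm(1) by (blast dest: multi_member_split)
          then have "(j, l) \<in># D0" using that by auto
          then obtain D' where DD: "D = add_mset (i, k) (add_mset (j, l) D')"
            unfolding D0 by (blast dest: multi_member_split)
          have lN: "l < N" using D[OF that(2)] by simp
          define D1 D2 where "D1 = add_mset (i, j) (add_mset (k, l) D')"
            and "D2 = add_mset (i, l) (add_mset (j, k) D')"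
          have o: "ordered_pairs D1" "ordered_pairs D2"
            using less.prems(1) that by (auto simp: ordered_pairs_def DD D1_def D2_def)
          have n: "int (size D1) + (\<Sum>i<N. e i) = - int N" "int (size D2) + (\<Sum>i<N. e i) = - int N"
            using less.prems(2) by (auto simp: DD D1_def D2_def)
          note ad = add[OF mA[OF o(1) n(1)] mA[OF o(2) n(2)]]
          have "J (mon D1 e) = 0"
            by (rule less.hyps[OF _ o(1) n(1)]) (use weight_crossing[OF that(3-5) lN] in \<open>simp add: DD D1_def\<close>)
          moreover have "J (mon D2 e) = 0"
            by (rule less.hyps[OF _ o(2) n(2)]) (use weight_crossing[OF that(3-5) lN] in \<open>simp add: DD D2_def\<close>)
          moreover have "J (mon D e) = J (\<lambda>u w. mon D1 e u w + mon D2 e u w)"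
          proof (rule J_cong)
            show "(\<lambda>u w. mon D1 e u w + mon D2 e u w) \<in> A" using ad by blast
            show "mon D1 e u w + mon D2 e u w = mon D e u w" for u w
              using br_plucker[of i k u w j l]
              by (simp add: D1_def D2_def DD mon_add mult.assoc[symmetric] distrib_right[symmetric])
          qed
          ultimately show False using nz ad by simp
        qed
        have wt: "wt D e (\<lambda>i. if i = v then 1 else 0) = -2" if "v < N" for v
          by (rule wt_weight[OF _ less.prems(2) nz that]) (blast dest: D intro: less_trans)
        have side_sum: "(\<Sum>i<N. of_int (e i) * ((if i = v then 1 else 0) + (if Suc i mod N = v then 1 else 0))) =
            (of_int (e v + e ((v + N - 1) mod N)) :: complex)" if "v < N" for v
        proof -
          have q: "i < N \<Longrightarrow> Suc i mod N = v \<longleftrightarrow> i = (v + N - 1) mod N" for i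
          proof
            assume "i < N" "Suc i mod N = v"
            then show "i = (v + N - 1) mod N"
              by (cases "Suc i = N") auto
          next
            assume "i < N" "i = (v + N - 1) mod N"
            then show "Suc i mod N = v" using that by (simp add: mod_Suc_eq)
          qed
          have "(\<Sum>i<N. of_int (e i) * ((if i = v then 1 else 0) + (if Suc i mod N = v then 1 else 0))) =
            (\<Sum>i<N. (if i = v then of_int (e i) else 0) + (if i = (v + N - 1) mod N then of_int (e i) else (0::complex)))"
            by (intro sum.cong refl) (use q in auto)
          also have "\<dots> = of_int (e v + e ((v + N - 1) mod N))"
            using that by (simp add: sum.distrib)
          finally show ?thesis .
        qed
        show False
        proof (cases "D = {#}")
          case True
          \<comment> \<open>Two exponents that are each at most \<open>-1\<close> add up to the
            weight \<open>-2\<close>.\<close>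
          have "e i = -1" if i: "i < N" for i
          proof -
            have "(of_int (e i + e ((i + N - 1) mod N)) :: complex) = of_int (-2)"
              using wt[OF i] side_sum[OF i] True by (simp add: wt_def)
            then have "e i + e ((i + N - 1) mod N) = -2" by (simp only: of_int_eq_iff)
            then show ?thesis using neg[OF i] neg[of "(i + N - 1) mod N"] N2 by simp
          qed
          then have "mon D e = (\<lambda>u w. 1 / cyc N u w)" by (simp add: True mon_sides fun_eq_iff)
          then show False using nz assms(1) by simp
        next
          case False
          then obtain p0 where "p0 \<in># D" by blast
          \<comment> \<open>Length is measured in the linear order of the indices, not around the
            cycle, so the arc from \<open>i\<close> to \<open>j\<close> avoids the closing
            side.\<close>
          then obtain p where p: "p \<in># D" "\<And>q. q \<in># D \<Longrightarrow> snd p - fst p \<le> snd q - fst q"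
            using ex_has_least_nat[of "\<lambda>p. p \<in># D" p0 "\<lambda>p. snd p - fst p"] by blast
          obtain i j where ij: "p = (i, j)" by fastforce
          have ijN: "i < j" "j < N" "j \<noteq> Suc i" "(i, j) \<noteq> (0, N - 1)"
            using D[OF p(1)] noside p(1) by (auto simp: ij)
          \<comment> \<open>A bracket with an end strictly inside the arc is at least as long as
            \<open>(i, j)\<close>, so its other end lies beyond the arc and it crosses
            \<open>(i, j)\<close>.\<close>
          have free: "fst q \<noteq> v \<and> snd q \<noteq> v" if q: "q \<in># D" and v: "i < v" "v < j" for q v
          proof -
            obtain x y where xy: "q = (x, y)" by fastforce
            have m: "j - i \<le> y - x" "x < y" using p(2)[OF q] D[OF q] by (auto simp: ij xy)
            have "x \<noteq> v"
            proof
              assume "x = v"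
              then have "y > j" using m v by auto
              then show False using nocross[of i j x y] p(1) q v \<open>x = v\<close> by (simp add: ij xy)
            qed
            moreover have "y \<noteq> v"
            proof
              assume "y = v"
              then have "x < i" using m v by auto
              then show False using nocross[of x y i j] p(1) q v \<open>y = v\<close> by (simp add: ij xy)
            qed
            ultimately show ?thesis by (simp add: xy)
          qed
          \<comment> \<open>At an inner vertex the two adjacent sides carry the whole weight
            \<open>-2\<close>.\<close>
          have em1: "e v = -1 \<and> e (v - 1) = -1" if v: "i < v" "v < j" for v
          proof -
            have vN: "v < N" using v ijN by simp
            have "(\<Sum>(i, j)\<in>#D. (if i = v then 1 else 0) + (if j = v then 1 else 0 :: complex)) = 0"
              by (rule sum_mset.neutral) (use free[OF _ v] in auto)
            then have "(of_int (e v + e ((v + N - 1) mod N)) :: complex) = of_int (-2)"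
              using wt[OF vN] side_sum[OF vN] by (simp add: wt_def)
            then have "e v + e ((v + N - 1) mod N) = -2" by (simp only: of_int_eq_iff)
            moreover have "(v + N - 1) mod N = v - 1"
            proof -
              have "v + N - 1 = v - 1 + N" using v by simp
              then show ?thesis unfolding \<open>v + N - 1 = v - 1 + N\<close> using vN by (simp only: mod_add_self2 mod_less less_imp_diff_less)
            qed
            ultimately show ?thesis using neg[OF vN] neg[of "v - 1"] less_imp_diff_less[OF vN, of 1] by simp
          qed
          have arc: "e k = -1" if "i \<le> k" "k < j" for k
          proof (cases "k = i")
            case True
            then show ?thesis using em1[of "Suc i"] ijN by simp
          next
            case False
            then show ?thesis using em1[of k] that by simp
          qed
          define l where "l = j - i"
          define D' where "D' = D - {#p#}"
          have DD: "D = add_mset (i, j) D'" using p(1) by (simp add: D'_def ij)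
          define e' where "e' k = (if i \<le> k \<and> k < j then 0 else e k)" for k
          have ai: "arc_int i l = {i<..<j}"
          proof -
            have "arc_int i l = (\<lambda>k. i + k) ` {0<..<l}"
              unfolding arc_int_def using ijN by (intro image_cong) (auto simp: l_def)
            also have "\<dots> = {i<..<j}" 
            proof (intro equalityI subsetI)
              fix x assume "x \<in> {i<..<j}"
              then show "x \<in> (\<lambda>k. i + k) ` {0<..<l}" by (intro image_eqI[of _ _ "x - i"]) (auto simp: l_def)
            qed (auto simp: l_def)
            finally show ?thesis .
          qed
          have as: "arc_sides i l = {i..<j}"
          proof -
            have "arc_sides i l = (\<lambda>k. i + k) ` {..<l}"
              unfolding arc_sides_def using ijN by (intro image_cong) (auto simp: l_def)
            also have "\<dots> = {i..<j}" 
            proof (intro equalityI subsetI)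
              fix x assume "x \<in> {i..<j}"
              then show "x \<in> (\<lambda>k. i + k) ` {..<l}" by (intro image_eqI[of _ _ "x - i"]) (auto simp: l_def)
            qed (auto simp: l_def)
            finally show ?thesis .
          qed
          have split: "{..<N} = {i..<j} \<union> ({..<N} - {i..<j})" using ijN by auto
          have se: "(\<Sum>k<N. e' k) = (\<Sum>k<N. e k) + int l"
          proof -
            have "(\<Sum>k<N. e k) = (\<Sum>k\<in>{i..<j}. e k) + (\<Sum>k\<in>{..<N} - {i..<j}. e k)"
              by (subst split, subst sum.union_disjoint) auto
            moreover have "(\<Sum>k<N. e' k) = (\<Sum>k\<in>{i..<j}. e' k) + (\<Sum>k\<in>{..<N} - {i..<j}. e' k)"
              by (subst split, subst sum.union_disjoint) auto
            moreover have "(\<Sum>k\<in>{i..<j}. e k) = (\<Sum>k\<in>{i..<j}. -1)" "(\<Sum>k\<in>{i..<j}. e' k) = (\<Sum>k\<in>{i..<j}. 0)"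
              "(\<Sum>k\<in>{..<N} - {i..<j}. e' k) = (\<Sum>k\<in>{..<N} - {i..<j}. e k)"
              by (intro sum.cong; simp add: arc e'_def)+
            ultimately show ?thesis using ijN by (simp add: l_def)
          qed
          have "brp N ({..<N} - arc_int i l) ({..<N} - arc_sides i l) (int (size D') + (\<Sum>k<N. e' k)) (mon D' e')"
          proof (rule brp_mon)
            fix q assume "q \<in># D'"
            then have "q \<in># D" by (simp add: DD)
            then show "fst q \<in> {..<N} - arc_int i l \<and> snd q \<in> {..<N} - arc_int i l"
              using D[of q] free[of q] by (auto simp: ai)
          next
            fix k assume "k < N" "e' k > 0"
            then show "k \<in> {..<N} - arc_int i l \<and> Suc k mod N \<in> {..<N} - arc_int i l"
              using neg[of k] by (auto simp: e'_def split: if_splits)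
          next
            fix k assume "k < N" "e' k < 0"
            then show "k \<in> {..<N} - arc_sides i l" by (auto simp: as e'_def split: if_splits)
          qed
          moreover have "int (size D') + (\<Sum>k<N. e' k) = int l - 1 - int N"
            using less.prems(2) by (simp add: se DD)
          ultimately have B: "brp N ({..<N} - arc_int i l) ({..<N} - arc_sides i l) (int l - 1 - int N) (mon D' e')"
            by simp
          \<comment> \<open>Excluding the pair \<open>(0, N - 1)\<close> leaves
            \<open>j - i \<le> N - 2\<close>.\<close>
          have "l + 2 \<le> N" using ijN by (auto simp: l_def)
          from arc_zero[OF _ this B] ijN
          have z: "J (\<lambda>u w. mon D' e' u w * (br (i mod N) ((i + l) mod N) u w /
            (\<Prod>k<l. br ((i + k) mod N) (Suc (i + k) mod N) u w))) = 0"
            by (simp add: l_def)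
          have "J (\<lambda>u w. mon D' e' u w * (br (i mod N) ((i + l) mod N) u w /
            (\<Prod>k<l. br ((i + k) mod N) (Suc (i + k) mod N) u w))) = J (mon D e)"
          proof (rule J_cong[OF mA[OF less.prems]])
            fix u w
            have "(\<Prod>k<N. br k (Suc k mod N) u w powi e k) =
              (\<Prod>k\<in>{i..<j}. br k (Suc k mod N) u w powi e k) * (\<Prod>k\<in>{..<N} - {i..<j}. br k (Suc k mod N) u w powi e k)"
              by (subst split, subst prod.union_disjoint) auto
            moreover have "(\<Prod>k<N. br k (Suc k mod N) u w powi e' k) =
              (\<Prod>k\<in>{i..<j}. br k (Suc k mod N) u w powi e' k) * (\<Prod>k\<in>{..<N} - {i..<j}. br k (Suc k mod N) u w powi e' k)"
              by (subst split, subst prod.union_disjoint) auto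
            moreover have "(\<Prod>k\<in>{i..<j}. br k (Suc k mod N) u w powi e' k) = 1"
              by (rule prod.neutral) (simp add: e'_def)
            moreover have "(\<Prod>k\<in>{..<N} - {i..<j}. br k (Suc k mod N) u w powi e' k) =
                (\<Prod>k\<in>{..<N} - {i..<j}. br k (Suc k mod N) u w powi e k)"
              by (intro prod.cong) (auto simp: e'_def)
            moreover have "(\<Prod>k\<in>{i..<j}. br k (Suc k mod N) u w powi e k) = (\<Prod>k\<in>{i..<j}. 1 / br k (Suc k mod N) u w)"
              by (intro prod.cong) (auto simp: arc power_int_minus inverse_eq_divide)
            moreover have "(\<Prod>k\<in>{i..<j}. br k (Suc k mod N) u w) =
                (\<Prod>k<l. br ((i + k) mod N) (Suc (i + k) mod N) u w)"
              using ijN by (intro prod.reindex_bij_witness[of _ "\<lambda>k. i + k" "\<lambda>k. k - i"]) (auto simp: l_def)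
            ultimately show "mon D e u w = mon D' e' u w * (br (i mod N) ((i + l) mod N) u w /
              (\<Prod>k<l. br ((i + k) mod N) (Suc (i + k) mod N) u w))"
              using ijN by (simp add: mon_def DD prod_dividef l_def)
          qed
          then show False using z nz by simp
        qed
      qed
    qed
  qed
qed

lemma brp_mon_form:
  assumes "brp N {..<N} {..<N} d g"
  shows "\<exists>c D e. ordered_pairs D \<and> int (size D) + (\<Sum>i<N. e i) = d \<and>
    (\<forall>u w. cyc N u w \<noteq> 0 \<longrightarrow> g u w = c * mon D e u w)"
  using assms
proof (induction rule: brp.induct)
  case (const c)
  show ?case
    by (intro exI[of _ c] exI[of _ "{#}"] exI[of _ "\<lambda>_. 0"]) (simp add: ordered_pairs_def mon_def)
next
  case (br i j d g)
  then obtain c D e where *: "ordered_pairs D" "int (size D) + (\<Sum>i<N. e i) = d"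
    "\<forall>u w. cyc N u w \<noteq> 0 \<longrightarrow> g u w = c * mon D e u w" by blast
  have i1: "(0::nat) < N" using N2 by simp
  consider "i < j" | "j < i" | "i = j" by linarith
  then show ?case
  proof cases
    case 1
    then show ?thesis using * br(2)
      by (intro exI[of _ c] exI[of _ "add_mset (i, j) D"] exI[of _ e])
        (auto simp: ordered_pairs_def mon_add)
  next
    case 2
    then show ?thesis using * br(1)
      by (intro exI[of _ "- c"] exI[of _ "add_mset (j, i) D"] exI[of _ e])
        (auto simp: ordered_pairs_def mon_add br_swap[of i j])
  next
    \<comment> \<open>The bracket vanishes, so an arbitrary bracket with coefficient 0 serves as a
      placeholder of the right degree.\<close>
    case 3
    then show ?thesis using * br(1) N2
      by (intro exI[of _ 0] exI[of _ "add_mset (0, 1) D"] exI[of _ e])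
        (auto simp: ordered_pairs_def mon_add)
  qed
next
  case (inv i d g)
  then obtain c D e where *: "ordered_pairs D" "int (size D) + (\<Sum>i<N. e i) = d"
    "\<forall>u w. cyc N u w \<noteq> 0 \<longrightarrow> g u w = c * mon D e u w" by blast
  have i: "i < N" using inv by simp
  have su: "(\<Sum>k<N. (e(i := e i - 1)) k) = (\<Sum>k<N. e k) - 1"
    using sum_update[OF i] by simp
  have "g u w / br i (Suc i mod N) u w = c * mon D (e(i := e i - 1)) u w" if "cyc N u w \<noteq> 0" for u w
    using mon_absorb[OF that i, of D "e(i := e i - 1)"] *(3) that cyc_nonzero[OF that i]
    by (auto simp: field_simps)
  moreover have "int (size D) + (\<Sum>k<N. (e(i := e i - 1)) k) = d - 1" using *(2) su by simp
  ultimately show ?case using *(1) by blast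
qed

text \<open>Vanishing at \<open>1 / cyc\<close> is the normalisation that suits uniqueness up to
  scalars: from any solution a multiple of a fixed one will be subtracted.\<close>

theorem brackets_zero:
  assumes "J (\<lambda>u w. 1 / cyc N u w) = 0" "length ps = k * N" "set ps \<subseteq> {..<N} \<times> {..<N}"
  shows "J (\<lambda>u w. (\<Prod>(i, j)\<leftarrow>ps. br i j u w) / cyc N u w ^ Suc k) = 0"
proof -
  have "brp N {..<N} {..<N} (int (length ps)) (\<lambda>u w. \<Prod>(i, j)\<leftarrow>ps. br i j u w)"
    using assms(3)
  proof (induction ps)
    case Nil
    then show ?case using brp.const[of N _ _ 1] by simp
  next
    case (Cons p ps)
    obtain i j where p: "p = (i, j)" by fastforce
    have "brp N {..<N} {..<N} (int (length ps) + 1) (\<lambda>u w. br i j u w * (\<Prod>(i, j)\<leftarrow>ps. br i j u w))"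
      using Cons p by (intro brp.br) auto
    then show ?case using p by (simp add: add_ac)
  qed
  moreover have "brp N {..<N} {..<N} (int (Suc k) * (\<Sum>i<N. -1))
      (\<lambda>u w. (\<Prod>i<N. 1 / br i (Suc i mod N) u w) ^ Suc k)"
    by (intro brp_power brp_prod brp_inv) auto
  ultimately have "brp N {..<N} {..<N} (int (length ps) + int (Suc k) * (\<Sum>i<N. -1))
      (\<lambda>u w. (\<Prod>(i, j)\<leftarrow>ps. br i j u w) * (\<Prod>i<N. 1 / br i (Suc i mod N) u w) ^ Suc k)"
    by (rule brp_mult)
  then have "brp N {..<N} {..<N} (- int N) (\<lambda>u w. (\<Prod>(i, j)\<leftarrow>ps. br i j u w) / cyc N u w ^ Suc k)"
    using assms(2) by (simp add: cyc_def prod_dividef power_divide algebra_simps del: power_Suc)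
  from brp_mon_form[OF this] obtain c D e where *: "ordered_pairs D" "int (size D) + (\<Sum>i<N. e i) = - int N"
    "\<forall>u w. cyc N u w \<noteq> 0 \<longrightarrow> (\<Prod>(i, j)\<leftarrow>ps. br i j u w) / cyc N u w ^ Suc k = c * mon D e u w" by blast
  have "mon D e \<in> A"
    by (rule mon_in[OF _ *(2)]) (use *(1) in \<open>force simp: ordered_pairs_def\<close>)
  then show ?thesis
    by (rule J_scale_cong[OF _ mon_zero[OF assms(1) *(1,2)], where c=c]) (use *(3) in blast)
qed

end

section \<open>Evaluation of monoid algebra elements\<close>

definition coeff_hom :: "(complex \<Rightarrow> 'r::comm_semiring_1) \<Rightarrow> bool" where
  "coeff_hom h \<longleftrightarrow> h 0 = 0 \<and> h 1 = 1 \<and> (\<forall>x y. h (x + y) = h x + h y) \<and> (\<forall>x y. h (x * y) = h x * h y)"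

text \<open>One evaluation serves polynomials and Laurent polynomials: \<open>h\<close> maps the
  coefficients and \<open>\<phi>\<close> the monomials.\<close>

definition alg_eval :: "(complex \<Rightarrow> 'r::comm_semiring_1) \<Rightarrow> ('m \<Rightarrow> 'r) \<Rightarrow> ('m \<Rightarrow>\<^sub>0 complex) \<Rightarrow> 'r" where
  "alg_eval h \<phi> p = (\<Sum>m\<in>keys p. h (lookup p m) * \<phi> m)"

lemma coeff_hom_id [simp]: "coeff_hom (\<lambda>c. c)"
  by (simp add: coeff_hom_def)

lemma coeff_hom_Const [simp]: "coeff_hom Const"
  by (simp add: coeff_hom_def Const_def single_add mult_single)

lemma alg_eval_superset:
  assumes "coeff_hom h" "finite A" "keys p \<subseteq> A"
  shows "alg_eval h \<phi> p = (\<Sum>m\<in>A. h (lookup p m) * \<phi> m)"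
  unfolding alg_eval_def
  by (intro sum.mono_neutral_left) (use assms in \<open>auto simp: in_keys_iff coeff_hom_def\<close>)

lemma alg_eval_zero [simp]: "alg_eval h \<phi> 0 = 0"
  by (simp add: alg_eval_def)

lemma alg_eval_add:
  assumes "coeff_hom h"
  shows "alg_eval h \<phi> (p + q) = alg_eval h \<phi> p + alg_eval h \<phi> q"
proof -
  let ?A = "keys p \<union> keys q"
  have A: "finite ?A" "keys (p + q) \<subseteq> ?A" "keys p \<subseteq> ?A" "keys q \<subseteq> ?A"
    using Poly_Mapping.keys_add[of p q] by auto
  show ?thesis
    unfolding alg_eval_superset[OF assms A(1,2)] alg_eval_superset[OF assms A(1,3)]
      alg_eval_superset[OF assms A(1,4)]
    using assms by (simp add: lookup_add sum.distrib distrib_right coeff_hom_def)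
qed

lemma alg_eval_sum:
  "coeff_hom h \<Longrightarrow> alg_eval h \<phi> (\<Sum>x\<in>A. p x) = (\<Sum>x\<in>A. alg_eval h \<phi> (p x))"
  by (induction A rule: infinite_finite_induct) (simp_all add: alg_eval_add)

lemma alg_eval_single:
  "coeff_hom h \<Longrightarrow> alg_eval h \<phi> (Poly_Mapping.single m c) = h c * \<phi> m"
  using alg_eval_superset[of h "{m}" "Poly_Mapping.single m c" \<phi>] by simp

lemma poly_mapping_decompose:
  "p = (\<Sum>m\<in>keys p. Poly_Mapping.single m (lookup p m))"
  by (rule poly_mapping_eqI) (auto simp: lookup_sum lookup_single when_def in_keys_iff)

lemma alg_eval_mult:
  assumes h: "coeff_hom h" and \<phi>: "\<And>m n. \<phi> (m + n) = \<phi> m * \<phi> n"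
  shows "alg_eval h \<phi> (p * q) = alg_eval h \<phi> p * alg_eval h \<phi> q"
proof -
  have hm: "h (x * y) = h x * h y" for x y using h by (simp add: coeff_hom_def)
  have "p * q = (\<Sum>m\<in>keys p. \<Sum>n\<in>keys q.
      Poly_Mapping.single (m + n) (lookup p m * lookup q n))"
    by (subst poly_mapping_decompose[of p], subst poly_mapping_decompose[of q])
      (simp add: sum_product mult_single)
  then have "alg_eval h \<phi> (p * q) =
      (\<Sum>m\<in>keys p. \<Sum>n\<in>keys q. h (lookup p m * lookup q n) * \<phi> (m + n))"
    by (simp add: alg_eval_sum[OF h] alg_eval_single[OF h])
  also have "\<dots> = (\<Sum>m\<in>keys p. \<Sum>n\<in>keys q. (h (lookup p m) * \<phi> m) * (h (lookup q n) * \<phi> n))"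
    by (simp add: hm \<phi> mult_ac)
  also have "\<dots> = alg_eval h \<phi> p * alg_eval h \<phi> q"
    by (simp add: alg_eval_def sum_product)
  finally show ?thesis .
qed

definition monom_eval :: "('v \<Rightarrow> 'r) \<Rightarrow> ('v \<Rightarrow>\<^sub>0 nat) \<Rightarrow> 'r::comm_semiring_1" where
  "monom_eval s m = (\<Prod>v\<in>keys m. s v ^ lookup m v)"

lemma poly_subst_alg_eval: "poly_subst h s = alg_eval h (monom_eval s)"
  by (simp add: fun_eq_iff poly_subst_def alg_eval_def monom_eval_def)

lemma monom_eval_superset:
  "finite A \<Longrightarrow> keys m \<subseteq> A \<Longrightarrow> monom_eval s m = (\<Prod>v\<in>A. s v ^ lookup m v)"
  unfolding monom_eval_def by (intro prod.mono_neutral_left) (auto simp: in_keys_iff)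

lemma monom_eval_zero [simp]: "monom_eval s 0 = 1"
  by (simp add: monom_eval_def)

lemma monom_eval_single [simp]: "monom_eval s (Poly_Mapping.single v n) = s v ^ n"
  using monom_eval_superset[of "{v}" "Poly_Mapping.single v n" s] by simp

lemma monom_eval_add: "monom_eval s (m + n) = monom_eval s m * monom_eval s n"
proof -
  let ?A = "keys m \<union> keys n"
  have A: "finite ?A" "keys (m + n) \<subseteq> ?A" "keys m \<subseteq> ?A" "keys n \<subseteq> ?A"
    using Poly_Mapping.keys_add[of m n] by auto
  show ?thesis
    unfolding monom_eval_superset[OF A(1,2)] monom_eval_superset[OF A(1,3)]
      monom_eval_superset[OF A(1,4)]
    by (simp add: lookup_add power_add prod.distrib)
qed

context
  fixes h :: "complex \<Rightarrow> 'r::comm_semiring_1"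
  assumes h: "coeff_hom h"
begin

lemma poly_subst_add: "poly_subst h s (p + q) = poly_subst h s p + poly_subst h s q"
  by (simp add: poly_subst_alg_eval alg_eval_add h)

lemma poly_subst_sum: "poly_subst h s (\<Sum>x\<in>A. p x) = (\<Sum>x\<in>A. poly_subst h s (p x))"
  by (simp add: poly_subst_alg_eval alg_eval_sum h)

lemma poly_subst_mult: "poly_subst h s (p * q) = poly_subst h s p * poly_subst h s q"
  by (simp add: poly_subst_alg_eval alg_eval_mult h monom_eval_add)

lemma poly_subst_single: "poly_subst h s (Poly_Mapping.single m c) = h c * monom_eval s m"
  by (simp add: poly_subst_alg_eval alg_eval_single h)

lemma poly_subst_Const: "poly_subst h s (Const c) = h c"
  by (simp add: Const_def poly_subst_single)

lemma poly_subst_Var: "poly_subst h s (Var v) = s v"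
  using h by (simp add: Var_def poly_subst_single coeff_hom_def)

lemma poly_subst_one: "poly_subst h s 1 = 1"
  using poly_subst_Const[of s 1] h by (simp add: Const_def coeff_hom_def)

lemma poly_subst_power: "poly_subst h s (p ^ n) = poly_subst h s p ^ n"
  by (induction n) (simp_all add: poly_subst_one poly_subst_mult)

lemma poly_subst_prod: "poly_subst h s (\<Prod>x\<in>A. p x) = (\<Prod>x\<in>A. poly_subst h s (p x))"
  by (induction A rule: infinite_finite_induct) (simp_all add: poly_subst_one poly_subst_mult)

end

lemma poly_subst_zero [simp]: "poly_subst h s 0 = 0"
  by (simp add: poly_subst_def)

lemma poly_subst_uminus:
  fixes h :: "complex \<Rightarrow> 'r::comm_ring_1"
  shows "coeff_hom h \<Longrightarrow> poly_subst h s (- p) = - poly_subst h s p"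
  using poly_subst_add[of h s p "- p"] by (simp add: eq_neg_iff_add_eq_0 add.commute)

lemma poly_subst_diff:
  fixes h :: "complex \<Rightarrow> 'r::comm_ring_1"
  shows "coeff_hom h \<Longrightarrow> poly_subst h s (p - q) = poly_subst h s p - poly_subst h s q"
  using poly_subst_add[of h s p "- q"] by (simp add: poly_subst_uminus)

lemmas poly_subst_hom = poly_subst_add poly_subst_sum poly_subst_mult poly_subst_Const
  poly_subst_Var poly_subst_one poly_subst_power poly_subst_prod poly_subst_uminus poly_subst_diff

lemma single_eq_Const_mult: "Poly_Mapping.single m c = Const c * Poly_Mapping.single m 1"
  by (simp add: Const_def mult_single)

lemma single_one_prod: "Poly_Mapping.single m 1 = (\<Prod>v\<in>keys m. Var v ^ lookup m v)"
proof -
  have pow: "Var v ^ n = Poly_Mapping.single (Poly_Mapping.single v n) 1" for v :: 'a and n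
    by (induction n) (simp_all add: Var_def mult_single single_add[symmetric])
  have "finite A \<Longrightarrow> (\<Prod>v\<in>A. Var v ^ lookup m v) =
      Poly_Mapping.single (\<Sum>v\<in>A. Poly_Mapping.single v (lookup m v)) 1" for A :: "'a set"
    by (induction A rule: finite_induct) (simp_all add: pow mult_single)
  then show ?thesis
    using poly_mapping_decompose[of m] by simp
qed

lemma mpoly_induct [case_names Const Var add mult]:
  fixes p :: "'v mpoly"
  assumes C: "\<And>c. P (Const c)" and V: "\<And>v. P (Var v)"
    and A: "\<And>p q. P p \<Longrightarrow> P q \<Longrightarrow> P (p + q)" and M: "\<And>p q. P p \<Longrightarrow> P q \<Longrightarrow> P (p * q)"
  shows "P p"
proof -
  have P0: "P 0" using C[of 0] by (simp add: Const_def)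
  have P1: "P 1" using C[of 1] by (simp add: Const_def)
  have pow: "P (Var v ^ n)" for v n by (induction n) (auto simp: P1 V M)
  have "P (\<Prod>v\<in>A. Var v ^ lookup m v)" for A :: "'v set" and m :: "'v \<Rightarrow>\<^sub>0 nat"
    by (induction A rule: infinite_finite_induct) (auto simp: P1 pow M)
  then have mono: "P (Poly_Mapping.single m c)" for m c
    by (subst single_eq_Const_mult) (auto simp: single_one_prod C M)
  have "P (\<Sum>m\<in>A. Poly_Mapping.single m (lookup p m))" for A
    by (induction A rule: infinite_finite_induct) (auto simp: P0 mono A)
  then show ?thesis by (subst poly_mapping_decompose)
qed

lemma poly_subst_cong:
  assumes "\<And>m v. m \<in> keys p \<Longrightarrow> v \<in> keys m \<Longrightarrow> s v = t v"
  shows "poly_subst h s p = poly_subst h t p"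
  unfolding poly_subst_def by (intro sum.cong prod.cong arg_cong2[where f="(*)"] refl)
    (simp add: assms)

lemma poly_eval_subst:
  "poly_eval s (poly_subst Const t p) = poly_eval (\<lambda>v. poly_eval s (t v)) p"
  by (induction p rule: mpoly_induct) (simp_all add: poly_subst_hom)

lemma mdeg_add: "mdeg (m + n) = mdeg m + mdeg n"
proof -
  let ?A = "keys m \<union> keys n"
  have A: "finite ?A" "keys (m + n) \<subseteq> ?A" "keys m \<subseteq> ?A" "keys n \<subseteq> ?A"
    using Poly_Mapping.keys_add[of m n] by auto
  have *: "mdeg x = (\<Sum>v\<in>?A. lookup x v)" if "keys x \<subseteq> ?A" for x
    unfolding mdeg_def using that by (intro sum.mono_neutral_left) (auto simp: in_keys_iff)
  show ?thesis by (simp add: * A lookup_add sum.distrib)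
qed

lemma mdeg_zero [simp]: "mdeg 0 = 0" by (simp add: mdeg_def)

lemma mdeg_single [simp]: "mdeg (Poly_Mapping.single v n) = n" by (simp add: mdeg_def)

section \<open>Forms in the Pluecker coordinates\<close>

text \<open>Vectors are functions on all natural numbers, so no lengths have to be tracked; on forms
  only the indices below \<open>N\<close> matter, by \<open>pe_cong\<close>.\<close>

definition pe :: "(nat \<Rightarrow> complex) \<Rightarrow> (nat \<Rightarrow> complex) \<Rightarrow> plpoly \<Rightarrow> complex" where
  "pe u w P = poly_eval (\<lambda>(i, j). br i j u w) P"

lemma pe_hom:
  "pe u w (P + Q) = pe u w P + pe u w Q" "pe u w (P * Q) = pe u w P * pe u w Q"
  "pe u w (- P) = - pe u w P" "pe u w (P - Q) = pe u w P - pe u w Q"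
  "pe u w (Const c) = c" "pe u w 0 = 0" "pe u w 1 = 1"
  "pe u w (sum f A) = (\<Sum>x\<in>A. pe u w (f x))" "pe u w (prod f A) = (\<Prod>x\<in>A. pe u w (f x))"
  by (simp_all add: pe_def poly_subst_hom)

lemma pe_Var: "pe u w (Var (i, j)) = br i j u w"
  by (simp add: pe_def poly_subst_hom)

lemma pe_pl: "pe u w (pl i j) = br i j u w"
  by (auto simp: pl_def pe_hom pe_Var br_def)

definition forms :: "nat \<Rightarrow> nat \<Rightarrow> plpoly set" where
  "forms N d = {P. \<forall>m\<in>keys P. keys m \<subseteq> {(i, j). i < j \<and> j < N} \<and> mdeg m = d}"

lemma pl_forms_eq: "pl_forms N = forms N N"
  by (simp add: pl_forms_def forms_def)

lemma forms_zero [simp]: "0 \<in> forms N d"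
  by (simp add: forms_def)

lemma forms_add: "P \<in> forms N d \<Longrightarrow> Q \<in> forms N d \<Longrightarrow> P + Q \<in> forms N d"
  using Poly_Mapping.keys_add[of P Q] by (auto simp: forms_def)

lemma forms_sum: "(\<And>x. x \<in> A \<Longrightarrow> f x \<in> forms N d) \<Longrightarrow> sum f A \<in> forms N d"
  by (induction A rule: infinite_finite_induct) (auto intro: forms_add)

lemma forms_mult:
  assumes "P \<in> forms N d" "Q \<in> forms N e"
  shows "P * Q \<in> forms N (d + e)"
  unfolding forms_def
proof (intro CollectI ballI)
  fix m assume "m \<in> keys (P * Q)"
  then obtain k l where kl: "m = k + l" "k \<in> keys P" "l \<in> keys Q"
    using Poly_Mapping.keys_mult[of P Q] by auto
  moreover have "keys k \<subseteq> {(i, j). i < j \<and> j < N} \<and> mdeg k = d" "keys l \<subseteq> {(i, j). i < j \<and> j < N} \<and> mdeg l = e"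
    using assms kl unfolding forms_def by blast+
  ultimately show "keys m \<subseteq> {(i, j). i < j \<and> j < N} \<and> mdeg m = d + e"
    using Poly_Mapping.keys_add[of k l] by (simp add: mdeg_add) blast
qed

lemma forms_Const [simp]: "Const c \<in> forms N 0"
  by (auto simp: forms_def Const_def)

lemma forms_one [simp]: "1 \<in> forms N 0"
  using forms_Const[of 1 N] by (simp add: Const_def)

lemma forms_scale: "P \<in> forms N d \<Longrightarrow> Const c * P \<in> forms N d"
  using forms_mult[OF forms_Const] by simp

lemma forms_uminus: "P \<in> forms N d \<Longrightarrow> - P \<in> forms N d"
  by (simp add: forms_def keys_def)

lemma forms_pl: "i < N \<Longrightarrow> j < N \<Longrightarrow> pl i j \<in> forms N 1"
proof -
  have V: "i < j \<Longrightarrow> j < N \<Longrightarrow> Var (i, j) \<in> forms N 1" for i j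
    by (auto simp: forms_def Var_def)
  then show "i < N \<Longrightarrow> j < N \<Longrightarrow> pl i j \<in> forms N 1"
    by (auto simp: pl_def simp del: One_nat_def intro!: forms_uminus)
qed

lemma forms_power: "P \<in> forms N d \<Longrightarrow> P ^ n \<in> forms N (n * d)"
  by (induction n) (auto intro: forms_mult)

lemma forms_prod:
  "finite A \<Longrightarrow> (\<And>x. x \<in> A \<Longrightarrow> f x \<in> forms N (d x)) \<Longrightarrow> prod f A \<in> forms N (sum d A)"
  by (induction A rule: finite_induct) (auto intro: forms_mult)

lemma forms_prod_list:
  "(\<And>x. x \<in> set xs \<Longrightarrow> f x \<in> forms N 1) \<Longrightarrow> (\<Prod>x\<leftarrow>xs. f x) \<in> forms N (length xs)"
proof (induction xs)
  case (Cons x xs)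
  then show ?case using forms_mult[of "f x" N 1 "\<Prod>x\<leftarrow>xs. f x" "length xs"] by simp
qed simp

lemma cyclic_section_forms: "cyclic_section N \<in> forms N N"
proof (cases "N = 0")
  case False
  then have "cyclic_section N \<in> forms N (\<Sum>i<N. 1)"
    unfolding cyclic_section_def by (intro forms_prod forms_pl) auto
  then show ?thesis by simp
qed (simp add: cyclic_section_def)

lemma pe_cyclic_section: "pe u w (cyclic_section N) = cyc N u w"
  by (simp add: cyclic_section_def cyc_def pe_hom pe_pl)

lemma pe_cong:
  assumes "P \<in> forms N d" "\<And>i. i < N \<Longrightarrow> u i = u' i \<and> w i = w' i"
  shows "pe u w P = pe u' w' P"
  unfolding pe_def
proof (rule poly_subst_cong)
  fix m v assume "m \<in> keys P" "v \<in> keys m"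
  moreover obtain i j where "v = (i, j)" by fastforce
  moreover have "keys m \<subseteq> {(i, j). i < j \<and> j < N}"
    using \<open>m \<in> keys P\<close> assms(1) unfolding forms_def by blast
  ultimately have "i < N" "j < N" "v = (i, j)" by auto
  then show "(case v of (i, j) \<Rightarrow> br i j u w) = (case v of (i, j) \<Rightarrow> br i j u' w')"
    using assms(2)[of i] assms(2)[of j] by (simp add: br_def)
qed

lemma pe_degenerate:
  assumes "P \<in> forms N d" "d > 0" "\<And>i j. i < N \<Longrightarrow> j < N \<Longrightarrow> br i j u w = 0"
  shows "pe u w P = 0"
  unfolding pe_def poly_subst_def
proof (intro sum.neutral ballI)
  fix m assume m: "m \<in> keys P"
  then have "mdeg m > 0" using assms by (auto simp: forms_def)
  then have "keys m \<noteq> {}" by (auto simp: mdeg_def)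
  then obtain v where v: "v \<in> keys m" by blast
  moreover have "keys m \<subseteq> {(i, j). i < j \<and> j < N}"
    using m assms(1) unfolding forms_def by blast
  then have "(case v of (i, j) \<Rightarrow> br i j u w) = 0"
    using v assms(3) by force
  ultimately have "(\<Prod>v\<in>keys m. (case v of (i, j) \<Rightarrow> br i j u w) ^ lookup m v) = 0"
    by (intro prod_zero bexI[of _ v]) (auto simp: in_keys_iff)
  then show "lookup P m * (\<Prod>v\<in>keys m. (case v of (i, j) \<Rightarrow> br i j u w) ^ lookup m v) = 0" by simp
qed

definition evf :: "nat \<Rightarrow> (nat \<Rightarrow> complex) \<Rightarrow> (nat \<Rightarrow> complex) \<Rightarrow> plpoly \<Rightarrow> complex" where
  "evf N u w P = (if P \<in> forms N N then pe u w P else 0)"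

lemma ev_eq_evf: "ev N U W = evf N (vec_index U) (vec_index W)"
  by (simp add: fun_eq_iff ev_def evf_def pe_def pl_forms_eq br_def)

lemma evf_cong: "(\<And>i. i < N \<Longrightarrow> u i = u' i \<and> w i = w' i) \<Longrightarrow> evf N u w = evf N u' w'"
  by (auto simp: evf_def fun_eq_iff intro: pe_cong)

lemma pe_plucker_ideal: "P \<in> plucker_ideal N \<Longrightarrow> pe u w P = 0"
  unfolding plucker_ideal_def
proof (induction rule: left_ideal.induct)
  case (gen P)
  then obtain i j k l where "P = pl i j * pl k l - pl i k * pl j l + pl i l * pl j k"
    by (auto simp: plucker_relations_def)
  then show ?case by (simp add: pe_hom pe_pl br_def) (simp add: algebra_simps)
qed (simp_all add: pe_hom)

lemma evf_V_space: "evf N u w \<in> V_space N"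
  unfolding V_space_def pl_forms_eq
  by (auto simp: evf_def pe_hom forms_add forms_scale pe_plucker_ideal)

text \<open>Dependent pairs add nothing: all their brackets vanish, so they evaluate to the zero
  functional, which is already the multiple 0 of the evaluation at an independent pair. Such a pair
  exists because \<open>N \<ge> 2\<close>.\<close>

lemma plucker_cone_eq:
  assumes "N \<ge> 2"
  shows "plucker_cone N = {fscale c (evf N u w) | c u w. True}"
proof (intro equalityI subsetI)
  fix v assume "v \<in> plucker_cone N"
  then show "v \<in> {fscale c (evf N u w) | c u w. True}"
    by (auto simp: plucker_cone_def ev_eq_evf)
next
  fix v assume "v \<in> {fscale c (evf N u w) | c u w. True}"
  then obtain c u w where v: "v = fscale c (evf N u w)" by auto
  have in_cone: "fscale c (evf N u w) \<in> plucker_cone N"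
    if "\<forall>s t. s \<cdot>\<^sub>v vec N u + t \<cdot>\<^sub>v vec N w = 0\<^sub>v N \<longrightarrow> s = 0 \<and> t = 0" for c u w
  proof -
    have "plane_basis N (vec N u) (vec N w) {s \<cdot>\<^sub>v vec N u + t \<cdot>\<^sub>v vec N w | s t. True}"
      using that by (simp add: plane_basis_def)
    moreover have "evf N u w = ev N (vec N u) (vec N w)"
      unfolding ev_eq_evf by (rule evf_cong) simp
    ultimately show ?thesis
      unfolding plucker_cone_def grassmannian2_def by (simp only: mem_Collect_eq) blast
  qed
  show "v \<in> plucker_cone N"
  proof (cases "\<forall>s t. s \<cdot>\<^sub>v vec N u + t \<cdot>\<^sub>v vec N w = 0\<^sub>v N \<longrightarrow> s = 0 \<and> t = 0")
    case True
    then show ?thesis using in_cone v by simp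
  next
    case False
    then obtain s t where st: "s \<cdot>\<^sub>v vec N u + t \<cdot>\<^sub>v vec N w = 0\<^sub>v N" "s \<noteq> 0 \<or> t \<noteq> 0" by blast
    have e: "s * u i + t * w i = 0" if "i < N" for i
      using arg_cong[OF st(1), of "\<lambda>v. vec_index v i"] that by simp
    have "br i j u w = 0" if "i < N" "j < N" for i j
    proof -
      have "s * br i j u w = w j * (s * u i + t * w i) - w i * (s * u j + t * w j)"
        "t * br i j u w = u i * (s * u j + t * w j) - u j * (s * u i + t * w i)"
        by (simp_all add: br_def algebra_simps)
      then show ?thesis using st(2) e that by auto
    qed
    then have "evf N u w = (\<lambda>P. 0)"
      using pe_degenerate[of _ N N u w] assms by (auto simp: evf_def fun_eq_iff)
    then have "v = fscale 0 (evf N (\<lambda>i. if i = 0 then 1 else 0) (\<lambda>i. if i = 1 then 1 else 0))"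
      by (simp add: v fscale_def)
    moreover have "fscale 0 (evf N (\<lambda>i. if i = 0 then 1 else 0) (\<lambda>i. if i = 1 then 1 else 0)) \<in> plucker_cone N"
    proof (rule in_cone, intro allI impI)
      fix s t :: complex
      let ?u = "\<lambda>i. if i = 0 then 1 else (0 :: complex)" and ?w = "\<lambda>i. if i = 1 then 1 else (0 :: complex)"
      assume "s \<cdot>\<^sub>v vec N ?u + t \<cdot>\<^sub>v vec N ?w = 0\<^sub>v N"
      then have "vec_index (s \<cdot>\<^sub>v vec N ?u + t \<cdot>\<^sub>v vec N ?w) i = 0" if "i < N" for i
        using that by simp
      from this[of 0] this[of 1] show "s = 0 \<and> t = 0" using assms by simp
    qed
    ultimately show ?thesis by simp
  qed
qed

section \<open>Coordinates on V and their dual forms\<close>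

lemma V_space_linear:
  assumes "v \<in> V_space N"
  shows "P \<notin> forms N N \<Longrightarrow> v P = 0"
    and "P \<in> forms N N \<Longrightarrow> Q \<in> forms N N \<Longrightarrow> v (P + Q) = v P + v Q"
    and "P \<in> forms N N \<Longrightarrow> v (Const c * P) = c * v P"
    and "P \<in> forms N N \<Longrightarrow> P \<in> plucker_ideal N \<Longrightarrow> v P = 0"
  using assms by (auto simp: V_space_def pl_forms_eq)

lemma V_space_zero: "v \<in> V_space N \<Longrightarrow> v 0 = 0"
  using V_space_linear(3)[of v N 0 0] by simp

lemma V_space_sum:
  assumes "v \<in> V_space N" "\<And>x. x \<in> A \<Longrightarrow> f x \<in> forms N N"
  shows "v (sum f A) = (\<Sum>x\<in>A. v (f x))"
  using assms(2)
  by (induction A rule: infinite_finite_induct)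
    (simp_all add: V_space_zero[OF assms(1)] V_space_linear(2)[OF assms(1)] forms_sum)

lemma sum_fun_eval: "(\<Sum>x\<in>A. f x) y = (\<Sum>x\<in>A. (f x y :: complex))"
  by (induction A rule: infinite_finite_induct) auto

text \<open>Elements of \<open>V\<close> are functionals on forms, so dual forms to a finite basis
  are found by elimination, one functional at a time. They turn the abstract coordinates
  \<open>dual_basis\<close> into evaluation at a form.\<close>

lemma dual_forms_exist:
  fixes a :: "'b::finite \<Rightarrow> plpoly \<Rightarrow> complex"
  assumes "is_basis a (V_space N)"
  shows "\<exists>p. \<forall>j. p j \<in> forms N N \<and> (\<forall>i. a i (p j) = (if i = j then 1 else 0))"
proof -
  have inj: "inj a" and ind: "fvec.independent (range a)" and span: "fvec.span (range a) = V_space N"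
    using assms by (auto simp: is_basis_def)
  have aV: "a i \<in> V_space N" for i using span fvec.span_base[of "a i" "range a"] by auto
  have nontriv: "\<forall>i\<in>A. c i = 0" if "finite A" "\<And>P. P \<in> forms N N \<Longrightarrow> (\<Sum>i\<in>A. c i * a i P) = 0" for c A
  proof -
    have "(\<Sum>i\<in>A. c i * a i P) = 0" for P
      using that(2)[of P] V_space_linear(1)[OF aV] by (cases "P \<in> forms N N") auto
    then have z: "(\<Sum>i\<in>A. fscale (c i) (a i)) = 0"
      by (simp add: fun_eq_iff fscale_def sum_fun_eval)
    have "(\<Sum>v\<in>a ` A. fscale (c (the_inv a v)) v) = (\<Sum>i\<in>A. fscale (c i) (a i))"
      by (subst sum.reindex) (use inj in \<open>auto simp: inj_on_def the_inv_f_f\<close>)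
    then have s0: "(\<Sum>v\<in>a ` A. fscale (c (the_inv a v)) v) = 0" using z by simp
    show ?thesis
    proof
      fix i assume "i \<in> A"
      then have "c (the_inv a (a i)) = 0"
        by (intro fvec.independentD[OF ind finite_imageI[OF that(1)] _ s0]) auto
      then show "c i = 0" by (simp add: the_inv_f_f[OF inj])
    qed
  qed
  have "\<exists>p. \<forall>j\<in>A. p j \<in> forms N N \<and> (\<forall>i\<in>A. a i (p j) = (if i = j then 1 else 0))" if "finite A" for A
    using that
  proof (induction A rule: finite_induct)
    case empty
    then show ?case by simp
  next
    case (insert k A)
    then obtain p where p: "\<And>j. j \<in> A \<Longrightarrow> p j \<in> forms N N"
      "\<And>i j. i \<in> A \<Longrightarrow> j \<in> A \<Longrightarrow> a i (p j) = (if i = j then 1 else 0)" by blast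
    \<comment> \<open>Otherwise \<open>a k\<close> would be a combination of the earlier functionals
      on all forms, against independence.\<close>
    have "\<exists>Q\<in>forms N N. a k Q - (\<Sum>j\<in>A. a k (p j) * a j Q) \<noteq> 0"
    proof (rule ccontr)
      assume "\<not> ?thesis"
      then have *: "a k Q - (\<Sum>j\<in>A. a k (p j) * a j Q) = 0" if "Q \<in> forms N N" for Q using that by blast
      have "(\<Sum>i\<in>insert k A. (if i = k then 1 else - a k (p i)) * a i Q) = 0" if "Q \<in> forms N N" for Q
      proof -
        have "(\<Sum>i\<in>A. (if i = k then 1 else - a k (p i)) * a i Q) = (\<Sum>i\<in>A. - (a k (p i) * a i Q))"
          using insert(2) by (intro sum.cong) auto
        then show ?thesis using *[OF that] insert(1,2) by (simp add: sum_negf)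
      qed
      from nontriv[OF _ this] insert(1) show False by auto
    qed
    then obtain Q where Q: "Q \<in> forms N N" "a k Q - (\<Sum>j\<in>A. a k (p j) * a j Q) \<noteq> 0" by blast
    define d where "d = a k Q - (\<Sum>j\<in>A. a k (p j) * a j Q)"
    \<comment> \<open>\<open>R\<close> is \<open>Q\<close> corrected so that the earlier functionals
      kill it, while \<open>a k\<close> takes the nonzero value \<open>d\<close>. It normalises the
      new form and corrects the old ones.\<close>
    define R where "R = Q + (\<Sum>j\<in>A. Const (- a j Q) * p j)"
    have R: "R \<in> forms N N" unfolding R_def using Q p by (intro forms_add forms_sum forms_scale)
    have aR: "a i R = a i Q - (\<Sum>j\<in>A. a j Q * a i (p j))" for i
      unfolding R_def
      by (subst V_space_linear(2)[OF aV], use Q p in \<open>auto intro!: forms_sum forms_scale\<close>)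
        (simp add: V_space_sum[OF aV] V_space_linear(3)[OF aV] p forms_scale sum_negf)
    have aRA: "a i R = 0" if "i \<in> A" for i
      using that insert(1) by (simp add: aR p if_distrib[where f="\<lambda>x. _ * x"] cong: if_cong)
    have aRk: "a k R = d" by (simp add: aR d_def mult.commute)
    define p' where "p' j = (if j = k then Const (1 / d) * R else p j + Const (- a k (p j) / d) * R)" for j
    have "p' j \<in> forms N N \<and> (\<forall>i\<in>insert k A. a i (p' j) = (if i = j then 1 else 0))" if "j \<in> insert k A" for j
    proof (cases "j = k")
      case True
      then show ?thesis using R Q(2) aRA aRk insert(2)
        by (auto simp: p'_def forms_scale V_space_linear(3)[OF aV] d_def[symmetric])
    next
      case False
      then have "j \<in> A" using that by simp
      then show ?thesis using R Q(2) aRA aRk insert(2) False p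
        by (auto simp: p'_def forms_scale forms_add V_space_linear(2,3)[OF aV] d_def[symmetric])
    qed
    then show ?case by blast
  qed
  from this[of UNIV] show ?thesis by auto
qed

locale plucker_frame =
  fixes N :: nat and a :: "'b::finite \<Rightarrow> plpoly \<Rightarrow> complex" and p :: "'b \<Rightarrow> plpoly"
  assumes N2: "N \<ge> 2" and basis: "is_basis a (V_space N)"
    and p_forms: "p j \<in> forms N N" and dual: "a i (p j) = (if i = j then 1 else 0)"
begin

text \<open>The \<open>j\<close>-th coordinate of the point of the cone given by \<open>u\<close>
  and \<open>w\<close>; see \<open>dual_basis_evf\<close>.\<close>

definition q :: "'b \<Rightarrow> (nat \<Rightarrow> complex) \<Rightarrow> (nat \<Rightarrow> complex) \<Rightarrow> complex" where
  "q j u w = pe u w (p j)"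

lemma a_V: "a i \<in> V_space N"
  using basis fvec.span_base[of "a i" "range a"] by (auto simp: is_basis_def)

lemma expand: "v \<in> V_space N \<Longrightarrow> v P = (\<Sum>i\<in>UNIV. dual_basis a i v * a i P)"
proof -
  assume v: "v \<in> V_space N"
  have b: "inj a" "fvec.independent (range a)" "fvec.span (range a) = V_space N"
    using basis by (auto simp: is_basis_def)
  have "v = (\<Sum>b\<in>range a. fscale (fvec.representation (range a) v b) b)"
    using fvec.sum_representation_eq[OF b(2), of v "range a"] v b(3) by simp
  also have "\<dots> = (\<Sum>i\<in>UNIV. fscale (dual_basis a i v) (a i))"
    using b(1) by (simp add: sum.reindex dual_basis_def)
  finally show ?thesis by (metis (no_types, lifting) fscale_def sum.cong sum_fun_eval)
qed

lemma dual_basis_eq: "v \<in> V_space N \<Longrightarrow> dual_basis a j v = v (p j)"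
  using expand[of v "p j"] by (simp add: dual if_distrib[where f="\<lambda>x. _ * x"] cong: if_cong)

lemma dual_basis_evf: "dual_basis a j (evf N u w) = q j u w"
  by (simp add: dual_basis_eq evf_V_space) (simp add: evf_def p_forms q_def)

lemma pe_expand: "P \<in> forms N N \<Longrightarrow> pe u w P = (\<Sum>i\<in>UNIV. q i u w * a i P)"
  using expand[OF evf_V_space, of u w P] by (simp add: dual_basis_evf evf_def)

lemma dual_basis_fscale: "v \<in> V_space N \<Longrightarrow> dual_basis a j (fscale c v) = c * dual_basis a j v"
proof -
  assume v: "v \<in> V_space N"
  have "fscale c v \<in> V_space N"
    using v basis fvec.span_scale[of v "range a" c] by (auto simp: is_basis_def)
  then show ?thesis using v by (simp add: dual_basis_eq) (simp add: fscale_def)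
qed

text \<open>Keeping the scalar \<open>c\<close> explicit allows a polynomial in the ideal to be
  split into its homogeneous components later.\<close>

lemma vanishing_ideal_iff:
  "P \<in> vanishing_ideal a (plucker_cone N) \<longleftrightarrow> (\<forall>c u w. poly_eval (\<lambda>i. c * q i u w) P = 0)"
proof -
  have "dual_basis a i (fscale c (evf N u w)) = c * q i u w" for i c u w
    by (simp add: dual_basis_fscale[OF evf_V_space] dual_basis_evf)
  moreover have "P \<in> vanishing_ideal a (plucker_cone N) \<longleftrightarrow>
      (\<forall>c u w. poly_eval (\<lambda>i. dual_basis a i (fscale c (evf N u w))) P = 0)"
    unfolding vanishing_ideal_def plucker_cone_eq[OF N2] by blast
  ultimately show ?thesis by simp
qed

end

section \<open>The group action on forms\<close>

lemma plucker_ideal_sum: "(\<And>x. x \<in> A \<Longrightarrow> f x \<in> plucker_ideal N) \<Longrightarrow> (\<Sum>x\<in>A. c x * f x) \<in> plucker_ideal N"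
  unfolding plucker_ideal_def
  by (induction A rule: infinite_finite_induct)
    (auto intro: left_ideal.zero left_ideal.add left_ideal.mult)

lemma pl_swap: "pl j i = - pl i j"
  by (auto simp: pl_def)

text \<open>The bracket of two vectors with polynomial entries. The group action substitutes such
  brackets for the Plucker coordinates.\<close>

definition pl_form :: "nat \<Rightarrow> (nat \<Rightarrow> plpoly) \<Rightarrow> (nat \<Rightarrow> plpoly) \<Rightarrow> plpoly" where
  "pl_form N x y = (\<Sum>k<N. \<Sum>l<N. x k * y l * pl k l)"

definition std_vec :: "nat \<Rightarrow> nat \<Rightarrow> plpoly" where
  "std_vec p i = (if i = p then 1 else 0)"

lemma pl_form_left: "pl_form N x y = (\<Sum>p<N. x p * pl_form N (std_vec p) y)"
proof -
  have "pl_form N (std_vec p) y = (\<Sum>l<N. y l * pl p l)" if "p < N" for p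
  proof -
    have "pl_form N (std_vec p) y = (\<Sum>k<N. if k = p then \<Sum>l<N. y l * pl k l else 0)"
      unfolding pl_form_def std_vec_def by (intro sum.cong) auto
    then show ?thesis using that by simp
  qed
  then show ?thesis by (simp add: pl_form_def sum_distrib_left mult.assoc)
qed

lemma pl_form_swap: "pl_form N y x = - pl_form N x y"
proof -
  have "pl_form N y x = (\<Sum>k<N. \<Sum>l<N. y l * x k * pl l k)"
    unfolding pl_form_def by (rule sum.swap)
  also have "\<dots> = (\<Sum>k<N. \<Sum>l<N. - (x k * y l * pl k l))"
    by (intro sum.cong refl) (subst pl_swap, simp add: mult.commute)
  also have "\<dots> = - pl_form N x y"
    by (simp only: pl_form_def sum_negf)
  finally show ?thesis .
qed

lemma pl_form_right: "pl_form N x y = (\<Sum>p<N. y p * pl_form N x (std_vec p))"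
proof -
  have "pl_form N x y = - (\<Sum>p<N. y p * pl_form N (std_vec p) x)"
    by (subst pl_form_swap, subst pl_form_left) (rule refl)
  also have "\<dots> = (\<Sum>p<N. y p * - pl_form N (std_vec p) x)"
    by (simp only: sum_negf mult_minus_right)
  also have "\<dots> = (\<Sum>p<N. y p * pl_form N x (std_vec p))"
    by (simp only: pl_form_swap[symmetric])
  finally show ?thesis .
qed

lemma pl_form_unit: "p < N \<Longrightarrow> q < N \<Longrightarrow> pl_form N (std_vec p) (std_vec q) = pl p q"
proof -
  assume "p < N" "q < N"
  then have "(\<Sum>l<N. std_vec p k * std_vec q l * pl k l) = (if k = p then pl k q else 0)" for k
    by (cases "k = p") (simp_all add: std_vec_def if_distrib[where f="\<lambda>x. x * _"] cong: if_cong)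
  then show ?thesis using \<open>p < N\<close> by (simp add: pl_form_def)
qed

lemma pl_form_self: "pl_form N x x = 0"
proof -
  have "lookup (pl_form N x x) m = - lookup (pl_form N x x) m" for m
    by (metis pl_form_swap lookup_uminus)
  then show ?thesis by (intro poly_mapping_eqI) simp
qed

text \<open>The four shapes correspond to the four vectors in a Plucker relation and record which
  factor of each product contains the expanded one.\<close>

lemma sum_trilinear:
  fixes x :: "'c \<Rightarrow> 'd::comm_ring_1"
  shows "(\<Sum>p\<in>A. x p * (f p * b - g p * d + h p * e)) = (\<Sum>p\<in>A. x p * f p) * b - (\<Sum>p\<in>A. x p * g p) * d + (\<Sum>p\<in>A. x p * h p) * e"
    "(\<Sum>p\<in>A. x p * (f p * b - d * g p + e * h p)) = (\<Sum>p\<in>A. x p * f p) * b - d * (\<Sum>p\<in>A. x p * g p) + e * (\<Sum>p\<in>A. x p * h p)"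
    "(\<Sum>p\<in>A. x p * (b * f p - g p * d + e * h p)) = b * (\<Sum>p\<in>A. x p * f p) - (\<Sum>p\<in>A. x p * g p) * d + e * (\<Sum>p\<in>A. x p * h p)"
    "(\<Sum>p\<in>A. x p * (b * f p - d * g p + h p * e)) = b * (\<Sum>p\<in>A. x p * f p) - d * (\<Sum>p\<in>A. x p * g p) + (\<Sum>p\<in>A. x p * h p) * e"
  by (induction A rule: infinite_finite_induct; simp add: algebra_simps)+

text \<open>The expression is linear in each of its four vectors; expanding them in
  \<open>std_vec\<close> one after the other leaves the defining relations. This is why the group
  action preserves the Plucker ideal.\<close>

lemma pl_form_relation:
  "pl_form N x y * pl_form N z t - pl_form N x z * pl_form N y t + pl_form N x t * pl_form N y z
    \<in> plucker_ideal N" (is "?E x y z t \<in> _")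
proof -
  let ?d = std_vec
  have x: "?E x y z t = (\<Sum>p<N. x p * ?E (?d p) y z t)" for x y z t
    by (simp only: sum_trilinear pl_form_left[symmetric])
  have y: "?E x y z t = (\<Sum>p<N. y p * ?E x (?d p) z t)" for x y z t
    by (simp only: sum_trilinear pl_form_left[symmetric] pl_form_right[symmetric])
  have z: "?E x y z t = (\<Sum>p<N. z p * ?E x y (?d p) t)" for x y z t
    by (simp only: sum_trilinear pl_form_left[symmetric] pl_form_right[symmetric])
  have t: "?E x y z t = (\<Sum>p<N. t p * ?E x y z (?d p))" for x y z t
    by (simp only: sum_trilinear pl_form_right[symmetric])
  have 0: "?E (?d i) (?d j) (?d k) (?d l) \<in> plucker_ideal N" if "i < N" "j < N" "k < N" "l < N" for i j k l
    using that unfolding plucker_ideal_def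
    by (intro left_ideal.gen) (auto simp: plucker_relations_def pl_form_unit)
  have 1: "?E (?d i) (?d j) (?d k) t \<in> plucker_ideal N" if "i < N" "j < N" "k < N" for i j k t
    by (subst t, rule plucker_ideal_sum, rule 0) (use that in auto)
  have 2: "?E (?d i) (?d j) z t \<in> plucker_ideal N" if "i < N" "j < N" for i j z t
    by (subst z, rule plucker_ideal_sum, rule 1) (use that in auto)
  have 3: "?E (?d i) y z t \<in> plucker_ideal N" if "i < N" for i y z t
    by (subst y, rule plucker_ideal_sum, rule 2) (use that in auto)
  show ?thesis
    by (subst x, rule plucker_ideal_sum, rule 3) auto
qed

lemma Const_mult: "Const (c * d) = Const c * Const d"
  by (simp add: Const_def mult_single)

lemma pl_act_hom:
  "pl_act N g (P + Q) = pl_act N g P + pl_act N g Q" "pl_act N g (P * Q) = pl_act N g P * pl_act N g Q"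
  "pl_act N g (- P) = - pl_act N g P" "pl_act N g (P - Q) = pl_act N g P - pl_act N g Q"
  "pl_act N g (Const c) = Const c" "pl_act N g 0 = 0"
  by (simp_all add: pl_act_def poly_subst_hom)

lemma pl_act_pl:
  "pl_act N g (pl i j) = pl_form N (\<lambda>k. Const (g $$ (i, k))) (\<lambda>l. Const (g $$ (j, l)))"
proof -
  have V: "pl_act N g (Var (i, j)) = pl_form N (\<lambda>k. Const (g $$ (i, k))) (\<lambda>l. Const (g $$ (j, l)))" for i j
    by (simp add: pl_act_def poly_subst_hom pl_form_def Const_mult)
  consider "i < j" | "j < i" | "i = j" by linarith
  then show ?thesis
  proof cases
    case 2
    then show ?thesis
      using V[of j i] pl_form_swap[of N "\<lambda>k. Const (g $$ (i, k))" "\<lambda>l. Const (g $$ (j, l))"]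
      by (simp add: pl_def pl_act_hom)
  qed (simp_all add: pl_def pl_act_hom V pl_form_self)
qed

lemma pl_act_plucker_ideal: "P \<in> plucker_ideal N \<Longrightarrow> pl_act N g P \<in> plucker_ideal N"
proof -
  assume "P \<in> plucker_ideal N"
  then show ?thesis
    unfolding plucker_ideal_def
  proof (induction rule: left_ideal.induct)
    case (gen P)
    then obtain i j k l where "P = pl i j * pl k l - pl i k * pl j l + pl i l * pl j k"
      by (auto simp: plucker_relations_def)
    then show ?case
      using pl_form_relation[of N] by (simp add: pl_act_hom pl_act_pl plucker_ideal_def)
  qed (auto simp: pl_act_hom intro: left_ideal.zero left_ideal.add left_ideal.mult)
qed

lemma pl_act_forms:
  assumes "P \<in> forms N d"
  shows "pl_act N g P \<in> forms N d"
  unfolding pl_act_def poly_subst_def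
proof (intro forms_sum forms_scale)
  fix m assume m: "m \<in> keys P"
  have "(\<Prod>v\<in>keys m. (case v of (i, j) \<Rightarrow> \<Sum>k<N. \<Sum>l<N. Const (g $$ (i, k) * g $$ (j, l)) * pl k l) ^ lookup m v)
      \<in> forms N (\<Sum>v\<in>keys m. lookup m v * 1)"
    by (intro forms_prod forms_power) (auto intro!: forms_sum forms_scale forms_pl simp del: One_nat_def)
  moreover have "mdeg m = d" using m assms by (auto simp: forms_def)
  ultimately show "(\<Prod>v\<in>keys m. (case v of (i, j) \<Rightarrow> \<Sum>k<N. \<Sum>l<N. Const (g $$ (i, k) * g $$ (j, l)) * pl k l) ^ lookup m v)
      \<in> forms N d"
    by (simp add: mdeg_def)
qed

definition gvec :: "nat \<Rightarrow> complex mat \<Rightarrow> (nat \<Rightarrow> complex) \<Rightarrow> nat \<Rightarrow> complex" where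
  "gvec N g u i = (\<Sum>k<N. g $$ (i, k) * u k)"

lemma pe_pl_act: "pe u w (pl_act N g P) = pe (gvec N g u) (gvec N g w) P"
proof -
  have "pe u w (\<Sum>k<N. \<Sum>l<N. Const (g $$ (i, k) * g $$ (j, l)) * pl k l) = br i j (gvec N g u) (gvec N g w)" for i j
  proof -
    have "br i j (gvec N g u) (gvec N g w) =
        (\<Sum>k<N. \<Sum>l<N. (g $$ (i, k) * u k) * (g $$ (j, l) * w l)) -
        (\<Sum>l<N. \<Sum>k<N. (g $$ (j, l) * u l) * (g $$ (i, k) * w k))"
      by (simp only: br_def gvec_def sum_product)
    also have "(\<Sum>l<N. \<Sum>k<N. (g $$ (j, l) * u l) * (g $$ (i, k) * w k)) =
        (\<Sum>k<N. \<Sum>l<N. (g $$ (j, l) * u l) * (g $$ (i, k) * w k))"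
      by (rule sum.swap)
    also have "(\<Sum>k<N. \<Sum>l<N. (g $$ (i, k) * u k) * (g $$ (j, l) * w l)) - \<dots> =
        (\<Sum>k<N. \<Sum>l<N. g $$ (i, k) * g $$ (j, l) * br k l u w)"
      unfolding sum_subtractf[symmetric]
      by (intro sum.cong refl) (simp add: br_def algebra_simps)
    finally show ?thesis by (simp add: pe_hom pe_pl)
  qed
  then show ?thesis
    unfolding pe_def pl_act_def poly_eval_subst
    by (intro poly_subst_cong) (auto simp: pe_def)
qed

section \<open>The induced Lie algebra representation\<close>

lemma smult_pow_mat:
  fixes x :: "complex mat"
  assumes "x \<in> carrier_mat N N"
  shows "(z \<cdot>\<^sub>m x) ^\<^sub>m k = z ^ k \<cdot>\<^sub>m (x ^\<^sub>m k)"
proof (induction k)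
  case 0
  show ?case using assms by (intro eq_matI) auto
next
  case (Suc k)
  have xk: "x ^\<^sub>m k \<in> carrier_mat N N" using assms by (rule pow_carrier_mat)
  then have "(z ^ k \<cdot>\<^sub>m (x ^\<^sub>m k)) * (z \<cdot>\<^sub>m x) = (z ^ k * z) \<cdot>\<^sub>m (x ^\<^sub>m k * x)"
    using assms by (intro eq_matI) (auto simp: scalar_prod_def sum_distrib_left algebra_simps)
  then show ?case by (simp add: Suc mult.commute)
qed

lemma norm_pow_mat_le:
  fixes x :: "complex mat"
  assumes x: "x \<in> carrier_mat N N" and M: "\<And>i j. i < N \<Longrightarrow> j < N \<Longrightarrow> norm (x $$ (i, j)) \<le> M"
    and ij: "i < N" "j < N"
  shows "norm ((x ^\<^sub>m k) $$ (i, j)) \<le> (real N * M) ^ k"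
  using ij
proof (induction k arbitrary: i j)
  case 0
  then show ?case using x by auto
next
  case (Suc k)
  have M0: "0 \<le> M" using M[OF Suc.prems] norm_ge_zero order_trans by blast
  have xk: "x ^\<^sub>m k \<in> carrier_mat N N" using x by (rule pow_carrier_mat)
  have "(x ^\<^sub>m Suc k) $$ (i, j) = (\<Sum>l<N. (x ^\<^sub>m k) $$ (i, l) * x $$ (l, j))"
    using x xk Suc.prems by (simp add: scalar_prod_def lessThan_atLeast0)
  also have "norm \<dots> \<le> (\<Sum>l<N. (real N * M) ^ k * M)"
    using Suc M M0 by (intro sum_norm_le) (auto simp: norm_mult intro!: mult_mono)
  finally show ?case by (simp add: mult_ac)
qed

text \<open>The entries of the \<open>k\<close>-th power grow at most like \<open>(N M)^k\<close>,
  so the exponential series converges at \<open>z = 1\<close> and may be differentiated termwise at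
  0.\<close>

lemma mat_exp_derivative:
  assumes x: "x \<in> carrier_mat N N" and ij: "i < N" "j < N"
  shows "((\<lambda>z. mat_exp N (z \<cdot>\<^sub>m x) $$ (i, j)) has_field_derivative x $$ (i, j)) (at 0)"
    and "mat_exp N (0 \<cdot>\<^sub>m x) $$ (i, j) = (if i = j then 1 else 0)"
proof -
  define c where "c k = (x ^\<^sub>m k) $$ (i, j) / fact k" for k
  have e: "mat_exp N (z \<cdot>\<^sub>m x) $$ (i, j) = suminf (\<lambda>k. c k * z ^ k)" for z
    using ij x pow_carrier_mat[OF x] by (simp add: mat_exp_def smult_pow_mat[OF x] c_def mult.commute)
  define M where "M = (\<Sum>i<N. \<Sum>j<N. norm (x $$ (i, j)))"
  have "norm (x $$ (i, j)) \<le> M" if "i < N" "j < N" for i j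
  proof -
    have "norm (x $$ (i, j)) \<le> (\<Sum>j<N. norm (x $$ (i, j)))"
      using that by (intro member_le_sum) auto
    also have "\<dots> \<le> M" unfolding M_def
      using that by (intro member_le_sum[of i "{..<N}" "\<lambda>i. \<Sum>j<N. norm (x $$ (i, j))"]) (auto intro: sum_nonneg)
    finally show ?thesis .
  qed
  note M = norm_pow_mat_le[OF x this ij]
  have "summable (\<lambda>k. c k * 1 ^ k)"
  proof (rule summable_comparison_test[OF exI, of 0])
    show "\<forall>n\<ge>0. norm (c n * 1 ^ n) \<le> inverse (fact n) * (real N * M) ^ n"
      using M by (simp add: c_def divide_inverse norm_mult norm_inverse mult.commute mult_left_mono)
    show "summable (\<lambda>n. inverse (fact n) * (real N * M) ^ n)" by (rule summable_exp)
  qed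
  from termdiffs_strong[OF this, of 0]
  have "((\<lambda>z. suminf (\<lambda>k. c k * z ^ k)) has_field_derivative c 1) (at 0)" by (simp add: diffs_def)
  moreover have "c 1 = x $$ (i, j)" using x by (simp add: c_def)
  ultimately show "((\<lambda>z. mat_exp N (z \<cdot>\<^sub>m x) $$ (i, j)) has_field_derivative x $$ (i, j)) (at 0)"
    by (simp add: e)
  show "mat_exp N (0 \<cdot>\<^sub>m x) $$ (i, j) = (if i = j then 1 else 0)"
    unfolding e powser_zero using x ij by (simp add: c_def)
qed

text \<open>The representation is defined through \<open>deriv\<close>, which is informative only
  for differentiable functions. A finite support common to all \<open>z\<close> reduces
  differentiability to coefficients and passes it on to every functional in
  \<open>V\<close>.\<close>

definition dcurve :: "(complex \<Rightarrow> 'v mpoly) \<Rightarrow> bool" where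
  "dcurve Q \<longleftrightarrow> (\<exists>K. finite K \<and> (\<forall>z. keys (Q z) \<subseteq> K)) \<and>
    (\<forall>m. (\<lambda>z. lookup (Q z) m) field_differentiable (at 0))"

lemma dcurve_const: "dcurve (\<lambda>z. P)"
  by (auto simp: dcurve_def intro: exI[of _ "keys P"])

lemma dcurve_Const: "h field_differentiable (at 0) \<Longrightarrow> dcurve (\<lambda>z. Const (h z))"
proof -
  assume "h field_differentiable (at 0)"
  then have "(\<lambda>z. lookup (Const (h z)) m) field_differentiable (at 0)" for m
    by (cases "m = 0") (simp_all add: Const_def lookup_single when_def)
  then show ?thesis by (auto simp: dcurve_def Const_def intro!: exI[of _ "{0}"])
qed

lemma dcurve_add: "dcurve P \<Longrightarrow> dcurve Q \<Longrightarrow> dcurve (\<lambda>z. P z + Q z)"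
proof -
  assume P: "dcurve P" and Q: "dcurve Q"
  then obtain K L where "finite K" "finite L" "\<And>z. keys (P z) \<subseteq> K" "\<And>z. keys (Q z) \<subseteq> L"
    by (auto simp: dcurve_def)
  moreover have "keys (P z + Q z) \<subseteq> keys (P z) \<union> keys (Q z)" for z by (rule Poly_Mapping.keys_add)
  ultimately have "finite (K \<union> L) \<and> (\<forall>z. keys (P z + Q z) \<subseteq> K \<union> L)" by blast
  then show ?thesis using P Q
    by (auto simp: dcurve_def lookup_add intro: field_differentiable_add)
qed

text \<open>Fixed index sets \<open>K\<close> and \<open>L\<close> keep the number of summands
  independent of the curve parameter.\<close>

lemma lookup_mult_superset:
  assumes "finite K" "finite L" "keys p \<subseteq> K" "keys q \<subseteq> L"
  shows "lookup (p * q :: 'v mpoly) m = (\<Sum>k\<in>K. \<Sum>l\<in>L. if k + l = m then lookup p k * lookup q l else 0)"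
proof -
  have d: "r = (\<Sum>m\<in>A. Poly_Mapping.single m (lookup r m))" if "finite A" "keys r \<subseteq> A" for r :: "'v mpoly" and A
  proof -
    have "(\<Sum>m\<in>keys r. Poly_Mapping.single m (lookup r m)) = (\<Sum>m\<in>A. Poly_Mapping.single m (lookup r m))"
      using that by (intro sum.mono_neutral_left) (auto simp: in_keys_iff)
    then show ?thesis by (simp only: poly_mapping_decompose[of r, symmetric])
  qed
  have "p * q = (\<Sum>k\<in>K. \<Sum>l\<in>L. Poly_Mapping.single (k + l) (lookup p k * lookup q l))"
    by (subst d[OF assms(1,3)], subst d[OF assms(2,4)]) (simp add: sum_product mult_single)
  then show ?thesis by (simp add: lookup_sum lookup_single when_def)
qed

lemma dcurve_mult: "dcurve P \<Longrightarrow> dcurve Q \<Longrightarrow> dcurve (\<lambda>z. P z * Q z)"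
proof -
  assume P: "dcurve P" and Q: "dcurve Q"
  then obtain K L where KL: "finite K" "finite L" "\<And>z. keys (P z) \<subseteq> K" "\<And>z. keys (Q z) \<subseteq> L"
    by (auto simp: dcurve_def)
  have "finite ((\<lambda>(k, l). k + l) ` (K \<times> L)) \<and> (\<forall>z. keys (P z * Q z) \<subseteq> (\<lambda>(k, l). k + l) ` (K \<times> L))"
  proof (intro conjI allI subsetI)
    fix z m assume "m \<in> keys (P z * Q z)"
    then obtain k l where "m = k + l" "k \<in> keys (P z)" "l \<in> keys (Q z)"
      using Poly_Mapping.keys_mult[of "P z" "Q z"] by auto
    then show "m \<in> (\<lambda>(k, l). k + l) ` (K \<times> L)" using KL by (auto intro!: image_eqI[of _ _ "(k, l)"])
  qed (use KL in auto)
  moreover have "(\<lambda>z. lookup (P z * Q z) m) field_differentiable (at 0)" for m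
  proof -
    have "(\<lambda>z. if k + l = m then lookup (P z) k * lookup (Q z) l else 0) field_differentiable (at 0)" for k l
      using P Q by (cases "k + l = m") (auto simp: dcurve_def intro!: field_differentiable_mult)
    then show ?thesis
      unfolding lookup_mult_superset[OF KL(1,2) KL(3,4)]
      by (intro field_differentiable_sum)
  qed
  ultimately show ?thesis unfolding dcurve_def by blast
qed

lemma dcurve_sum: "(\<And>x. x \<in> A \<Longrightarrow> dcurve (f x)) \<Longrightarrow> dcurve (\<lambda>z. \<Sum>x\<in>A. f x z)"
  by (induction A rule: infinite_finite_induct) (auto intro: dcurve_add dcurve_const)

lemma dcurve_subst: "(\<And>v. dcurve (s v)) \<Longrightarrow> dcurve (\<lambda>z. poly_subst Const (\<lambda>v. s v z) P)"
  by (induction P rule: mpoly_induct) (auto simp: poly_subst_hom dcurve_const intro: dcurve_add dcurve_mult)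

lemma V_space_dcurve:
  assumes v: "v \<in> V_space N" and Q: "dcurve Q" "\<And>z. Q z \<in> forms N N"
  shows "(\<lambda>z. v (Q z)) field_differentiable (at 0)"
proof -
  obtain K where K: "finite K" "\<And>z. keys (Q z) \<subseteq> K" using Q by (auto simp: dcurve_def)
  define K' where "K' = {m \<in> K. Poly_Mapping.single m 1 \<in> forms N N}"
  have s: "Poly_Mapping.single m 1 \<in> forms N N" if "m \<in> keys (Q z)" for m z
    using that Q(2)[of z] by (auto simp: forms_def)
  have "v (Q z) = (\<Sum>m\<in>K'. lookup (Q z) m * v (Poly_Mapping.single m 1))" for z
  proof -
    have "v (Q z) = v (\<Sum>m\<in>keys (Q z). Poly_Mapping.single m (lookup (Q z) m))"
      by (simp only: poly_mapping_decompose[of "Q z", symmetric])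
    also have "\<dots> = v (\<Sum>m\<in>keys (Q z). Const (lookup (Q z) m) * Poly_Mapping.single m 1)"
      by (simp only: single_eq_Const_mult[where c = "lookup (Q z) m" for m])
    also have "\<dots> = (\<Sum>m\<in>keys (Q z). lookup (Q z) m * v (Poly_Mapping.single m 1))"
      using s by (subst V_space_sum[OF v]) (auto intro!: forms_scale sum.cong V_space_linear(3)[OF v])
    also have "\<dots> = (\<Sum>m\<in>K'. lookup (Q z) m * v (Poly_Mapping.single m 1))"
      using K s by (intro sum.mono_neutral_left) (auto simp: K'_def in_keys_iff)
    finally show ?thesis .
  qed
  moreover have "(\<lambda>z. \<Sum>m\<in>K'. lookup (Q z) m * v (Poly_Mapping.single m 1)) field_differentiable (at 0)"
    using Q(1) by (auto simp: dcurve_def intro!: field_differentiable_sum field_differentiable_mult)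
  ultimately show ?thesis by presburger
qed

lemma forms_indices:
  assumes "P \<in> forms N d" "m \<in> keys P" "(i, j) \<in> keys m"
  shows "i < N" "j < N"
proof -
  have "keys m \<subseteq> {(i, j). i < j \<and> j < N}" using assms unfolding forms_def by blast
  then show "i < N" "j < N" using assms(3) by auto
qed

lemma dcurve_pl_act:
  assumes x: "x \<in> carrier_mat N N" and P: "P \<in> forms N d"
  shows "dcurve (\<lambda>z. pl_act N (mat_exp N (z \<cdot>\<^sub>m x)) P)"
proof -
  \<comment> \<open>The value 0 outside the index range matters: matrix entries there are
    unspecified, so nothing is known about their derivatives. Forms do not see these
    indices.\<close>
  define s where "s v z = (case v of (i, j) \<Rightarrow> if i < N \<and> j < N then
    \<Sum>k<N. \<Sum>l<N. Const (mat_exp N (z \<cdot>\<^sub>m x) $$ (i, k) * mat_exp N (z \<cdot>\<^sub>m x) $$ (j, l)) * pl k l else 0)" for v z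
  have e: "(\<lambda>z. mat_exp N (z \<cdot>\<^sub>m x) $$ (i, k)) field_differentiable (at 0)" if "i < N" "k < N" for i k
    unfolding field_differentiable_def by (rule exI, rule mat_exp_derivative(1)[OF x that])
  have "dcurve (s v)" for v
  proof -
    obtain i j where v: "v = (i, j)" by fastforce
    show ?thesis
    proof (cases "i < N \<and> j < N")
      case True
      have "dcurve (\<lambda>z. \<Sum>k<N. \<Sum>l<N.
          Const (mat_exp N (z \<cdot>\<^sub>m x) $$ (i, k) * mat_exp N (z \<cdot>\<^sub>m x) $$ (j, l)) * pl k l)"
        using True by (intro dcurve_sum dcurve_mult dcurve_const dcurve_Const field_differentiable_mult e) auto
      then show ?thesis using True by (simp add: s_def[abs_def] v)
    qed (auto simp: s_def[abs_def] v dcurve_const)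
  qed
  then have "dcurve (\<lambda>z. poly_subst Const (\<lambda>v. s v z) P)" by (rule dcurve_subst)
  moreover have "poly_subst Const (\<lambda>v. s v z) P = pl_act N (mat_exp N (z \<cdot>\<^sub>m x)) P" for z
    unfolding pl_act_def
    by (rule poly_subst_cong) (use forms_indices[OF P] in \<open>auto simp: s_def\<close>)
  ultimately show ?thesis by simp
qed

text \<open>A polynomial sees only the point and the tangent at \<open>t = 0\<close>. This is what
  replaces the exponential curve by the affine \<open>flow\<close>.\<close>

lemma pe_tangent:
  assumes "\<And>i. ((\<lambda>t. u1 t i) has_field_derivative u' i) (at 0)" "\<And>i. ((\<lambda>t. w1 t i) has_field_derivative w' i) (at 0)"
    and "\<And>i. ((\<lambda>t. u2 t i) has_field_derivative u' i) (at 0)" "\<And>i. ((\<lambda>t. w2 t i) has_field_derivative w' i) (at 0)"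
    and "u1 0 = u2 0" "w1 0 = w2 0"
  shows "\<exists>D. ((\<lambda>t. pe (u1 t) (w1 t) P) has_field_derivative D) (at (0::complex)) \<and>
    ((\<lambda>t. pe (u2 t) (w2 t) P) has_field_derivative D) (at 0)"
proof -
  define T where "T P D \<longleftrightarrow> ((\<lambda>t. pe (u1 t) (w1 t) P) has_field_derivative D) (at (0::complex)) \<and>
    ((\<lambda>t. pe (u2 t) (w2 t) P) has_field_derivative D) (at 0)" for P D
  have T_add: "T (P + Q) (D + E)" if "T P D" "T Q E" for P Q D E
  proof -
    have d: "((\<lambda>t. pe (u1 t) (w1 t) P) has_field_derivative D) (at 0)"
      "((\<lambda>t. pe (u1 t) (w1 t) Q) has_field_derivative E) (at 0)"
      "((\<lambda>t. pe (u2 t) (w2 t) P) has_field_derivative D) (at 0)"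
      "((\<lambda>t. pe (u2 t) (w2 t) Q) has_field_derivative E) (at 0)"
      using that by (simp_all only: T_def)
    show ?thesis
      using DERIV_add[OF d(1,2)] DERIV_add[OF d(3,4)] by (simp only: T_def pe_hom simp_thms)
  qed
  have T_mult: "T (P * Q) (D * pe (u2 0) (w2 0) Q + E * pe (u2 0) (w2 0) P)" if "T P D" "T Q E" for P Q D E
  proof -
    have d: "((\<lambda>t. pe (u1 t) (w1 t) P) has_field_derivative D) (at 0)"
      "((\<lambda>t. pe (u1 t) (w1 t) Q) has_field_derivative E) (at 0)"
      "((\<lambda>t. pe (u2 t) (w2 t) P) has_field_derivative D) (at 0)"
      "((\<lambda>t. pe (u2 t) (w2 t) Q) has_field_derivative E) (at 0)"
      using that by (simp_all only: T_def)
    show ?thesis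
      using DERIV_mult[OF d(1,2)] DERIV_mult[OF d(3,4)] by (simp only: T_def pe_hom assms(5,6) simp_thms)
  qed
  have T_Var: "T (Var (i, j)) (u' i * w2 0 j + u2 0 i * w' j - (u' j * w2 0 i + u2 0 j * w' i))" for i j
    unfolding T_def pe_Var br_def
    by (intro conjI
        DERIV_cong[OF DERIV_diff[OF DERIV_mult[OF assms(1)[of i] assms(2)[of j]] DERIV_mult[OF assms(1)[of j] assms(2)[of i]]]]
        DERIV_cong[OF DERIV_diff[OF DERIV_mult[OF assms(3)[of i] assms(4)[of j]] DERIV_mult[OF assms(3)[of j] assms(4)[of i]]]])
      (simp_all add: assms(5,6) algebra_simps)
  have "\<exists>D. T P D"
  proof (induction P rule: mpoly_induct)
    case (Const c)
    have "T (Const c) 0" by (simp add: T_def pe_hom)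
    then show ?case by blast
  next
    case (Var v)
    show ?case using T_Var by (cases v) blast
  next
    case (add P Q)
    then show ?case using T_add by blast
  next
    case (mult P Q)
    then show ?case using T_mult by blast
  qed
  then show ?thesis unfolding T_def .
qed

context plucker_frame
begin

text \<open>The matrix entry \<open>x_{ji}\<close> of the Lie algebra element \<open>x\<close>
  acting on the basis \<open>a\<close>.\<close>

definition tc :: "complex mat \<times> complex \<Rightarrow> 'b \<Rightarrow> 'b \<Rightarrow> complex" where
  "tc x j i = dual_basis a j (lie_rep N x (a i))"

context
  fixes x :: "complex mat" and s :: complex
  assumes x: "x \<in> carrier_mat N N"
begin

lemma rep_differentiable:
  assumes "v \<in> V_space N" "P \<in> forms N N"
  shows "(\<lambda>z. exp (z * s) * v (pl_act N (mat_exp N (z \<cdot>\<^sub>m x)) P)) field_differentiable (at 0)"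
proof (rule field_differentiable_mult)
  show "(\<lambda>z. exp (z * s)) field_differentiable at 0"
    unfolding field_differentiable_def by (rule exI[of _ s]) (auto intro!: derivative_eq_intros)
  show "(\<lambda>z. v (pl_act N (mat_exp N (z \<cdot>\<^sub>m x)) P)) field_differentiable at 0"
    by (rule V_space_dcurve[OF assms(1) dcurve_pl_act[OF x assms(2)]]) (rule pl_act_forms[OF assms(2)])
qed

lemma lie_rep_eq:
  "P \<in> forms N N \<Longrightarrow> lie_rep N (x, s) v P = deriv (\<lambda>z. exp (z * s) * v (pl_act N (mat_exp N (z \<cdot>\<^sub>m x)) P)) 0"
  by (simp add: lie_rep_def group_rep_def pl_forms_eq)

text \<open>Membership in \<open>V\<close> is what allows coordinates of the image to be read off by
  \<open>dual_basis_eq\<close>.\<close>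

lemma lie_rep_V_space:
  assumes v: "v \<in> V_space N"
  shows "lie_rep N (x, s) v \<in> V_space N"
  unfolding V_space_def pl_forms_eq
proof (intro CollectI conjI allI ballI impI)
  fix P assume "P \<notin> forms N N"
  then show "lie_rep N (x, s) v P = 0"
    by (simp add: lie_rep_def group_rep_def pl_forms_eq)
next
  fix P Q assume "P \<in> forms N N" "Q \<in> forms N N"
  then show "lie_rep N (x, s) v (P + Q) = lie_rep N (x, s) v P + lie_rep N (x, s) v Q"
    using deriv_add[OF rep_differentiable[OF v, of P] rep_differentiable[OF v, of Q]]
    by (simp add: lie_rep_eq forms_add pl_act_hom V_space_linear(2)[OF v] pl_act_forms distrib_left)
next
  fix c P assume "P \<in> forms N N"
  then show "lie_rep N (x, s) v (Const c * P) = c * lie_rep N (x, s) v P"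
    using deriv_cmult[OF rep_differentiable[OF v, of P], of c]
    by (simp add: lie_rep_eq forms_scale pl_act_hom V_space_linear(3)[OF v] pl_act_forms mult.left_commute)
next
  fix P assume "P \<in> forms N N \<inter> plucker_ideal N"
  then show "lie_rep N (x, s) v P = 0"
    by (simp add: lie_rep_eq V_space_linear(4)[OF v] pl_act_forms pl_act_plucker_ideal)
qed

lemma pe_flow_derivative:
  assumes P: "P \<in> forms N d"
  shows "\<exists>D. ((\<lambda>t. pe (flow N (\<lambda>i k. x $$ (i, k)) t u) (flow N (\<lambda>i k. x $$ (i, k)) t w) P)
      has_field_derivative D) (at 0) \<and>
    ((\<lambda>z. pe (gvec N (mat_exp N (z \<cdot>\<^sub>m x)) u) (gvec N (mat_exp N (z \<cdot>\<^sub>m x)) w) P) has_field_derivative D) (at 0)"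
proof -
  \<comment> \<open>Entries from \<open>N\<close> on are cut off because \<open>pe_tangent\<close>
    asks for matching tangents at every index.\<close>
  define F where "F u t i = (if i < N then flow N (\<lambda>i k. x $$ (i, k)) t u i else 0)" for u t i
  define G where "G u z i = (if i < N then gvec N (mat_exp N (z \<cdot>\<^sub>m x)) u i else 0)" for u z i
  define u' where "u' u i = (if i < N then (\<Sum>k<N. x $$ (i, k) * u k) else 0)" for u i
  have F: "((\<lambda>t. F u t i) has_field_derivative u' u i) (at 0)" for u i
    by (cases "i < N") (auto simp: F_def u'_def flow_def intro!: derivative_eq_intros)
  have G: "((\<lambda>t. G u t i) has_field_derivative u' u i) (at 0)" for u i
  proof (cases "i < N")
    case True
    have "((\<lambda>z. \<Sum>k<N. mat_exp N (z \<cdot>\<^sub>m x) $$ (i, k) * u k) has_field_derivative (\<Sum>k<N. x $$ (i, k) * u k)) (at 0)"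
      using mat_exp_derivative(1)[OF x True] by (intro DERIV_sum DERIV_cmult_right) auto
    then show ?thesis using True by (simp add: G_def u'_def gvec_def)
  qed (simp add: G_def u'_def)
  have "F u 0 = G u 0" for u
    using mat_exp_derivative(2)[OF x]
    by (auto simp: F_def G_def gvec_def flow_def fun_eq_iff if_distrib[where f="\<lambda>x. x * _"] cong: if_cong)
  from pe_tangent[OF F F G G this this, of u w P] obtain D where
    "((\<lambda>t. pe (F u t) (F w t) P) has_field_derivative D) (at 0)"
    "((\<lambda>t. pe (G u t) (G w t) P) has_field_derivative D) (at 0)" by blast
  moreover have "pe (F u t) (F w t) P = pe (flow N (\<lambda>i k. x $$ (i, k)) t u) (flow N (\<lambda>i k. x $$ (i, k)) t w) P" for t
    by (rule pe_cong[OF P]) (simp add: F_def)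
  moreover have "pe (G u t) (G w t) P = pe (gvec N (mat_exp N (t \<cdot>\<^sub>m x)) u) (gvec N (mat_exp N (t \<cdot>\<^sub>m x)) w) P" for t
    by (rule pe_cong[OF P]) (simp add: G_def)
  ultimately show ?thesis by auto
qed

text \<open>The action of \<open>exp (z (x, s))\<close> on a coordinate is differentiated twice,
  through the matrix \<open>tc\<close> and directly along the exponential curve. The scalar part
  contributes \<open>s * q j u w\<close> but does not move the plane, so subtracting it leaves the
  tangent of the flow.\<close>

lemma flow_derivative:
  "((\<lambda>t. q j (flow N (\<lambda>i k. x $$ (i, k)) t u) (flow N (\<lambda>i k. x $$ (i, k)) t w)) has_field_derivative
    (\<Sum>i\<in>UNIV. tc (x, s) j i * q i u w) - s * q j u w) (at 0)"
proof -
  obtain D where D: "((\<lambda>t. q j (flow N (\<lambda>i k. x $$ (i, k)) t u) (flow N (\<lambda>i k. x $$ (i, k)) t w)) has_field_derivative D) (at 0)"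
    "((\<lambda>z. pe (gvec N (mat_exp N (z \<cdot>\<^sub>m x)) u) (gvec N (mat_exp N (z \<cdot>\<^sub>m x)) w) (p j)) has_field_derivative D) (at 0)"
    using pe_flow_derivative[OF p_forms[of j]] unfolding q_def by blast
  define h where "h i z = exp (z * s) * a i (pl_act N (mat_exp N (z \<cdot>\<^sub>m x)) (p j))" for i z
  have h: "h i field_differentiable (at 0)" for i
    unfolding h_def by (rule rep_differentiable[OF a_V p_forms])
  have tc: "tc (x, s) j i = deriv (h i) 0" for i
    by (simp add: tc_def dual_basis_eq lie_rep_V_space a_V lie_rep_eq p_forms h_def[abs_def])
  have "((\<lambda>z. \<Sum>i\<in>UNIV. h i z * q i u w) has_field_derivative (\<Sum>i\<in>UNIV. tc (x, s) j i * q i u w)) (at 0)"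
    unfolding tc using h by (intro DERIV_sum DERIV_cmult_right) (simp add: field_differentiable_derivI)
  moreover have "(\<Sum>i\<in>UNIV. h i z * q i u w) =
      exp (z * s) * pe (gvec N (mat_exp N (z \<cdot>\<^sub>m x)) u) (gvec N (mat_exp N (z \<cdot>\<^sub>m x)) w) (p j)" for z
    unfolding pe_pl_act[symmetric] pe_expand[OF pl_act_forms[OF p_forms]] h_def sum_distrib_left
    by (intro sum.cong refl) (simp add: mult_ac)
  moreover have "pe (gvec N (mat_exp N (0 \<cdot>\<^sub>m x)) u) (gvec N (mat_exp N (0 \<cdot>\<^sub>m x)) w) (p j) = q j u w"
    unfolding q_def
    by (rule pe_cong[OF p_forms]) (simp add: gvec_def mat_exp_derivative(2)[OF x] if_distrib[where f="\<lambda>x. x * _"] cong: if_cong)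
  moreover have "((\<lambda>z. exp (z * s) * pe (gvec N (mat_exp N (z \<cdot>\<^sub>m x)) u) (gvec N (mat_exp N (z \<cdot>\<^sub>m x)) w) (p j))
      has_field_derivative s * q j u w + D) (at 0)"
    using calculation(3) by (auto intro!: derivative_eq_intros D(2))
  ultimately have "(\<Sum>i\<in>UNIV. tc (x, s) j i * q i u w) = s * q j u w + D"
    using DERIV_unique by (metis (no_types, lifting) ext)
  then show ?thesis using D(1) by simp
qed

end

end

section \<open>Solutions as functionals\<close>

definition mfact :: "('b::finite \<Rightarrow>\<^sub>0 nat) \<Rightarrow> complex" where
  "mfact m = (\<Prod>i\<in>UNIV. fact (lookup m i))"

text \<open>The factor \<open>mfact\<close> makes the partial derivative in direction
  \<open>i\<close> on series the transpose of multiplication by the \<open>i\<close>-th variable on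
  polynomials.\<close>

definition func :: "'b::finite series \<Rightarrow> 'b mpoly \<Rightarrow> complex" where
  "func c p = alg_eval (\<lambda>c. c) (\<lambda>m. mfact m * c m) p"

lemma func_linear:
  "func c (p + q) = func c p + func c q" "func c 0 = 0"
  "func c (\<Sum>x\<in>A. g x) = (\<Sum>x\<in>A. func c (g x))"
  "func c (Poly_Mapping.single m k) = k * (mfact m * c m)"
  by (simp_all add: func_def alg_eval_add alg_eval_sum alg_eval_single)

lemma func_scale: "func c (Const k * p) = k * func c p"
proof -
  have "func c (Const k * p) = func c (\<Sum>m\<in>keys p. Poly_Mapping.single m (k * lookup p m))"
    by (subst poly_mapping_decompose[of p]) (simp add: sum_distrib_left Const_def mult_single)
  also have "\<dots> = k * func c p"
    unfolding func_linear by (simp add: func_def alg_eval_def sum_distrib_left mult.assoc)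
  finally show ?thesis .
qed

lemma func_diff: "func c (p - q) = func c p - func c q"
proof -
  have "p - q = p + Const (-1) * q" by (simp add: Const_def single_uminus)
  then show ?thesis by (simp only: func_linear func_scale) simp
qed

lemma mfact_nonzero [simp]: "mfact m \<noteq> 0"
  by (simp add: mfact_def)

lemma mfact_zero [simp]: "mfact 0 = 1"
  by (simp add: mfact_def)

lemma mfact_shift: "mfact (m + Poly_Mapping.single i n) * fact (lookup m i) = mfact m * fact (lookup m i + n)"
proof -
  have "(\<Prod>k\<in>UNIV - {i}. fact (lookup (m + Poly_Mapping.single i n) k)) = (\<Prod>k\<in>UNIV - {i}. fact (lookup m k) :: complex)"
    by (intro prod.cong) (auto simp: lookup_add lookup_single when_def)
  then show ?thesis
    by (simp add: mfact_def prod.remove[of UNIV i] lookup_add)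
qed

lemma mfact_Suc: "mfact (m + Poly_Mapping.single i 1) = of_nat (lookup m i + 1) * mfact m"
proof -
  have "mfact (m + Poly_Mapping.single i 1) * fact (lookup m i) = (of_nat (lookup m i + 1) * mfact m) * fact (lookup m i)"
    using mfact_shift[of m i 1] by (simp add: algebra_simps)
  then show ?thesis by (rule mult_right_cancel[OF fact_nonzero, THEN iffD1])
qed

lemma weyl_act_zero: "weyl_act f 0 c = 0"
  by transfer (rule free_act_zero)

lemma weyl_act_sum: "weyl_act f (\<Sum>x\<in>A. P x) c = (\<Sum>x\<in>A. weyl_act f (P x) c)"
  by (induction A rule: infinite_finite_induct) (simp_all add: weyl_act_zero weyl_act_add)

lemma weyl_act_series_zero: "weyl_act f P 0 = 0"
  using weyl_act_series_add[of f P 0 0] by simp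

lemma weyl_act_left_ideal:
  assumes "P \<in> left_ideal S" "\<And>s. s \<in> S \<Longrightarrow> weyl_act f s c = 0"
  shows "weyl_act f P c = 0"
  using assms(1) by (induction rule: left_ideal.induct)
    (simp_all only: assms(2) weyl_act_zero weyl_act_add weyl_act_mult weyl_act_series_zero add_0)

lemma weyl_act_partial_power:
  fixes c :: "'b::finite series"
  shows "mfact m * weyl_act f (wpartial i ^ n) c m =
    mfact (m + Poly_Mapping.single i n) * c (m + Poly_Mapping.single i n)"
proof (induction n arbitrary: m)
  case 0
  then show ?case by (simp add: weyl_act_one)
next
  case (Suc n)
  have "mfact m * weyl_act f (wpartial i ^ Suc n) c m =
      mfact (m + Poly_Mapping.single i 1) * weyl_act f (wpartial i ^ n) c (m + Poly_Mapping.single i 1)"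
    by (simp add: weyl_act_mult weyl_act_partial mfact_Suc[simplified])
  also have "\<dots> = mfact (m + Poly_Mapping.single i (Suc n)) * c (m + Poly_Mapping.single i (Suc n))"
    using Suc[of "m + Poly_Mapping.single i 1"] by (simp add: add.assoc single_add[symmetric])
  finally show ?case .
qed

lemma weyl_act_partial_monom:
  fixes c :: "'b::finite series"
  shows "mfact m * weyl_act f (wpartial_monom n) c m = mfact (m + n) * c (m + n)"
proof -
  interpret comp_fun_commute "\<lambda>i P. wpartial i ^ lookup n i * P"
    by (rule wpartial_monom_comp_fun_commute)
  have "mfact m * weyl_act f (Finite_Set.fold (\<lambda>i P. wpartial i ^ lookup n i * P) 1 A) c m =
      mfact (m + (\<Sum>i\<in>A. Poly_Mapping.single i (lookup n i))) * c (m + (\<Sum>i\<in>A. Poly_Mapping.single i (lookup n i)))"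
    if "finite A" for A m
    using that
  proof (induction A arbitrary: m rule: finite_induct)
    case empty
    then show ?case by (simp add: weyl_act_one)
  next
    case (insert i A)
    then show ?case
      by (simp add: weyl_act_mult weyl_act_partial_power add.assoc)
  qed
  from this[of "keys n"] show ?thesis
    by (simp add: wpartial_monom_def poly_mapping_decompose[of n, symmetric])
qed

text \<open>As \<open>mfact\<close> never vanishes, \<open>p(\<partial>)\<close> kills the series
  exactly when the functional kills all monomial multiples of \<open>p\<close>.\<close>

lemma weyl_act_poly_partial:
  fixes c :: "'b::finite series"
  shows "mfact m * weyl_act f (poly_partial p) c m = func c (Poly_Mapping.single m 1 * p)"
proof -
  have "Poly_Mapping.single m 1 * p = (\<Sum>n\<in>keys p. Poly_Mapping.single (m + n) (lookup p n))"
    by (subst poly_mapping_decompose[of p]) (simp add: sum_distrib_left mult_single)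
  then have "func c (Poly_Mapping.single m 1 * p) = (\<Sum>n\<in>keys p. lookup p n * (mfact (m + n) * c (m + n)))"
    by (simp add: func_linear)
  also have "\<dots> = (\<Sum>n\<in>keys p. lookup p n * (mfact m * weyl_act f (wpartial_monom n) c m))"
    by (simp only: weyl_act_partial_monom)
  also have "\<dots> = mfact m * weyl_act f (poly_partial p) c m"
    by (simp add: poly_partial_def weyl_act_sum sum_fun_eval weyl_act_mult weyl_act_const fscale_def
        sum_distrib_left mult.left_commute)
  finally show ?thesis by simp
qed

text \<open>The derivation sending the variable \<open>j\<close> to the linear form with
  coefficients \<open>\<tau> j\<close>, applied to the monomial \<open>m\<close>. If
  \<open>lookup m j = 0\<close>, the truncated difference is harmless because the coefficient is
  0.\<close>

definition deriv_monom :: "('b \<Rightarrow> 'b \<Rightarrow> complex) \<Rightarrow> ('b \<Rightarrow>\<^sub>0 nat) \<Rightarrow> 'b::finite mpoly" where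
  "deriv_monom \<tau> m = (\<Sum>j\<in>UNIV. \<Sum>i\<in>UNIV.
    Poly_Mapping.single (m - Poly_Mapping.single j 1 + Poly_Mapping.single i 1) (\<tau> j i * of_nat (lookup m j)))"

text \<open>The same derivation applied to the linear form with coefficients
  \<open>f\<close>.\<close>

definition deriv_lin :: "('b \<Rightarrow> 'b \<Rightarrow> complex) \<Rightarrow> ('b \<Rightarrow> complex) \<Rightarrow> 'b::finite mpoly" where
  "deriv_lin \<tau> f = (\<Sum>j\<in>UNIV. \<Sum>i\<in>UNIV. Poly_Mapping.single (Poly_Mapping.single i 1) (\<tau> j i * f j))"

text \<open>Near the base point \<open>a_j\<close> acts as the constant \<open>f_j\<close> plus the
  shift \<open>a_j - f_j\<close>; the constant gives \<open>deriv_lin\<close> and the shift gives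
  \<open>deriv_monom\<close>.\<close>

lemma weyl_act_lin_operator:
  fixes c :: "'b::finite series"
  assumes "\<And>i j. dual_basis a j (T (a i)) = \<tau> j i"
  shows "mfact m * weyl_act f (lin_operator a T + wconst k) c m =
    func c (deriv_monom \<tau> m) + func c (deriv_lin \<tau> f * Poly_Mapping.single m 1) + k * (mfact m * c m)"
proof -
  let ?e = "\<lambda>i. Poly_Mapping.single i (1::nat)"
  have t: "mfact m * letter_act f (LCoord j) (letter_act f (LPartial i) c) m =
      f j * (mfact (m + ?e i) * c (m + ?e i)) +
      of_nat (lookup m j) * (mfact (m - ?e j + ?e i) * c (m - ?e j + ?e i))" for i j
  proof (cases "lookup m j = 0")
    case True
    then show ?thesis by (simp add: mfact_Suc[simplified])
  next
    case False
    then have m: "m - ?e j + ?e j = m" using minus_single_add[of m j] by (simp add: add.commute)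
    have "mfact m = of_nat (lookup m j) * mfact (m - ?e j)"
      using mfact_Suc[of "m - ?e j" j] False unfolding m by (simp add: lookup_minus)
    then show ?thesis using False by (simp add: mfact_Suc[simplified]) (simp add: algebra_simps)
  qed
  have "mfact m * weyl_act f (lin_operator a T) c m =
      (\<Sum>i\<in>UNIV. \<Sum>j\<in>UNIV. \<tau> j i * (mfact m * letter_act f (LCoord j) (letter_act f (LPartial i) c) m))"
    by (simp only: lin_operator_def weyl_act_sum sum_fun_eval weyl_act_mult weyl_act_const fscale_def
        weyl_act_coord weyl_act_partial assms sum_distrib_left mult.left_commute)
  also have "\<dots> = (\<Sum>j\<in>UNIV. \<Sum>i\<in>UNIV. \<tau> j i * (mfact m * letter_act f (LCoord j) (letter_act f (LPartial i) c) m))"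
    by (rule sum.swap)
  also have "\<dots> = func c (deriv_monom \<tau> m) + func c (deriv_lin \<tau> f * Poly_Mapping.single m 1)"
    unfolding t deriv_monom_def deriv_lin_def sum_distrib_right mult_single func_linear sum.distrib[symmetric]
    by (intro sum.cong refl) (simp add: algebra_simps)
  finally show ?thesis
    by (simp add: weyl_act_add weyl_act_const fscale_def distrib_left mult.left_commute)
qed

lemma poly_eval_deriv_lin:
  "poly_eval \<sigma> (deriv_lin \<tau> f) = (\<Sum>j\<in>UNIV. f j * (\<Sum>i\<in>UNIV. \<tau> j i * \<sigma> i))"
  by (simp add: deriv_lin_def poly_subst_hom poly_subst_single sum_distrib_left mult_ac)

lemma poly_eval_deriv_monom:
  "poly_eval \<sigma> (deriv_monom \<tau> m) =
    (\<Sum>j\<in>UNIV. of_nat (lookup m j) * monom_eval \<sigma> (m - Poly_Mapping.single j 1) * (\<Sum>i\<in>UNIV. \<tau> j i * \<sigma> i))"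
  by (simp add: deriv_monom_def poly_subst_hom poly_subst_single monom_eval_add sum_distrib_left mult_ac)

lemma monom_eval_UNIV: "monom_eval s (m :: 'b::finite \<Rightarrow>\<^sub>0 nat) = (\<Prod>v\<in>UNIV. s v ^ lookup m v)"
  by (rule monom_eval_superset) auto

lemma monom_eval_derivative:
  fixes \<sigma> :: "complex \<Rightarrow> 'b::finite \<Rightarrow> complex"
  assumes "\<And>j. ((\<lambda>t. \<sigma> t j) has_field_derivative \<sigma>' j) (at 0)"
  shows "((\<lambda>t. monom_eval (\<sigma> t) m) has_field_derivative
    (\<Sum>j\<in>UNIV. of_nat (lookup m j) * monom_eval (\<sigma> 0) (m - Poly_Mapping.single j 1) * \<sigma>' j)) (at 0)"
proof -
  have "((\<lambda>t. \<Prod>v\<in>B. \<sigma> t v ^ lookup m v) has_field_derivative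
     (\<Sum>j\<in>B. of_nat (lookup m j) * (\<sigma> 0 j ^ (lookup m j - 1) * (\<Prod>v\<in>B - {j}. \<sigma> 0 v ^ lookup m v)) * \<sigma>' j)) (at 0)"
    if "finite B" for B
    using that
  proof (induction B rule: finite_induct)
    case (insert j B)
    have "((\<lambda>t. \<sigma> t j ^ lookup m j) has_field_derivative
        of_nat (lookup m j) * \<sigma> 0 j ^ (lookup m j - 1) * \<sigma>' j) (at 0)"
      by (rule DERIV_cong[OF DERIV_power[OF assms]]) simp
    note d = DERIV_mult[OF this insert.IH]
    have s: "(\<Sum>i\<in>B. of_nat (lookup m i) * (\<sigma> 0 i ^ (lookup m i - 1) * (\<Prod>v\<in>insert j B - {i}. \<sigma> 0 v ^ lookup m v)) * \<sigma>' i)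
      = (\<Sum>i\<in>B. of_nat (lookup m i) * (\<sigma> 0 i ^ (lookup m i - 1) * (\<Prod>v\<in>B - {i}. \<sigma> 0 v ^ lookup m v)) * \<sigma>' i) * \<sigma> 0 j ^ lookup m j"
      unfolding sum_distrib_right
    proof (intro sum.cong refl)
      fix i assume "i \<in> B"
      then have "insert j B - {i} = insert j (B - {i})" "j \<notin> B - {i}" using insert(2) by auto
      then show "of_nat (lookup m i) * (\<sigma> 0 i ^ (lookup m i - 1) * (\<Prod>v\<in>insert j B - {i}. \<sigma> 0 v ^ lookup m v)) * \<sigma>' i
       = of_nat (lookup m i) * (\<sigma> 0 i ^ (lookup m i - 1) * (\<Prod>v\<in>B - {i}. \<sigma> 0 v ^ lookup m v)) * \<sigma>' i * \<sigma> 0 j ^ lookup m j"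
        using insert(1) by (simp add: mult_ac)
    qed
    have "insert j B - {j} = B" using insert(2) by auto
    then have "((\<lambda>t. \<sigma> t j ^ lookup m j * (\<Prod>v\<in>B. \<sigma> t v ^ lookup m v)) has_field_derivative
      (\<Sum>i\<in>insert j B. of_nat (lookup m i) * (\<sigma> 0 i ^ (lookup m i - 1) * (\<Prod>v\<in>insert j B - {i}. \<sigma> 0 v ^ lookup m v)) * \<sigma>' i)) (at 0)"
      by (intro DERIV_cong[OF d]) (simp only: sum.insert[OF insert(1,2)] s, simp add: mult_ac)
    then show ?case using insert(1,2) by simp
  qed simp
  note this[OF finite, of UNIV]
  moreover have "of_nat (lookup m j) * (\<sigma> 0 j ^ (lookup m j - 1) * (\<Prod>v\<in>UNIV - {j}. \<sigma> 0 v ^ lookup m v)) =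
      of_nat (lookup m j) * monom_eval (\<sigma> 0) (m - Poly_Mapping.single j 1)" for j
  proof -
    have "(\<Prod>v\<in>UNIV - {j}. \<sigma> 0 v ^ lookup (m - Poly_Mapping.single j 1) v) = (\<Prod>v\<in>UNIV - {j}. \<sigma> 0 v ^ lookup m v)"
      by (intro prod.cong) (auto simp: lookup_minus lookup_single when_def)
    then show ?thesis by (simp add: monom_eval_UNIV prod.remove[of UNIV j] lookup_minus)
  qed
  ultimately show ?thesis by (simp only: monom_eval_UNIV[of "\<sigma> t" m for t])
qed

section \<open>Uniqueness of solutions\<close>

definition homog :: "nat \<Rightarrow> 'v mpoly \<Rightarrow> bool" where
  "homog k p \<longleftrightarrow> (\<forall>m\<in>keys p. mdeg m = k)"

lemma homog_zero [simp]: "homog k 0"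
  by (simp add: homog_def)

lemma homog_add: "homog k p \<Longrightarrow> homog k q \<Longrightarrow> homog k (p + q)"
  using Poly_Mapping.keys_add[of p q] by (auto simp: homog_def)

lemma homog_sum: "(\<And>x. x \<in> A \<Longrightarrow> homog k (g x)) \<Longrightarrow> homog k (\<Sum>x\<in>A. g x)"
  by (induction A rule: infinite_finite_induct) (auto intro: homog_add)

lemma homog_mult: "homog k p \<Longrightarrow> homog l q \<Longrightarrow> homog (k + l) (p * q)"
  using Poly_Mapping.keys_mult[of p q] by (force simp: homog_def mdeg_add)

lemma homog_single: "mdeg m = k \<Longrightarrow> homog k (Poly_Mapping.single m c)"
  by (simp add: homog_def)

lemma homog_Const: "homog 0 (Const c)"
  by (simp add: Const_def homog_single)

lemma homog_scale: "homog k p \<Longrightarrow> homog k (Const c * p)"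
  using homog_mult[OF homog_Const] by simp

lemma homog_diff: "homog k p \<Longrightarrow> homog k q \<Longrightarrow> homog k (p - q)"
  using homog_add[of k p "Const (-1) * q"] homog_scale[of k q "-1"]
  by (simp add: Const_def single_uminus)

lemma homog_eval_scale:
  assumes "homog k p"
  shows "poly_eval (\<lambda>i. c * s i) p = c ^ k * poly_eval s p"
proof -
  have "monom_eval (\<lambda>i. c * s i) m = c ^ mdeg m * monom_eval s m" for m
    by (simp add: monom_eval_def mdeg_def power_mult_distrib prod.distrib power_sum)
  then show ?thesis
    using assms by (simp add: poly_subst_alg_eval alg_eval_def homog_def sum_distrib_left mult.left_commute)
qed

lemma mdeg_shift:
  assumes "lookup m j \<noteq> 0"
  shows "mdeg (m - Poly_Mapping.single j 1 + Poly_Mapping.single i 1) = mdeg m"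
proof -
  have "mdeg m = mdeg (Poly_Mapping.single j 1 + (m - Poly_Mapping.single j 1))"
    by (simp only: minus_single_add[OF assms])
  then show ?thesis by (simp add: mdeg_add)
qed

lemma homog_deriv_monom: "homog (mdeg m) (deriv_monom \<tau> m)"
  unfolding deriv_monom_def
proof (intro homog_sum)
  fix i j
  show "homog (mdeg m) (Poly_Mapping.single (m - Poly_Mapping.single j 1 + Poly_Mapping.single i 1)
      (\<tau> j i * of_nat (lookup m j)))"
    by (cases "lookup m j = 0") (auto intro!: homog_single mdeg_shift[simplified])
qed

lemma homog_deriv_lin: "homog 1 (deriv_lin \<tau> f)"
  unfolding deriv_lin_def by (intro homog_sum homog_single) simp

definition deriv_poly :: "('b \<Rightarrow> 'b \<Rightarrow> complex) \<Rightarrow> 'b::finite mpoly \<Rightarrow> 'b mpoly" where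
  "deriv_poly \<tau> p = (\<Sum>m\<in>keys p. Const (lookup p m) * deriv_monom \<tau> m)"

lemma homog_deriv_poly:
  assumes "homog k p"
  shows "homog k (deriv_poly \<tau> p)"
  unfolding deriv_poly_def
proof (intro homog_sum homog_scale)
  fix m assume "m \<in> keys p"
  then have "mdeg m = k" using assms by (simp add: homog_def)
  then show "homog k (deriv_monom \<tau> m)" using homog_deriv_monom[of m \<tau>] by simp
qed

lemma poly_eval_derivative:
  fixes \<sigma> :: "complex \<Rightarrow> 'b::finite \<Rightarrow> complex"
  assumes "\<And>j. ((\<lambda>t. \<sigma> t j) has_field_derivative (\<Sum>i\<in>UNIV. \<tau> j i * \<sigma> 0 i)) (at 0)"
  shows "((\<lambda>t. poly_eval (\<sigma> t) p) has_field_derivative poly_eval (\<sigma> 0) (deriv_poly \<tau> p)) (at 0)"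
  unfolding poly_subst_alg_eval alg_eval_def[of _ _ p] 
  unfolding poly_subst_alg_eval[symmetric] deriv_poly_def poly_subst_sum[OF coeff_hom_id]
  unfolding poly_subst_mult[OF coeff_hom_id] poly_subst_Const[OF coeff_hom_id] poly_eval_deriv_monom
  by (rule DERIV_sum, rule DERIV_cmult, rule monom_eval_derivative, rule assms)

lemma monomial_brackets:
  assumes "finite A"
  shows "\<exists>ps. length ps = (\<Sum>v\<in>A. n v) \<and> set ps \<subseteq> A \<and> (\<forall>\<sigma>. (\<Prod>v\<leftarrow>ps. \<sigma> v) = (\<Prod>v\<in>A. \<sigma> v ^ n v :: complex))"
  using assms
proof (induction A rule: finite_induct)
  case (insert x A)
  then obtain ps where "length ps = (\<Sum>v\<in>A. n v)" "set ps \<subseteq> A" "\<forall>\<sigma>. (\<Prod>v\<leftarrow>ps. \<sigma> v) = (\<Prod>v\<in>A. \<sigma> v ^ n v :: complex)"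
    by blast
  then show ?case using insert(1,2)
    by (intro exI[of _ "replicate (n x) x @ ps"]) (auto simp: prod_list_replicate)
qed simp

text \<open>Convergence is not assumed: uniqueness holds for formal power series.\<close>

locale solution = plucker_frame N a p for N and a :: "'b::finite \<Rightarrow> plpoly \<Rightarrow> complex" and p +
  fixes c :: "'b series"
  assumes annihilated: "\<And>P. P \<in> tautological_ideal a (plucker_cone N) (lie_alg N) (lie_rep N) beta \<Longrightarrow>
    weyl_act (\<lambda>i. a i (cyclic_section N)) P c = 0"
begin

definition f :: "'b \<Rightarrow> complex" where "f i = a i (cyclic_section N)"

lemma func_vanishing: "P \<in> vanishing_ideal a (plucker_cone N) \<Longrightarrow> func c P = 0"
proof -
  assume "P \<in> vanishing_ideal a (plucker_cone N)"
  then have "weyl_act (\<lambda>i. a i (cyclic_section N)) (poly_partial P) c = 0"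
    by (intro annihilated) (auto simp: tautological_ideal_def intro: left_ideal.gen)
  then show ?thesis
    using weyl_act_poly_partial[of 0 "\<lambda>i. a i (cyclic_section N)" P c] by simp
qed

lemma func_lie:
  assumes "(x, s) \<in> lie_alg N"
  shows "func c (deriv_monom (tc (x, s)) m) + func c (deriv_lin (tc (x, s)) f * Poly_Mapping.single m 1) +
    s * (mfact m * c m) = 0"
proof -
  have "weyl_act (\<lambda>i. a i (cyclic_section N)) (lin_operator a (lie_rep N (x, s)) + wconst (beta (x, s))) c = 0"
    using assms by (intro annihilated) (auto simp: tautological_ideal_def intro!: left_ideal.gen)
  then show ?thesis
    using weyl_act_lin_operator[of a "lie_rep N (x, s)" "tc (x, s)" m "\<lambda>i. a i (cyclic_section N)" "beta (x, s)" c]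
    by (simp add: tc_def beta_def f_def[abs_def])
qed

text \<open>Homogeneous polynomials of the same degree that agree at all points \<open>q\<close>
  agree on the whole cone, so their difference lies in the vanishing ideal. Identities in
  \<open>\<complex>[V]\<close> are therefore needed only for values.\<close>

lemma func_eq:
  assumes "homog k P" "homog k Q" "\<And>u w. poly_eval (\<lambda>i. q i u w) P = poly_eval (\<lambda>i. q i u w) Q"
  shows "func c P = func c Q"
proof -
  have "P - Q \<in> vanishing_ideal a (plucker_cone N)"
    unfolding vanishing_ideal_iff
    using homog_eval_scale[OF homog_diff[OF assms(1,2)]] assms(3) by (simp add: poly_subst_hom)
  then show ?thesis using func_vanishing func_diff[of c P Q] by simp
qed

text \<open>The cyclic section as a linear form on \<open>V\<close>.\<close>

definition ff :: "'b mpoly" where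
  "ff = (\<Sum>i\<in>UNIV. Const (f i) * Var i)"

lemma homog_Var: "homog 1 (Var i)"
  by (simp add: homog_single Var_def)

lemma homog_ff: "homog 1 ff"
  unfolding ff_def by (intro homog_sum homog_scale homog_Var)

lemma eval_ff: "poly_eval (\<lambda>i. q i u w) ff = cyc N u w"
  using pe_expand[OF cyclic_section_forms, of u w]
  by (simp add: ff_def poly_subst_hom f_def pe_cyclic_section mult.commute)

text \<open>The zero matrix has a constant flow, so only the scalar part of
  \<open>flow_derivative\<close> remains.\<close>

lemma tc_euler: "(\<Sum>i\<in>UNIV. tc (0\<^sub>m N N, 1) j i * q i u w) = q j u w"
proof -
  have "((\<lambda>t. q j (flow N (\<lambda>i k. (0\<^sub>m N N) $$ (i, k)) t u) (flow N (\<lambda>i k. (0\<^sub>m N N) $$ (i, k)) t w)) has_field_derivative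
    (\<Sum>i\<in>UNIV. tc (0\<^sub>m N N, 1) j i * q i u w) - 1 * q j u w) (at 0)"
    by (rule flow_derivative) simp
  moreover have "q j (flow N (\<lambda>i k. (0\<^sub>m N N) $$ (i, k)) t u) (flow N (\<lambda>i k. (0\<^sub>m N N) $$ (i, k)) t w) = q j u w" for t
    unfolding q_def by (rule pe_cong[OF p_forms]) (simp add: flow_def)
  ultimately have "((\<lambda>t. q j u w) has_field_derivative
      (\<Sum>i\<in>UNIV. tc (0\<^sub>m N N, 1) j i * q i u w) - 1 * q j u w) (at 0)" by (simp only:)
  from DERIV_unique[OF this DERIV_const] show ?thesis by simp
qed

lemma func_deriv_poly:
  "func c (deriv_poly \<tau> P) = (\<Sum>m\<in>keys P. lookup P m * func c (deriv_monom \<tau> m))"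
  by (simp add: deriv_poly_def func_linear func_scale)

lemma func_mult_poly:
  "func c (R * P) = (\<Sum>m\<in>keys P. lookup P m * func c (R * Poly_Mapping.single m 1))"
proof -
  have "R * P = (\<Sum>m\<in>keys P. Const (lookup P m) * (R * Poly_Mapping.single m 1))"
    by (subst poly_mapping_decompose[of P])
      (simp add: sum_distrib_left single_eq_Const_mult[where c="lookup P m" for m] mult.left_commute)
  then show ?thesis by (simp add: func_linear func_scale)
qed

text \<open>This is the equation of the Euler field at \<open>f\<close>: \<open>deriv_monom\<close>
  contributes the degree \<open>k\<close>, \<open>deriv_lin\<close> the factor \<open>ff\<close>,
  and \<open>beta\<close> the 1 in \<open>k + 1\<close>.\<close>

lemma func_ff:
  assumes "homog k P"
  shows "func c (ff * P) = - of_nat (k + 1) * func c P"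
proof -
  let ?x = "(0\<^sub>m N N, 1)"
  have x: "?x \<in> lie_alg N" by (simp add: lie_alg_def)
  have m: "func c (ff * Poly_Mapping.single m 1) = - of_nat (k + 1) * (mfact m * c m)" if "m \<in> keys P" for m
  proof -
    have k: "mdeg m = k" using assms that by (simp add: homog_def)
    have "func c (deriv_monom (tc ?x) m) = func c (Poly_Mapping.single m (of_nat k))"
    proof (rule func_eq)
      show "homog k (deriv_monom (tc ?x) m)" using homog_deriv_monom[of m] k by simp
      show "homog k (Poly_Mapping.single m (of_nat k))" by (rule homog_single[OF k])
      fix u w
      have "of_nat (lookup m j) * monom_eval (\<lambda>i. q i u w) (m - Poly_Mapping.single j 1) * q j u w =
        of_nat (lookup m j) * monom_eval (\<lambda>i. q i u w) m" for j
      proof (cases "lookup m j = 0")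
        case False
        have "monom_eval (\<lambda>i. q i u w) m = monom_eval (\<lambda>i. q i u w) (Poly_Mapping.single j 1 + (m - Poly_Mapping.single j 1))"
          by (simp only: minus_single_add[OF False])
        then show ?thesis by (simp add: monom_eval_add mult_ac)
      qed simp
      then have "poly_eval (\<lambda>i. q i u w) (deriv_monom (tc ?x) m) = (\<Sum>j\<in>UNIV. of_nat (lookup m j) * monom_eval (\<lambda>i. q i u w) m)"
        unfolding poly_eval_deriv_monom tc_euler by (intro sum.cong refl) blast
      also have "\<dots> = of_nat (\<Sum>j\<in>UNIV. lookup m j) * monom_eval (\<lambda>i. q i u w) m"
        by (simp only: sum_distrib_right of_nat_sum)
      also have "(\<Sum>j\<in>UNIV. lookup m j) = k"
        unfolding k[symmetric] mdeg_def by (intro sum.mono_neutral_right) (auto simp: in_keys_iff)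
      finally show "poly_eval (\<lambda>i. q i u w) (deriv_monom (tc ?x) m) = poly_eval (\<lambda>i. q i u w) (Poly_Mapping.single m (of_nat k))"
        by (simp add: poly_subst_single)
    qed
    moreover have "func c (deriv_lin (tc ?x) f * Poly_Mapping.single m 1) = func c (ff * Poly_Mapping.single m 1)"
    proof (rule func_eq)
      show "homog (1 + k) (deriv_lin (tc ?x) f * Poly_Mapping.single m 1)" "homog (1 + k) (ff * Poly_Mapping.single m 1)"
        by (intro homog_mult homog_deriv_lin homog_ff homog_single k)+
      show "poly_eval (\<lambda>i. q i u w) (deriv_lin (tc ?x) f * Poly_Mapping.single m 1) =
          poly_eval (\<lambda>i. q i u w) (ff * Poly_Mapping.single m 1)" for u w
        by (simp add: poly_subst_hom poly_eval_deriv_lin tc_euler ff_def)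
    qed
    ultimately have "of_nat k * (mfact m * c m) + func c (ff * Poly_Mapping.single m 1) + mfact m * c m = 0"
      using func_lie[OF x, of m] by (simp add: func_linear)
    then show ?thesis by (simp add: algebra_simps eq_neg_iff_add_eq_0)
  qed
  have "func c (ff * P) = (\<Sum>m\<in>keys P. lookup P m * (- of_nat (k + 1) * (mfact m * c m)))"
    unfolding func_mult_poly[of ff P] by (intro sum.cong refl) (simp only: m)
  also have "\<dots> = - of_nat (k + 1) * func c P"
    unfolding func_def alg_eval_def sum_distrib_left by (intro sum.cong refl) (rule mult.left_commute)
  finally show ?thesis .
qed

lemma func_traceless:
  assumes "(x, 0) \<in> lie_alg N"
  shows "func c (deriv_poly (tc (x, 0)) P) + func c (deriv_lin (tc (x, 0)) f * P) = 0"
proof -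
  have "func c (deriv_poly (tc (x, 0)) P) + func c (deriv_lin (tc (x, 0)) f * P) =
    (\<Sum>m\<in>keys P. lookup P m * (func c (deriv_monom (tc (x, 0)) m) + func c (deriv_lin (tc (x, 0)) f * Poly_Mapping.single m 1)))"
    by (simp only: func_deriv_poly func_mult_poly[of _ P] sum.distrib distrib_left)
  then show ?thesis using func_lie[OF assms] by simp
qed

section \<open>The invariant functional of a solution\<close>

definition rep :: "nat \<Rightarrow> 'b mpoly \<Rightarrow> pfun \<Rightarrow> bool" where
  "rep k P g \<longleftrightarrow> homog k P \<and> (\<forall>u w. cyc N u w \<noteq> 0 \<longrightarrow> g u w = poly_eval (\<lambda>i. q i u w) P / cyc N u w ^ Suc k)"

text \<open>By \<open>func_ff\<close>, multiplying the numerator by \<open>ff\<close> multiplies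
  \<open>func\<close> by \<open>-(k + 1)\<close>; the factor in front compensates this.\<close>

definition val :: "nat \<Rightarrow> 'b mpoly \<Rightarrow> complex" where
  "val k P = (-1) ^ k / fact k * func c P"

definition dom :: "pfun set" where
  "dom = {g. \<exists>k P. rep k P g}"

definition J :: "pfun \<Rightarrow> complex" where
  "J g = (SOME y. \<exists>k P. rep k P g \<and> y = val k P)"

lemma rep_lift: "rep k P g \<Longrightarrow> rep (Suc k) (ff * P) g \<and> val (Suc k) (ff * P) = val k P"
proof -
  assume r: "rep k P g"
  then have h: "homog k P" by (simp add: rep_def)
  have "func c (ff * P) = - of_nat (Suc k) * func c P" using func_ff[OF h] by simp
  then have "val (Suc k) (ff * P) = val k P" by (simp add: val_def del: of_nat_Suc)
  then show ?thesis using r homog_mult[OF homog_ff h] by (simp add: rep_def poly_subst_hom eval_ff)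
qed

lemma rep_lift_add: "rep k P g \<Longrightarrow> \<exists>P'. rep (k + d) P' g \<and> val (k + d) P' = val k P"
proof (induction d)
  case 0
  then show ?case by auto
next
  case (Suc d)
  then obtain P' where "rep (k + d) P' g" "val (k + d) P' = val k P" by blast
  then show ?case using rep_lift[of "k + d" P' g] by auto
qed

text \<open>Agreement is known only off the zeros of the section. After multiplication by
  \<open>ff\<close> both sides vanish at those zeros, and \<open>func_ff\<close> removes the factor
  again since \<open>-(k + 1)\<close> is nonzero.\<close>

lemma rep_unique_same:
  assumes "rep k P g" "rep k Q g"
  shows "val k P = val k Q"
proof -
  have h: "homog k P" "homog k Q" using assms by (simp_all add: rep_def)
  have "func c (ff * P) = func c (ff * Q)"
  proof (rule func_eq)
    show "homog (1 + k) (ff * P)" "homog (1 + k) (ff * Q)" by (intro homog_mult homog_ff h)+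
    fix u w
    show "poly_eval (\<lambda>i. q i u w) (ff * P) = poly_eval (\<lambda>i. q i u w) (ff * Q)"
    proof (cases "cyc N u w = 0")
      case False
      then have "poly_eval (\<lambda>i. q i u w) P / cyc N u w ^ Suc k = poly_eval (\<lambda>i. q i u w) Q / cyc N u w ^ Suc k"
        using assms by (metis rep_def)
      then show ?thesis using False by (simp add: poly_subst_hom)
    qed (simp add: poly_subst_hom eval_ff)
  qed
  then have e: "- of_nat (k + 1) * func c P = - of_nat (k + 1) * func c Q"
    by (simp only: func_ff[OF h(1)] func_ff[OF h(2)])
  have nz: "(- of_nat (k + 1) :: complex) \<noteq> 0"
    by (simp only: neg_equal_0_iff_equal of_nat_eq_0_iff)
  have "func c P = func c Q" by (rule mult_left_cancel[OF nz, THEN iffD1, OF e])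
  then show ?thesis by (simp add: val_def)
qed

lemma rep_unique:
  assumes "rep k P g" "rep l Q g"
  shows "val k P = val l Q"
proof -
  obtain P' where P': "rep (k + l) P' g" "val (k + l) P' = val k P" using rep_lift_add[OF assms(1)] by blast
  obtain Q' where Q': "rep (l + k) Q' g" "val (l + k) Q' = val l Q" using rep_lift_add[OF assms(2)] by blast
  show ?thesis using rep_unique_same[of "k + l" P' g Q'] P' Q' by (simp add: add.commute)
qed

lemma J_rep: "rep k P g \<Longrightarrow> J g = val k P"
  unfolding J_def
proof (rule some_equality)
  assume r: "rep k P g"
  then show "\<exists>k' P'. rep k' P' g \<and> val k P = val k' P'" by blast
  fix y assume "\<exists>k P. rep k P g \<and> y = val k P"
  then obtain k' P' where "rep k' P' g" "y = val k' P'" by blast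
  then show "y = val k P" using rep_unique[OF r] by simp
qed

lemma domI: "rep k P g \<Longrightarrow> g \<in> dom"
  by (auto simp: dom_def)

text \<open>Each block of \<open>N\<close> brackets is a form of degree \<open>N\<close>, hence a
  linear form in the coordinates \<open>q\<close> by \<open>pe_expand\<close>.\<close>

lemma rep_brackets:
  assumes "length ps = k * N" "set ps \<subseteq> {..<N} \<times> {..<N}"
  shows "\<exists>P. homog k P \<and> (\<forall>u w. poly_eval (\<lambda>i. q i u w) P = (\<Prod>(i, j)\<leftarrow>ps. br i j u w))"
  using assms
proof (induction k arbitrary: ps)
  case 0
  then show ?case by (intro exI[of _ "Const 1"]) (simp add: homog_Const poly_subst_hom)
next
  case (Suc k)
  have "length (drop N ps) = k * N" "set (drop N ps) \<subseteq> {..<N} \<times> {..<N}"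
    using Suc.prems set_drop_subset[of N ps] by auto
  from Suc.IH[OF this] obtain P where P: "homog k P"
    "\<And>u w. poly_eval (\<lambda>i. q i u w) P = (\<Prod>(i, j)\<leftarrow>drop N ps. br i j u w)" by blast
  define M where "M = (\<Prod>(i, j)\<leftarrow>take N ps. pl i j)"
  have "M \<in> forms N (length (take N ps))"
    unfolding M_def using Suc.prems set_take_subset[of N ps]
    by (intro forms_prod_list) (auto intro!: forms_pl simp del: One_nat_def)
  then have M: "M \<in> forms N N" using Suc.prems by simp
  have "pe u w (prod_list xs) = prod_list (map (pe u w) xs)" for xs u w
    by (induction xs) (simp_all add: pe_hom)
  then have peM: "pe u w M = (\<Prod>(i, j)\<leftarrow>take N ps. br i j u w)" for u w
    by (simp add: M_def o_def case_prod_unfold pe_pl)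
  define Q where "Q = (\<Sum>i\<in>UNIV. Const (a i M) * Var i)"
  have Q: "homog 1 Q" unfolding Q_def by (intro homog_sum homog_scale homog_Var)
  have "poly_eval (\<lambda>i. q i u w) (Q * P) = (\<Prod>(i, j)\<leftarrow>ps. br i j u w)" for u w
  proof -
    have "poly_eval (\<lambda>i. q i u w) Q = (\<Prod>(i, j)\<leftarrow>take N ps. br i j u w)"
      using pe_expand[OF M, of u w] by (simp add: Q_def poly_subst_hom peM mult.commute)
    then have "poly_eval (\<lambda>i. q i u w) (Q * P) = (\<Prod>(i, j)\<leftarrow>take N ps @ drop N ps. br i j u w)"
      unfolding map_append prod_list.append by (simp add: poly_subst_hom P(2))
    then show ?thesis by simp
  qed
  then show ?case using homog_mult[OF Q P(1)] by auto
qed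

text \<open>The quotient rule turns \<open>P / f^(k+1)\<close> into
  \<open>f \<delta>P - (k + 1) \<delta>f P\<close> over \<open>f^(k+2)\<close>, and
  \<open>func\<close> of this numerator is \<open>-(k + 1)\<close> times the left side of the Lie
  algebra equation \<open>func_traceless\<close>.\<close>

lemma J_invariant:
  assumes g: "g \<in> dom" and X: "(\<Sum>i<N. X i i) = 0"
    and h: "\<And>u w. cyc N u w \<noteq> 0 \<Longrightarrow>
        ((\<lambda>t. g (flow N X t u) (flow N X t w)) has_field_derivative h u w) (at 0)"
  shows "h \<in> dom \<and> J h = 0"
proof -
  obtain k P where kP: "rep k P g" using g by (auto simp: dom_def)
  then have P: "homog k P" by (simp add: rep_def)
  define x where "x = mat N N (\<lambda>(i, k). X i k)"
  have x: "x \<in> carrier_mat N N" by (simp add: x_def)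
  have xl: "(x, 0) \<in> lie_alg N" using X by (simp add: lie_alg_def x_def)
  let ?\<tau> = "tc (x, 0)"
  have fl: "flow N X t u i = flow N (\<lambda>i k. x $$ (i, k)) t u i" if "i < N" for t u i
    using that by (simp add: flow_def x_def)
  have cycX: "cyc N (flow N X t u) (flow N X t w) = cyc N (flow N (\<lambda>i k. x $$ (i, k)) t u) (flow N (\<lambda>i k. x $$ (i, k)) t w)" for t u w
    unfolding pe_cyclic_section[symmetric] by (rule pe_cong[OF cyclic_section_forms]) (simp add: fl)
  have qX: "q j (flow N X t u) (flow N X t w) = q j (flow N (\<lambda>i k. x $$ (i, k)) t u) (flow N (\<lambda>i k. x $$ (i, k)) t w)" for j t u w
    unfolding q_def by (rule pe_cong[OF p_forms]) (simp add: fl)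
  have flow0: "flow N X 0 u = u" for u by (simp add: flow_def)
  have dq: "((\<lambda>t. q j (flow N X t u) (flow N X t w)) has_field_derivative (\<Sum>i\<in>UNIV. ?\<tau> j i * q i u w)) (at 0)" for j u w
    using flow_derivative[OF x, of j u w 0] by (simp add: qX)
  have dP: "((\<lambda>t. poly_eval (\<lambda>i. q i (flow N X t u) (flow N X t w)) R) has_field_derivative
      poly_eval (\<lambda>i. q i u w) (deriv_poly ?\<tau> R)) (at 0)" for R u w
    using poly_eval_derivative[of "\<lambda>t i. q i (flow N X t u) (flow N X t w)" ?\<tau> R] dq by (simp add: flow0)
  have dc: "((\<lambda>t. cyc N (flow N X t u) (flow N X t w)) has_field_derivative
      poly_eval (\<lambda>i. q i u w) (deriv_lin ?\<tau> f)) (at 0)" for u w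
  proof -
    have "((\<lambda>t. \<Sum>j\<in>UNIV. f j * q j (flow N X t u) (flow N X t w)) has_field_derivative
      (\<Sum>j\<in>UNIV. f j * (\<Sum>i\<in>UNIV. ?\<tau> j i * q i u w))) (at 0)"
      by (intro DERIV_sum DERIV_cmult dq)
    moreover have "(\<Sum>j\<in>UNIV. f j * q j (flow N X t u) (flow N X t w)) = cyc N (flow N X t u) (flow N X t w)" for t
      unfolding eval_ff[symmetric] by (simp add: ff_def poly_subst_hom)
    ultimately show ?thesis by (simp add: poly_eval_deriv_lin)
  qed
  define R where "R = ff * deriv_poly ?\<tau> P - Const (of_nat (k + 1)) * (deriv_lin ?\<tau> f * P)"
  have R: "homog (1 + k) R" unfolding R_def
    by (intro homog_diff homog_scale homog_mult homog_ff homog_deriv_lin homog_deriv_poly P)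
  have "rep (Suc k) R h"
    unfolding rep_def
  proof (intro conjI allI impI)
    show "homog (Suc k) R" using R by simp
    fix u w assume nz: "cyc N u w \<noteq> 0"
    let ?C = "\<lambda>t. cyc N (flow N X t u) (flow N X t w)"
    let ?P = "\<lambda>t. poly_eval (\<lambda>i. q i (flow N X t u) (flow N X t w)) P"
    \<comment> \<open>The function \<open>g\<close> is known to be the fraction only off the zeros
      of the section, so the flow has to stay there for small \<open>t\<close>.\<close>
    have "isCont ?C 0" using DERIV_isCont[OF dc] .
    then have "?C \<midarrow>0\<rightarrow> ?C 0" by (simp add: isCont_def)
    then have "\<forall>\<^sub>F t in at 0. ?C t \<noteq> 0"
      using nz by (intro tendsto_imp_eventually_ne) (simp_all add: flow0)
    then have "\<forall>\<^sub>F t in nhds 0. ?C t \<noteq> 0"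
      using nz by (simp add: eventually_nhds_conv_at flow0)
    then have ev: "\<forall>\<^sub>F t in nhds 0. g (flow N X t u) (flow N X t w) = ?P t / ?C t ^ Suc k"
      by eventually_elim (use kP in \<open>auto simp: rep_def\<close>)
    let ?D = "(poly_eval (\<lambda>i. q i u w) (deriv_poly ?\<tau> P) * ?C 0 ^ Suc k -
        ?P 0 * (of_nat (Suc k) * (poly_eval (\<lambda>i. q i u w) (deriv_lin ?\<tau> f) * ?C 0 ^ k))) / (?C 0 ^ Suc k * ?C 0 ^ Suc k)"
    have "((\<lambda>t. ?P t / ?C t ^ Suc k) has_field_derivative ?D) (at 0)"
      by (rule DERIV_cong[OF DERIV_divide[OF dP DERIV_power[OF dc]]]) (use nz in \<open>simp_all add: flow0\<close>)
    moreover have "((\<lambda>t. ?P t / ?C t ^ Suc k) has_field_derivative h u w) (at 0)"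
      using h[OF nz] by (rule DERIV_cong_ev[OF refl ev refl, THEN iffD1])
    ultimately have "h u w = ?D" using DERIV_unique by blast
    also have "\<dots> = poly_eval (\<lambda>i. q i u w) R / cyc N u w ^ Suc (Suc k)"
      using nz by (simp add: R_def poly_subst_hom eval_ff flow0 divide_simps) (simp add: algebra_simps)
    finally show "h u w = poly_eval (\<lambda>i. q i u w) R / cyc N u w ^ Suc (Suc k)" .
  qed
  moreover have "func c R = 0"
  proof -
    have "func c R = - of_nat (k + 1) * (func c (deriv_poly ?\<tau> P) + func c (deriv_lin ?\<tau> f * P))"
      unfolding R_def func_diff func_scale func_ff[OF homog_deriv_poly[OF P]] by (simp add: algebra_simps)
    then show ?thesis using func_traceless[OF xl] by simp
  qed
  ultimately show ?thesis using domI J_rep by (auto simp: val_def)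
qed

lemma J_functional: "invariant_functional N dom J"
proof
  show "2 \<le> N" by (rule N2)
next
  fix k ps assume "length ps = k * N" "set ps \<subseteq> {..<N} \<times> {..<N}"
  then obtain P where "homog k P" "\<forall>u w. poly_eval (\<lambda>i. q i u w) P = (\<Prod>(i, j)\<leftarrow>ps. br i j u w)"
    using rep_brackets by blast
  then have "rep k P (\<lambda>u w. (\<Prod>(i, j)\<leftarrow>ps. br i j u w) / cyc N u w ^ Suc k)" by (simp add: rep_def)
  then show "(\<lambda>u w. (\<Prod>(i, j)\<leftarrow>ps. br i j u w) / cyc N u w ^ Suc k) \<in> dom" by (rule domI)
next
  fix g h :: pfun assume "g \<in> dom" and e: "\<And>u w. cyc N u w \<noteq> 0 \<Longrightarrow> g u w = h u w"
  then obtain k P where r: "rep k P g" by (auto simp: dom_def)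
  then have "rep k P h" using e by (simp add: rep_def)
  then show "h \<in> dom \<and> J h = J g" using J_rep[OF r] J_rep[of k P h] domI[of k P h] by simp
next
  fix g h assume "g \<in> dom" "h \<in> dom"
  then obtain k P l Q where kP: "rep k P g" and lQ: "rep l Q h" by (auto simp: dom_def)
  obtain P' where P': "rep (k + l) P' g" using rep_lift_add[OF kP] by blast
  obtain Q' where Q': "rep (k + l) Q' h" using rep_lift_add[OF lQ, of k] by (auto simp: add.commute)
  have r: "rep (k + l) (P' + Q') (\<lambda>u w. g u w + h u w)"
    using P' Q' homog_add[of "k + l" P' Q'] by (simp add: rep_def poly_subst_hom add_divide_distrib)
  have v: "val (k + l) (P' + Q') = val (k + l) P' + val (k + l) Q'"
    by (simp add: val_def func_linear distrib_left)
  show "(\<lambda>u w. g u w + h u w) \<in> dom \<and> J (\<lambda>u w. g u w + h u w) = J g + J h"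
    using domI[OF r] by (simp only: J_rep[OF r] J_rep[OF P'] J_rep[OF Q'] v simp_thms)
next
  fix g z assume "g \<in> dom"
  then obtain k P where kP: "rep k P g" by (auto simp: dom_def)
  then have r: "rep k (Const z * P) (\<lambda>u w. z * g u w)"
    using homog_scale[of k P z] by (simp add: rep_def poly_subst_hom)
  have v: "val k (Const z * P) = z * val k P"
    by (simp add: val_def func_scale)
  show "(\<lambda>u w. z * g u w) \<in> dom \<and> J (\<lambda>u w. z * g u w) = z * J g"
    using domI[OF r] by (simp only: J_rep[OF r] J_rep[OF kP] v simp_thms)
next
  fix g h X assume "g \<in> dom" "(\<Sum>i<N. X i i) = 0"
    "\<And>u w. cyc N u w \<noteq> 0 \<Longrightarrow> ((\<lambda>t. g (flow N X t u) (flow N X t w)) has_field_derivative h u w) (at 0)"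
  then show "h \<in> dom \<and> J h = 0" by (rule J_invariant[where X=X])
qed

text \<open>The function \<open>1 / cyc\<close> is represented by the constant 1 with
  \<open>k = 0\<close>, so its value is \<open>c 0\<close>; \<open>brackets_zero\<close> carries its
  vanishing to all bracket products.\<close>

lemma form_zero:
  assumes "c 0 = 0" "P \<in> forms N (k * N)"
  shows "(\<lambda>u w. pe u w P / cyc N u w ^ Suc k) \<in> dom \<and> J (\<lambda>u w. pe u w P / cyc N u w ^ Suc k) = 0"
proof -
  have "rep 0 (Const 1) (\<lambda>u w. 1 / cyc N u w)" by (simp add: rep_def homog_Const poly_subst_hom)
  moreover have "func c (Const 1) = 0" unfolding Const_def func_linear using assms(1) by simp
  ultimately have J1: "J (\<lambda>u w. 1 / cyc N u w) = 0" by (simp add: J_rep val_def)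
  have mono: "(\<lambda>u w. monom_eval (\<lambda>(i, j). br i j u w) m / cyc N u w ^ Suc k) \<in> dom \<and>
      J (\<lambda>u w. monom_eval (\<lambda>(i, j). br i j u w) m / cyc N u w ^ Suc k) = 0" if m: "m \<in> keys P" for m
  proof -
    obtain ps where ps: "length ps = (\<Sum>v\<in>keys m. lookup m v)" "set ps \<subseteq> keys m"
      "\<forall>\<sigma>. (\<Prod>v\<leftarrow>ps. \<sigma> v) = (\<Prod>v\<in>keys m. \<sigma> v ^ lookup m v :: complex)"
      using monomial_brackets[OF finite_keys[of m], of "lookup m"] by blast
    have "keys m \<subseteq> {(i, j). i < j \<and> j < N}" "mdeg m = k * N" using assms(2) m unfolding forms_def by blast+
    then have l: "length ps = k * N" "set ps \<subseteq> {..<N} \<times> {..<N}" using ps by (auto simp: mdeg_def)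
    have "(\<lambda>u w. monom_eval (\<lambda>(i, j). br i j u w) m / cyc N u w ^ Suc k) =
        (\<lambda>u w. (\<Prod>(i, j)\<leftarrow>ps. br i j u w) / cyc N u w ^ Suc k)"
      using ps(3) by (simp add: monom_eval_def)
    then show ?thesis using invariant_functional.brackets_zero[OF J_functional J1 l] invariant_functional.brackets[OF J_functional l] by simp
  qed
  have sum: "(\<lambda>u w. (\<Sum>m\<in>K. lookup P m * monom_eval (\<lambda>(i, j). br i j u w) m) / cyc N u w ^ Suc k) \<in> dom \<and>
      J (\<lambda>u w. (\<Sum>m\<in>K. lookup P m * monom_eval (\<lambda>(i, j). br i j u w) m) / cyc N u w ^ Suc k) = 0"
    if "finite K" "K \<subseteq> keys P" for K
    using that
  proof (induction K rule: finite_induct)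
    case empty
    have "rep 0 0 (\<lambda>u w. 0)" by (simp add: rep_def)
    then show ?case using domI J_rep[of 0 0 "\<lambda>u w. 0"] by (simp add: val_def func_linear)
  next
    case (insert m K)
    then have m: "m \<in> keys P" and K: "K \<subseteq> keys P" by auto
    note s = invariant_functional.scale[OF J_functional mono[OF m, THEN conjunct1], of "lookup P m"]
    note ad = invariant_functional.add[OF J_functional s[THEN conjunct1] insert.IH[OF K, THEN conjunct1]]
    show ?case
      using ad s mono[OF m] insert.IH[OF K] insert(1,2)
      by (simp add: add_divide_distrib)
  qed
  from sum[OF finite_keys order_refl] show ?thesis
    by (simp add: pe_def poly_subst_alg_eval alg_eval_def)
qed

text \<open>Substituting the forms \<open>p\<close> for the variables makes the monomial
  \<open>m\<close> a form of degree \<open>k N\<close>, whose value under \<open>J\<close> is a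
  nonzero multiple of \<open>c m\<close>.\<close>

theorem unique: "c 0 = 0 \<Longrightarrow> c = 0"
proof (rule ext)
  fix m :: "'b \<Rightarrow>\<^sub>0 nat" assume c0: "c 0 = 0"
  define k where "k = mdeg m"
  let ?b = "Poly_Mapping.single m (1 :: complex)"
  define P where "P = poly_subst Const p ?b"
  have "P = (\<Prod>v\<in>keys m. p v ^ lookup m v)"
    by (simp add: P_def poly_subst_single monom_eval_def Const_def)
  also have "\<dots> \<in> forms N (\<Sum>v\<in>keys m. lookup m v * N)"
    by (intro forms_prod forms_power p_forms) auto
  finally have "P \<in> forms N (k * N)" by (simp add: k_def mdeg_def sum_distrib_right)
  from form_zero[OF c0 this] have "J (\<lambda>u w. pe u w P / cyc N u w ^ Suc k) = 0" by simp
  moreover have "rep k ?b (\<lambda>u w. pe u w P / cyc N u w ^ Suc k)"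
    unfolding rep_def
  proof (intro conjI allI impI)
    show "homog k ?b" by (rule homog_single) (simp add: k_def)
    show "pe u w P / cyc N u w ^ Suc k = poly_eval (\<lambda>i. q i u w) ?b / cyc N u w ^ Suc k" for u w
      by (simp add: P_def pe_def poly_eval_subst q_def)
  qed
  ultimately have "val k ?b = 0" using J_rep by simp
  then show "c m = 0 m" by (simp add: val_def func_linear)
qed

end

section \<open>Laurent polynomials\<close>

type_synonym 'x laurent = "('x \<Rightarrow>\<^sub>0 int) \<Rightarrow>\<^sub>0 complex"

definition LC :: "complex \<Rightarrow> 'x laurent" where
  "LC c = Poly_Mapping.single 0 c"

definition lm :: "('x \<Rightarrow>\<^sub>0 int) \<Rightarrow> 'x laurent" where
  "lm m = Poly_Mapping.single m 1"

definition CT :: "'x laurent \<Rightarrow> complex" where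
  "CT h = lookup h 0"

text \<open>The logarithmic derivative in the variable \<open>v\<close>. It multiplies each monomial
  by an exponent and so never produces a constant term; \<open>CT_theta\<close> is the source of all
  integrations by parts.\<close>

definition theta :: "'x \<Rightarrow> 'x laurent \<Rightarrow> 'x laurent" where
  "theta v h = (\<Sum>m\<in>keys h. Poly_Mapping.single m (of_int (lookup m v) * lookup h m))"

lemma coeff_hom_LC [simp]: "coeff_hom LC"
  by (simp add: coeff_hom_def LC_def single_add mult_single)

lemma LC_simps: "LC (x + y) = LC x + LC y" "LC (x * y) = LC x * LC y" "LC 0 = 0" "LC 1 = 1" "LC (- x) = - LC x"
  by (simp_all add: LC_def single_add mult_single single_uminus)

lemma lm_add: "lm (m + n) = lm m * lm n"
  by (simp add: lm_def mult_single)

lemma lm_zero [simp]: "lm 0 = 1"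
  by (simp add: lm_def)

lemma lookup_theta: "lookup (theta v h) m = of_int (lookup m v) * lookup h m"
  by (auto simp: theta_def lookup_sum lookup_single when_def in_keys_iff)

lemma theta_add: "theta v (g + h) = theta v g + theta v h"
  by (rule poly_mapping_eqI) (simp add: lookup_theta lookup_add distrib_left)

lemma theta_zero [simp]: "theta v 0 = 0"
  by (rule poly_mapping_eqI) (simp add: lookup_theta)

lemma theta_sum: "theta v (\<Sum>x\<in>A. g x) = (\<Sum>x\<in>A. theta v (g x))"
  by (induction A rule: infinite_finite_induct) (simp_all add: theta_add)

lemma theta_single: "theta v (Poly_Mapping.single m c) = Poly_Mapping.single m (of_int (lookup m v) * c)"
  by (rule poly_mapping_eqI) (simp add: lookup_theta lookup_single when_def)

lemma theta_lm: "theta v (lm m) = LC (of_int (lookup m v)) * lm m"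
  by (simp only: lm_def theta_single LC_def mult_single add_0)

lemma theta_LC [simp]: "theta v (LC c) = 0"
  by (simp add: LC_def theta_single)

lemma theta_mult: "theta v (g * h) = theta v g * h + g * theta v h"
proof -
  have s: "theta v (Poly_Mapping.single m c * Poly_Mapping.single n d) =
      theta v (Poly_Mapping.single m c) * Poly_Mapping.single n d +
      Poly_Mapping.single m c * theta v (Poly_Mapping.single n d)" for m n c d
    by (simp add: mult_single theta_single lookup_add single_add[symmetric] algebra_simps)
  define S where "S p m = Poly_Mapping.single m (lookup p m)" for p :: "'a laurent" and m
  have d: "p = (\<Sum>m\<in>keys p. S p m)" for p unfolding S_def by (rule poly_mapping_decompose)
  have "theta v (g * h) = theta v ((\<Sum>m\<in>keys g. S g m) * (\<Sum>n\<in>keys h. S h n))"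
    by (simp only: d[symmetric])
  also have "\<dots> = (\<Sum>m\<in>keys g. \<Sum>n\<in>keys h. theta v (S g m) * S h n + S g m * theta v (S h n))"
    unfolding sum_product theta_sum S_def s ..
  also have "\<dots> = theta v (\<Sum>m\<in>keys g. S g m) * (\<Sum>n\<in>keys h. S h n) +
      (\<Sum>m\<in>keys g. S g m) * theta v (\<Sum>n\<in>keys h. S h n)"
    unfolding sum_product theta_sum sum.distrib ..
  finally show ?thesis by (simp only: d[symmetric])
qed

lemma CT_add: "CT (g + h) = CT g + CT h"
  by (simp add: CT_def lookup_add)

lemma CT_zero [simp]: "CT 0 = 0"
  by (simp add: CT_def)

lemma CT_uminus: "CT (- h) = - CT h"
  by (simp add: CT_def)

lemma CT_diff: "CT (g - h) = CT g - CT h"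
  by (simp add: CT_def lookup_minus)

lemma CT_sum: "CT (\<Sum>x\<in>A. g x) = (\<Sum>x\<in>A. CT (g x))"
  by (simp add: CT_def lookup_sum)

lemma LC_mult_lookup: "lookup (LC c * h) m = c * lookup h m"
proof -
  define S where "S m = Poly_Mapping.single m (lookup h m)" for m
  have d: "h = (\<Sum>m\<in>keys h. S m)" unfolding S_def by (rule poly_mapping_decompose)
  have "LC c * h = LC c * (\<Sum>m\<in>keys h. S m)" by (simp only: d[symmetric])
  also have "\<dots> = (\<Sum>m\<in>keys h. Poly_Mapping.single m (c * lookup h m))"
    by (simp add: sum_distrib_left LC_def S_def mult_single)
  finally have "lookup (LC c * h) m = lookup (\<Sum>m\<in>keys h. Poly_Mapping.single m (c * lookup h m)) m" by simp
  also have "\<dots> = c * lookup h m"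
    by (auto simp: lookup_sum lookup_single when_def in_keys_iff)
  finally show ?thesis .
qed

lemma CT_scale: "CT (LC c * h) = c * CT h"
  by (simp add: CT_def LC_mult_lookup)

lemma CT_theta: "CT (theta v h) = 0"
  by (simp add: CT_def lookup_theta)

section \<open>Evaluation on the torus\<close>

definition character :: "('x \<Rightarrow> complex) \<Rightarrow> ('x \<Rightarrow>\<^sub>0 int) \<Rightarrow> complex" where
  "character y m = (\<Prod>v\<in>keys m. y v powi lookup m v)"

definition leval :: "('x \<Rightarrow> complex) \<Rightarrow> 'x laurent \<Rightarrow> complex" where
  "leval y h = alg_eval (\<lambda>c. c) (character y) h"

lemma character_superset:
  "finite A \<Longrightarrow> keys m \<subseteq> A \<Longrightarrow> character y m = (\<Prod>v\<in>A. y v powi lookup m v)"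
  unfolding character_def by (intro prod.mono_neutral_left) (auto simp: in_keys_iff)

lemma character_add:
  assumes "\<And>v. y v \<noteq> 0"
  shows "character y (m + n) = character y m * character y n"
proof -
  let ?A = "keys m \<union> keys n"
  have A: "finite ?A" "keys (m + n) \<subseteq> ?A" "keys m \<subseteq> ?A" "keys n \<subseteq> ?A"
    using Poly_Mapping.keys_add[of m n] by auto
  show ?thesis
    unfolding character_superset[OF A(1,2)] character_superset[OF A(1,3)] character_superset[OF A(1,4)]
    using assms by (simp add: lookup_add power_int_add prod.distrib)
qed

lemma character_mult: "character (\<lambda>v. y v * z v) m = character y m * character z m"
  by (simp add: character_def power_int_mult_distrib prod.distrib)

text \<open>Dedekind's argument: translating by a point at which two characters differ and
  subtracting removes one of them. A single coordinate 2 suffices, as different powers of 2 have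
  different norms.\<close>

lemma characters_independent:
  assumes "finite K" "\<And>y. (\<And>v. y v \<noteq> 0) \<Longrightarrow> (\<Sum>m\<in>K. c m * character y m) = 0" "m \<in> K"
  shows "c m = 0"
  using assms
proof (induction K arbitrary: c m rule: finite_induct)
  case empty
  then show ?case by simp
next
  case (insert m0 K)
  have K0: "c n = 0" if n: "n \<in> K" for n
  proof -
    have "n \<noteq> m0" using insert n by auto
    then obtain v where v: "lookup n v \<noteq> lookup m0 v" by (metis poly_mapping_eqI)
    define z where "z x = (if x = v then 2 else 1 :: complex)" for x
    have z: "z x \<noteq> 0" for x by (simp add: z_def)
    have cz: "character z m = 2 powi lookup m v" for m
    proof -
      have "character z m = (\<Prod>x\<in>insert v (keys m). z x powi lookup m x)" by (rule character_superset) auto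
      also have "\<dots> = (\<Prod>x\<in>{v}. z x powi lookup m x)"
        by (rule prod.mono_neutral_right) (auto simp: z_def)
      finally show ?thesis by (simp add: z_def)
    qed
    have "c n * (character z n - character z m0) = 0"
    proof (rule insert.IH[OF _ n])
      fix y :: "'a \<Rightarrow> complex" assume y: "\<And>v. y v \<noteq> 0"
      have 1: "c m0 * character y m0 + (\<Sum>m\<in>K. c m * character y m) = 0"
        using insert.prems(1)[OF y] insert.hyps by simp
      have "(\<Sum>m\<in>insert m0 K. c m * character (\<lambda>v. y v * z v) m) = 0"
        by (rule insert.prems(1)) (use y z in auto)
      then have 2: "c m0 * (character y m0 * character z m0) + (\<Sum>m\<in>K. c m * (character y m * character z m)) = 0"
        using insert.hyps by (simp add: character_mult)
      have "(\<Sum>m\<in>K. c m * (character z m - character z m0) * character y m) =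
          (\<Sum>m\<in>K. c m * (character y m * character z m)) - (\<Sum>m\<in>K. c m * character y m) * character z m0"
        unfolding sum_distrib_right sum_subtractf[symmetric] by (intro sum.cong refl) (simp add: algebra_simps)
      also have "\<dots> = (c m0 * (character y m0 * character z m0) + (\<Sum>m\<in>K. c m * (character y m * character z m))) -
          (c m0 * character y m0 + (\<Sum>m\<in>K. c m * character y m)) * character z m0"
        by (simp only: distrib_right) simp
      finally show "(\<Sum>m\<in>K. c m * (character z m - character z m0) * character y m) = 0"
        by (simp only: 1 2) simp
    qed
    moreover have "character z n \<noteq> character z m0"
    proof
      assume "character z n = character z m0"
      then have "norm (2 powi lookup n v :: complex) = norm (2 powi lookup m0 v :: complex)" by (simp add: cz)
      then have "(2::real) powi lookup n v = 2 powi lookup m0 v" by (simp add: norm_power_int)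
      then show False using v power_int_strict_increasing[of "lookup n v" "lookup m0 v" "2::real"]
          power_int_strict_increasing[of "lookup m0 v" "lookup n v" "2::real"] by linarith
    qed
    ultimately show ?thesis by simp
  qed
  have "(\<Sum>m\<in>K. c m * character (\<lambda>_. 1) m) = 0" using K0 by (intro sum.neutral) auto
  then have "c m0 = 0" using insert.prems(1)[of "\<lambda>_. 1"] insert.hyps by (simp add: character_def)
  then show ?case using K0 insert.prems(2) by auto
qed

lemma leval_eq_zero:
  assumes "\<And>y. (\<And>v. y v \<noteq> 0) \<Longrightarrow> leval y h = 0"
  shows "h = 0"
proof (rule poly_mapping_eqI)
  fix m
  have "lookup h m = 0" if "m \<in> keys h"
    using characters_independent[OF finite_keys[of h], of "lookup h" m] assms that
    by (simp add: leval_def alg_eval_def)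
  then show "lookup h m = lookup 0 m" by (auto simp: in_keys_iff)
qed

text \<open>This carries identities between functions of \<open>u\<close> and \<open>w\<close> over
  to the Laurent ring, where constant terms are taken.\<close>

lemma leval_eqI:
  assumes "\<And>y. (\<And>v. y v \<noteq> 0) \<Longrightarrow> leval y g = leval y h"
  shows "g = h"
proof -
  have "leval y (g + - h) = 0" if y: "\<And>v. y v \<noteq> 0" for y
  proof -
    have "leval y (- h) + leval y h = 0"
      unfolding leval_def by (subst alg_eval_add[symmetric]) simp_all
    then show ?thesis using assms[OF y] unfolding leval_def alg_eval_add[OF coeff_hom_id]
      by (simp add: eq_neg_iff_add_eq_0 add.commute)
  qed
  then have "g + - h = 0" by (rule leval_eq_zero)
  then show ?thesis by simp
qed

context
  fixes y :: "'x \<Rightarrow> complex"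
  assumes y: "\<And>v. y v \<noteq> 0"
begin

lemma leval_add: "leval y (g + h) = leval y g + leval y h"
  by (simp add: leval_def alg_eval_add)

lemma leval_mult: "leval y (g * h) = leval y g * leval y h"
  unfolding leval_def by (rule alg_eval_mult[OF coeff_hom_id]) (rule character_add[OF y])

lemma leval_LC: "leval y (LC c) = c"
  by (simp add: leval_def LC_def alg_eval_single character_def)

lemma leval_sum: "leval y (\<Sum>x\<in>A. g x) = (\<Sum>x\<in>A. leval y (g x))"
  by (simp add: leval_def alg_eval_sum)

lemma leval_diff: "leval y (g - h) = leval y g - leval y h"
  using leval_add[of "g - h" h] by simp

lemma leval_poly_subst: "leval y (poly_subst LC s P) = poly_eval (\<lambda>v. leval y (s v)) P"
  by (induction P rule: mpoly_induct) (simp_all add: poly_subst_hom leval_add leval_mult leval_LC)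

end

section \<open>Derivations of the Laurent ring\<close>

definition derivation :: "('x laurent \<Rightarrow> 'x laurent) \<Rightarrow> bool" where
  "derivation D \<longleftrightarrow> (\<forall>g h. D (g + h) = D g + D h) \<and> (\<forall>g h. D (g * h) = D g * h + g * D h) \<and> (\<forall>c. D (LC c) = 0)"

lemma derivation_theta: "derivation (theta v)"
  by (simp add: derivation_def theta_add theta_mult)

lemma derivation_mult: "derivation D \<Longrightarrow> derivation (\<lambda>h. x * D h)"
  by (simp add: derivation_def algebra_simps)

lemma derivation_add: "derivation D \<Longrightarrow> derivation E \<Longrightarrow> derivation (\<lambda>h. D h + E h)"
  by (simp add: derivation_def algebra_simps)

lemma derivation_zero: "derivation (\<lambda>h. 0)"
  by (simp add: derivation_def)

lemma derivation_sum: "(\<And>x. x \<in> A \<Longrightarrow> derivation (D x)) \<Longrightarrow> derivation (\<lambda>h. \<Sum>x\<in>A. D x h)"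
  by (induction A rule: infinite_finite_induct) (auto intro: derivation_add derivation_zero)

lemma derivation_simps:
  assumes "derivation D"
  shows "D (g + h) = D g + D h" "D (g * h) = D g * h + g * D h" "D (LC c) = 0" "D 0 = 0" "D 1 = 0"
    "D (- g) = - D g" "D (g - h) = D g - D h" "D (\<Sum>x\<in>A. k x) = (\<Sum>x\<in>A. D (k x))"
proof -
  have a: "D (g + h) = D g + D h" for g h using assms by (simp add: derivation_def)
  show "D (g + h) = D g + D h" by (rule a)
  show "D (g * h) = D g * h + g * D h" "D (LC c) = 0" using assms by (simp_all add: derivation_def)
  show z: "D 0 = 0" using a[of 0 0] by simp
  have "D (LC 1) = 0" using assms by (simp add: derivation_def)
  then show "D 1 = 0" by (simp add: LC_simps)
  show n: "D (- g) = - D g" for g using a[of g "- g"] z by (simp add: eq_neg_iff_add_eq_0 add.commute)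
  show "D (g - h) = D g - D h" using a[of g "- h"] n[of h] by simp
  show "D (\<Sum>x\<in>A. k x) = (\<Sum>x\<in>A. D (k x))" by (induction A rule: infinite_finite_induct) (simp_all add: z a)
qed

section \<open>A torus in the complement\<close>

text \<open>The planes spanned by the rows of the matrix with columns \<open>(1, 0)\<close> and \<open>(z\<^sub>k w\<^sub>k, w\<^sub>k)\<close>,
  \<open>1 \<le> k < N\<close>, where \<open>z\<^sub>1 = 0\<close> and \<open>z\<^sub>r - z\<^sub>r\<^sub>+\<^sub>1 = d\<^sub>r\<close>. In the torus coordinates \<open>w\<^sub>k\<close>
  (\<open>Inl k\<close>) and \<open>d\<^sub>r\<close> (\<open>Inr r\<close>) the cyclic section is minus the monomial \<open>Phi\<close>, which is also
  the density of the \<open>SL\<^sub>N\<close>-invariant volume with respect to the logarithmic one.\<close>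

type_synonym tring = "(nat + nat) laurent"

definition wv :: "nat \<Rightarrow> tring" where "wv k = lm (Poly_Mapping.single (Inl k) 1)"
definition wi :: "nat \<Rightarrow> tring" where "wi k = lm (Poly_Mapping.single (Inl k) (-1))"
definition dv :: "nat \<Rightarrow> tring" where "dv r = lm (Poly_Mapping.single (Inr r) 1)"
definition di :: "nat \<Rightarrow> tring" where "di r = lm (Poly_Mapping.single (Inr r) (-1))"

definition zz :: "nat \<Rightarrow> tring" where "zz k = - (\<Sum>r\<in>{1..<k}. dv r)"

definition tU :: "nat \<Rightarrow> nat \<Rightarrow> tring" where
  "tU N k = (if k = 0 then 1 else if k < N then zz k * wv k else 0)"

definition tW :: "nat \<Rightarrow> nat \<Rightarrow> tring" where
  "tW N k = (if k = 0 then 0 else if k < N then wv k else 0)"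

definition tB :: "nat \<Rightarrow> nat \<Rightarrow> nat \<Rightarrow> tring" where
  "tB N i j = tU N i * tW N j - tU N j * tW N i"

definition phi :: "nat \<Rightarrow> (nat + nat) \<Rightarrow>\<^sub>0 int" where
  "phi N = (\<Sum>k\<in>{1..<N}. Poly_Mapping.single (Inl k) 2) + (\<Sum>r\<in>{1..<N-1}. Poly_Mapping.single (Inr r) 1)"

definition Phi :: "nat \<Rightarrow> tring" where "Phi N = lm (phi N)"

lemma lookup_phi:
  "lookup (phi N) (Inl k) = (if 1 \<le> k \<and> k < N then 2 else 0)"
  "lookup (phi N) (Inr r) = (if 1 \<le> r \<and> r + 1 < N then 1 else 0)"
proof -
  have "lookup (phi N) (Inl k) = (\<Sum>i\<in>{1..<N}. if i = k then 2 else 0)"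
    unfolding phi_def lookup_add lookup_sum by (simp add: lookup_single when_def)
  then show "lookup (phi N) (Inl k) = (if 1 \<le> k \<and> k < N then 2 else 0)" by auto
  have "lookup (phi N) (Inr r) = (\<Sum>i\<in>{1..<N-1}. if i = r then 1 else 0)"
    unfolding phi_def lookup_add lookup_sum by (simp add: lookup_single when_def)
  then show "lookup (phi N) (Inr r) = (if 1 \<le> r \<and> r + 1 < N then 1 else 0)" by auto
qed

lemma units: "wv k * wi k = 1" "wi k * wv k = 1" "dv r * di r = 1" "di r * dv r = 1"
  unfolding wv_def wi_def dv_def di_def by (simp_all flip: lm_add single_add)

lemma theta_vars:
  "theta (Inl j) (wv k) = (if j = k then wv k else 0)" "theta (Inl j) (wi k) = (if j = k then - wi k else 0)"
  "theta (Inl j) (dv r) = 0" "theta (Inl j) (di r) = 0"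
  "theta (Inr s) (wv k) = 0" "theta (Inr s) (wi k) = 0"
  "theta (Inr s) (dv r) = (if s = r then dv r else 0)" "theta (Inr s) (di r) = (if s = r then - di r else 0)"
  by (simp_all add: wv_def wi_def dv_def di_def theta_lm lookup_single when_def LC_simps)

lemmas theta_simps = derivation_simps[OF derivation_theta]

lemma theta_zz:
  "theta (Inl j) (zz k) = 0"
  "theta (Inr s) (zz k) = (if 1 \<le> s \<and> s < k then - dv s else 0)"
proof -
  show "theta (Inl j) (zz k) = 0" by (simp add: zz_def theta_simps theta_vars)
  have "theta (Inr s) (zz k) = - (\<Sum>r\<in>{1..<k}. if r = s then dv s else 0)"
    unfolding zz_def theta_simps theta_vars by (intro arg_cong[where f=uminus] sum.cong) auto
  then show "theta (Inr s) (zz k) = (if 1 \<le> s \<and> s < k then - dv s else 0)" by simp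
qed

section \<open>The vector fields of \<open>gl_N\<close> on the torus chart\<close>

lemma Phi_parts:
  "CT (Phi N * (A * theta v h)) = - CT (Phi N * ((LC (of_int (lookup (phi N) v)) * A + theta v A) * h))"
proof -
  have "theta v (Phi N * A * h) = Phi N * (A * theta v h) + Phi N * ((LC (of_int (lookup (phi N) v)) * A + theta v A) * h)"
    unfolding Phi_def theta_mult theta_lm by (simp add: algebra_simps)
  then have "CT (Phi N * (A * theta v h)) + CT (Phi N * ((LC (of_int (lookup (phi N) v)) * A + theta v A) * h)) = 0"
    using CT_theta[of v "Phi N * A * h"] by (simp only: CT_add)
  then show ?thesis by (simp only: eq_neg_iff_add_eq_0)
qed

text \<open>\<open>D\<close> realises the vector field that adds column \<open>i\<close> to column
  \<open>j\<close>, up to the row operation in \<open>sl_2\<close> with entries \<open>a\<close>,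
  \<open>b\<close>, \<open>c\<close>, \<open>-a\<close>. The row operation restores the normalised
  shape of the matrix and is invisible to brackets. In the last clause, 2 is the degree of the
  cyclic section in each column; for traceless combinations these terms cancel.\<close>

definition good :: "nat \<Rightarrow> nat \<Rightarrow> nat \<Rightarrow> (tring \<Rightarrow> tring) \<Rightarrow> bool" where
  "good N i j D \<longleftrightarrow> derivation D \<and>
    (\<exists>a b c. \<forall>k. D (tU N k) = (if k = j then tU N i else 0) + a * tU N k + b * tW N k \<and>
      D (tW N k) = (if k = j then tW N i else 0) + c * tU N k - a * tW N k) \<and>
    (\<forall>h. CT (Phi N * D h) = (if i = j then - 2 * CT (Phi N * h) else 0))"

lemma goodI:
  assumes "derivation D" "\<And>k. D (tU N k) = (if k = j then tU N i else 0) + a * tU N k + b * tW N k"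
    and "\<And>k. D (tW N k) = (if k = j then tW N i else 0) + c * tU N k - a * tW N k"
    and "\<And>h. CT (Phi N * D h) = (if i = j then - 2 * CT (Phi N * h) else 0)"
  shows "good N i j D"
  unfolding good_def by (intro conjI assms(1) exI[of _ a] exI[of _ b] exI[of _ c] allI assms(2-4))

lemma good_derivation: "good N i j D \<Longrightarrow> derivation D"
  by (simp add: good_def)

lemma good_CT: "good N i j D \<Longrightarrow> CT (Phi N * D h) = (if i = j then - 2 * CT (Phi N * h) else 0)"
  unfolding good_def by blast

lemma good_bracket:
  assumes "good N i j D"
  shows "D (tB N k l) = (if k = j then tB N i l else 0) + (if l = j then tB N k i else 0)"
proof -
  obtain a b c where v: "\<And>k. D (tU N k) = (if k = j then tU N i else 0) + a * tU N k + b * tW N k"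
    "\<And>k. D (tW N k) = (if k = j then tW N i else 0) + c * tU N k - a * tW N k"
    using assms unfolding good_def by blast
  show ?thesis
    unfolding tB_def derivation_simps[OF good_derivation[OF assms]] v
    by (simp add: algebra_simps)
qed

text \<open>Only column \<open>j\<close> moves, and \<open>\<zeta>\<close> is the resulting velocity
  of \<open>z_j\<close>; it enters \<open>d_j\<close> with sign plus and \<open>d_(j-1)\<close> with
  sign minus. For \<open>j = 1\<close> the normalisation \<open>z_1 = 0\<close> is restored by the
  row operation that shifts every \<open>z_k\<close> by \<open>- \<zeta>\<close>.\<close>

lemma good_off_diagonal:
  assumes "1 \<le> j" "j < N" "i < N" "i \<noteq> j"
  shows "\<exists>D. good N i j D"
proof -
  define \<zeta> where "\<zeta> = (tU N i - zz j * tW N i) * wi j"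
  define A1 where "A1 = tW N i * wi j"
  define A2 where "A2 = (if j + 1 < N then \<zeta> * di j else 0)"
  define A3 where "A3 = (if 2 \<le> j then - (\<zeta> * di (j - 1)) else 0)"
  define D where "D h = A1 * theta (Inl j) h + (A2 * theta (Inr j) h + A3 * theta (Inr (j - 1)) h)" for h
  have der: "derivation D" unfolding D_def
    by (intro derivation_add derivation_mult derivation_theta)
  have Dw: "D (wv k) = (if k = j then tW N i else 0)" for k
    using units(2)[of j] by (simp add: D_def theta_vars A1_def mult.assoc)
  have Dd: "D (dv r) = (if r = j then if j + 1 < N then \<zeta> else 0 else 0) + (if r = j - 1 then if 2 \<le> j then - \<zeta> else 0 else 0)" for r
    using units(4)[of j] units(4)[of "j - 1"] assms(1)
    by (auto simp: D_def theta_vars A2_def A3_def mult.assoc)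
  have Dz: "D (zz k) = (if k = j then \<zeta> else 0) + (if j = 1 then - \<zeta> else 0)" if k: "1 \<le> k" "k < N" for k
  proof -
    have "D (zz k) = - ((\<Sum>r\<in>{1..<k}. if r = j then if j + 1 < N then \<zeta> else 0 else 0) +
        (\<Sum>r\<in>{1..<k}. if r = j - 1 then if 2 \<le> j then - \<zeta> else 0 else 0))"
      unfolding zz_def derivation_simps[OF der] Dd sum.distrib ..
    also have "(\<Sum>r\<in>{1..<k}. if r = j then if j + 1 < N then \<zeta> else 0 else 0) = (if j < k then \<zeta> else 0)"
      using assms k by simp
    also have "(\<Sum>r\<in>{1..<k}. if r = j - 1 then if 2 \<le> j then - \<zeta> else 0 else 0) = (if 2 \<le> j \<and> j \<le> k then - \<zeta> else 0)"
      using assms k by auto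
    finally show ?thesis using assms(1) k by auto
  qed
  have \<zeta>w: "\<zeta> * wv j = tU N i - zz j * tW N i"
    using units(2)[of j] by (simp add: \<zeta>_def mult.assoc)
  have U: "D (tU N k) = (if k = j then tU N i else 0) + 0 * tU N k + (if j = 1 then - \<zeta> else 0) * tW N k" for k
  proof -
    consider "k = 0" | "N \<le> k" | "1 \<le> k" "k < N" by linarith
    then show ?thesis
    proof cases
      case 3
      then have "D (tU N k) = ((if k = j then \<zeta> else 0) + (if j = 1 then - \<zeta> else 0)) * wv k + zz k * (if k = j then tW N i else 0)"
        by (simp add: tU_def derivation_simps[OF der] Dz Dw)
      then show ?thesis using 3 \<zeta>w by (auto simp: tW_def algebra_simps)
    qed (use assms in \<open>auto simp: tU_def tW_def derivation_simps[OF der]\<close>)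
  qed
  have W: "D (tW N k) = (if k = j then tW N i else 0) + 0 * tU N k - 0 * tW N k" for k
    using assms by (auto simp: tW_def derivation_simps[OF der] Dw)
  \<comment> \<open>\<open>\<zeta>\<close> depends on \<open>d_r\<close> only through
    \<open>z_i\<close> and \<open>z_j\<close>, and \<open>z_k\<close> contains \<open>- d_r\<close>
    exactly for \<open>r < k\<close>.\<close>
  have t\<zeta>: "theta (Inr r) \<zeta> * di r = ((if r < j then 1 else 0) - (if r < i then 1 else 0)) * A1" if r: "1 \<le> r" for r
  proof (cases "i = 0")
    case True
    then show ?thesis using r by (simp add: \<zeta>_def A1_def tU_def tW_def theta_simps theta_vars theta_zz)
  next
    case False
    then have "theta (Inr r) \<zeta> = ((if r < i then - dv r else 0) * wv i - (if r < j then - dv r else 0) * wv i) * wi j"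
      using r assms(3) by (simp add: \<zeta>_def tU_def tW_def theta_simps theta_vars theta_zz)
    also have "\<dots> = dv r * (((if r < j then 1 else 0) - (if r < i then 1 else 0)) * A1)"
      using False assms(3) by (auto simp: A1_def tW_def algebra_simps)
    finally show ?thesis using units(3)[of r] by (simp add: mult_ac)
  qed
  have D1: "LC (of_int (lookup (phi N) (Inl j))) * A1 + theta (Inl j) A1 = A1"
  proof -
    have L: "LC 2 = 1 + 1" by (metis LC_simps(1,4) one_add_one)
    have T: "theta (Inl j) A1 = - A1"
      using assms by (simp add: A1_def theta_simps theta_vars tW_def)
    have l: "lookup (phi N) (Inl j) = 2" using assms by (simp add: lookup_phi)
    show ?thesis unfolding l T of_int_numeral L distrib_right mult_1_left
      by (simp only: add.assoc add.right_inverse add_0_right)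
  qed
  have D2: "LC (of_int (lookup (phi N) (Inr j))) * A2 + theta (Inr j) A2 = (if j + 1 < N then theta (Inr j) \<zeta> * di j else 0)"
  proof -
    have "theta (Inr j) (\<zeta> * di j) = theta (Inr j) \<zeta> * di j - \<zeta> * di j"
      unfolding theta_mult theta_vars by simp
    then show ?thesis using assms(1) by (simp add: A2_def lookup_phi LC_simps(4))
  qed
  have D3: "LC (of_int (lookup (phi N) (Inr (j - 1)))) * A3 + theta (Inr (j - 1)) A3 =
      (if 2 \<le> j then - (theta (Inr (j - 1)) \<zeta> * di (j - 1)) else 0)"
  proof -
    have "theta (Inr (j - 1)) (- (\<zeta> * di (j - 1))) = - (theta (Inr (j - 1)) \<zeta> * di (j - 1) - \<zeta> * di (j - 1))"
      unfolding theta_simps(6) theta_mult theta_vars by simp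
    moreover have "lookup (phi N) (Inr (j - 1)) = 1" if "2 \<le> j"
      using that assms(2) by (auto simp: lookup_phi)
    ultimately show ?thesis by (cases "2 \<le> j") (simp_all add: A3_def LC_simps(4))
  qed
  \<comment> \<open>For \<open>i \<noteq> j\<close> the conditions \<open>j - 1 < i\<close> and
    \<open>j < i\<close> are equivalent, which makes the three terms cancel; for
    \<open>i = 0\<close> already \<open>A1 = 0\<close>.\<close>
  have div: "A1 + ((if j + 1 < N then theta (Inr j) \<zeta> * di j else 0) + (if 2 \<le> j then - (theta (Inr (j - 1)) \<zeta> * di (j - 1)) else 0)) = 0"
  proof (cases "i = 0")
    case True
    then show ?thesis using t\<zeta>[of j] t\<zeta>[of "j - 1"] assms by (simp add: A1_def tW_def)
  next
    case False
    consider "j < i" | "i < j" using assms(4) by linarith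
    then show ?thesis
    proof cases
      case 1
      then show ?thesis using t\<zeta>[of j] t\<zeta>[of "j - 1"] assms by auto
    next
      case 2
      then show ?thesis using t\<zeta>[of j] t\<zeta>[of "j - 1"] assms False by auto
    qed
  qed
  have CT: "CT (Phi N * D h) = (if i = j then - 2 * CT (Phi N * h) else 0)" for h
  proof -
    have "CT (Phi N * D h) = CT (Phi N * (A1 * theta (Inl j) h)) + (CT (Phi N * (A2 * theta (Inr j) h)) + CT (Phi N * (A3 * theta (Inr (j - 1)) h)))"
      by (simp only: D_def distrib_left CT_add)
    also have "\<dots> = - CT (Phi N * ((A1 + ((if j + 1 < N then theta (Inr j) \<zeta> * di j else 0) +
        (if 2 \<le> j then - (theta (Inr (j - 1)) \<zeta> * di (j - 1)) else 0))) * h))"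
      unfolding Phi_parts D1 D2 D3 by (simp only: distrib_left distrib_right CT_add minus_add_distrib)
    also have "\<dots> = 0" unfolding div by simp
    finally show ?thesis using assms(4) by simp
  qed
  have "good N i j D" by (rule goodI[OF der U W CT])
  then show ?thesis by blast
qed

lemma good_diagonal:
  assumes "1 \<le> j" "j < N"
  shows "good N j j (theta (Inl j))"
proof -
  have U: "theta (Inl j) (tU N k) = (if k = j then tU N j else 0) + 0 * tU N k + 0 * tW N k" for k
    using assms by (auto simp: tU_def theta_simps theta_zz theta_vars)
  have W: "theta (Inl j) (tW N k) = (if k = j then tW N j else 0) + 0 * tU N k - 0 * tW N k" for k
    using assms by (auto simp: tW_def theta_simps theta_vars)
  have CT: "CT (Phi N * theta (Inl j) h) = (if j = j then - 2 * CT (Phi N * h) else 0)" for h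
  proof -
    have "CT (Phi N * theta (Inl j) h) = - CT (LC 2 * (Phi N * h))"
      using Phi_parts[of N 1 "Inl j" h] assms by (simp add: lookup_phi theta_simps mult_ac)
    then show ?thesis by (simp only: CT_scale) simp
  qed
  show ?thesis by (rule goodI[OF derivation_theta U W CT])
qed

text \<open>Column 0 is fixed at \<open>(1, 0)\<close>, so its scaling is undone by the row
  operation with diagonal \<open>-1, 1\<close>, under which \<open>w_k\<close> has weight 1 and
  \<open>z_k\<close> weight \<open>-2\<close>. The constant terms then count
  \<open>-2 (N - 1) + 2 (N - 2) = -2\<close>.\<close>

lemma good_corner_diagonal:
  assumes "N \<ge> 2"
  shows "\<exists>D. good N 0 0 D"
proof -
  define D where "D h = (\<Sum>k\<in>{1..<N}. theta (Inl k) h) + (\<Sum>r\<in>{1..<N-1}. LC (-2) * theta (Inr r) h)" for h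
  have der: "derivation D" unfolding D_def
    by (intro derivation_add derivation_mult derivation_sum derivation_theta)
  have Dw: "D (wv k) = wv k" if "1 \<le> k" "k < N" for k
    using that by (simp add: D_def theta_vars)
  have Dd: "D (dv r) = LC (-2) * dv r" if "1 \<le> r" "r < N - 1" for r
  proof -
    have "D (dv r) = (\<Sum>s\<in>{1..<N-1}. if s = r then LC (-2) * dv r else 0)"
      unfolding D_def theta_vars sum.neutral_const add_0 by (intro sum.cong) auto
    then show ?thesis using that by simp
  qed
  have m2: "LC (-2) = - 2" by (metis LC_simps(1,4,5) one_add_one)
  have Dz: "D (zz k) = LC (-2) * zz k" if "k < N" for k
    unfolding zz_def derivation_simps[OF der] mult_minus_right sum_distrib_left using that Dd
    by (intro arg_cong[where f=uminus] sum.cong) auto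
  have U: "D (tU N k) = (if k = 0 then tU N 0 else 0) + (- 1) * tU N k + 0 * tW N k" for k
    by (auto simp: tU_def derivation_simps[OF der] Dz Dw m2 algebra_simps)
  have W: "D (tW N k) = (if k = 0 then tW N 0 else 0) + 0 * tU N k - (- 1) * tW N k" for k
    by (auto simp: tW_def derivation_simps[OF der] Dw)
  have CT: "CT (Phi N * D h) = (if 0 = 0 then - 2 * CT (Phi N * h) else 0)" for h
  proof -
    have l: "CT (Phi N * theta (Inl k) h) = - 2 * CT (Phi N * h)" if "k \<in> {1..<N}" for k
      using good_CT[OF good_diagonal[of k N]] that by simp
    have r: "CT (Phi N * (LC (-2) * theta (Inr r) h)) = 2 * CT (Phi N * h)" if "r \<in> {1..<N-1}" for r
    proof -
      have "CT (Phi N * (LC (-2) * theta (Inr r) h)) = - CT (LC (-2) * (Phi N * h))"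
      proof -
        have "lookup (phi N) (Inr r) = 1" using that by (auto simp: lookup_phi)
        then show ?thesis
          using Phi_parts[of N "LC (-2)" "Inr r" h] by (simp add: theta_simps LC_simps(4) mult_ac)
      qed
      then show ?thesis by (simp only: CT_scale) simp
    qed
    have "CT (Phi N * D h) = (\<Sum>k\<in>{1..<N}. CT (Phi N * theta (Inl k) h)) +
        (\<Sum>r\<in>{1..<N-1}. CT (Phi N * (LC (-2) * theta (Inr r) h)))"
      by (simp only: D_def distrib_left CT_add CT_sum sum_distrib_left)
    also have "\<dots> = (\<Sum>k\<in>{1..<N}. - 2 * CT (Phi N * h)) + (\<Sum>r\<in>{1..<N-1}. 2 * CT (Phi N * h))"
      by (intro arg_cong2[where f="(+)"] sum.cong refl l r)
    also have "\<dots> = - 2 * CT (Phi N * h)"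
      using assms by (simp add: of_nat_diff algebra_simps)
    finally show ?thesis by simp
  qed
  have "good N 0 0 D" by (rule goodI[OF der U W CT])
  then show ?thesis by blast
qed

text \<open>On brackets \<open>\<Sum>\<^sub>k [i k] E\<^sub>i\<^sub>k = 0\<close>, where \<open>E\<^sub>i\<^sub>k\<close> replaces the \<open>k\<close>-th vector by the \<open>i\<close>-th
  one; this expresses \<open>E\<^sub>i\<^sub>0\<close> by the other \<open>E\<^sub>i\<^sub>k\<close>.\<close>

lemma good_corner:
  assumes "1 \<le> i" "i < N"
  shows "\<exists>D. good N i 0 D"
proof -
  define S where "S = {1..<N} - {i}"
  have "\<forall>k\<in>S. \<exists>D. good N i k D" using good_off_diagonal assms by (auto simp: S_def)
  then obtain E where E: "\<And>k. k \<in> S \<Longrightarrow> good N i k (E k)" by metis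
  define x where "x k = tB N i k * wi i" for k
  define D where "D h = (\<Sum>k\<in>S. x k * E k h)" for h
  have der: "derivation D" unfolding D_def
    by (intro derivation_sum derivation_mult good_derivation[OF E])
  \<comment> \<open>On brackets \<open>E k\<close> acts on the index \<open>k\<close> only: it turns
    \<open>[i, k]\<close> into \<open>[i, i] = 0\<close> and leaves \<open>w_i = - [i, 0]\<close>
    alone. The coefficient \<open>x k\<close> may therefore be moved inside \<open>E k\<close>, and
    no divergence arises.\<close>
  have Ex: "E k (x k) = 0" if k: "k \<in> S" for k
  proof -
    note dk = derivation_simps[OF good_derivation[OF E[OF k]]]
    have ki: "k \<noteq> i" "k \<noteq> 0" using k by (auto simp: S_def)
    have b: "E k (tB N i k) = 0" using good_bracket[OF E[OF k], of i k] ki by (simp add: tB_def)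
    have "tB N i 0 = - wv i" using assms by (simp add: tB_def tU_def tW_def)
    then have "E k (wv i) = 0" using good_bracket[OF E[OF k], of i 0] ki dk(6)[of "wv i"] by simp
    then have "wv i * E k (wi i) = 0" using dk(2)[of "wv i" "wi i"] dk(5) by (simp add: units)
    then have "wi i * (wv i * E k (wi i)) = 0" by simp
    then have "E k (wi i) = 0" by (simp add: units mult.assoc[symmetric])
    then show ?thesis using b by (simp add: x_def dk(2))
  qed
  have CT0: "CT (Phi N * D h) = (if i = 0 then - 2 * CT (Phi N * h) else 0)" for h
  proof -
    have "CT (Phi N * (x k * E k h)) = 0" if k: "k \<in> S" for k
    proof -
      have "x k * E k h = E k (x k * h)"
        by (simp add: derivation_simps[OF good_derivation[OF E[OF k]]] Ex[OF k])
      moreover have "i \<noteq> k" using k by (auto simp: S_def)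
      ultimately show ?thesis using good_CT[OF E[OF k], of "x k * h"] by simp
    qed
    then show ?thesis using assms(1) by (simp add: D_def sum_distrib_left CT_sum)
  qed
  have "\<forall>k\<in>S. \<exists>a b c. \<forall>m. E k (tU N m) = (if m = k then tU N i else 0) + a * tU N m + b * tW N m \<and>
      E k (tW N m) = (if m = k then tW N i else 0) + c * tU N m - a * tW N m"
    using E unfolding good_def by blast
  then obtain a b c where abc:
    "\<And>k m. k \<in> S \<Longrightarrow> E k (tU N m) = (if m = k then tU N i else 0) + a k * tU N m + b k * tW N m"
    "\<And>k m. k \<in> S \<Longrightarrow> E k (tW N m) = (if m = k then tW N i else 0) + c k * tU N m - a k * tW N m"
    by metis
  \<comment> \<open>At \<open>m = 0\<close>, an index missing from \<open>S\<close>, one has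
    \<open>x 0 = -1\<close>; the correction is exactly the term at column 0 that the field has to
    produce.\<close>
  have xs: "(if m \<in> S then x m else 0) = (if m = 0 then 1 else 0) + x m" for m
  proof -
    consider "m = 0" | "m = i" | "N \<le> m" | "m \<in> S" "m \<noteq> 0" using assms by (fastforce simp: S_def)
    then show ?thesis
    proof cases
      case 1
      then show ?thesis using assms by (simp add: x_def S_def tB_def tU_def tW_def units)
    next
      case 2
      then show ?thesis using assms by (simp add: x_def S_def tB_def)
    next
      case 3
      then have "x m = 0" using assms by (simp add: x_def tB_def tU_def tW_def)
      then show ?thesis using 3 assms by (simp add: S_def)
    qed auto
  qed
  have fS: "finite S" by (simp add: S_def)
  have pick: "(\<Sum>k\<in>S. x k * (if m = k then t else 0)) = (if m = 0 then t else 0) + x m * t" for m t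
  proof -
    have "(\<Sum>k\<in>S. x k * (if m = k then t else 0)) = (\<Sum>k\<in>S. if k = m then x m * t else 0)"
      by (intro sum.cong) auto
    also have "\<dots> = (if m \<in> S then x m else 0) * t" using fS by simp
    also have "\<dots> = ((if m = 0 then 1 else 0) + x m) * t" by (simp only: xs)
    finally show ?thesis by (simp add: distrib_right)
  qed
  \<comment> \<open>The surplus \<open>x m\<close> times column \<open>i\<close> is linear in column
    \<open>m\<close>, hence a row operation. Its diagonal entries are opposite, so it lies in
    \<open>sl_2\<close> as \<open>good\<close> requires.\<close>
  define a' where "a' = (\<Sum>k\<in>S. x k * a k) - wi i * tU N i * tW N i"
  define b' where "b' = (\<Sum>k\<in>S. x k * b k) + wi i * tU N i * tU N i"
  define c' where "c' = (\<Sum>k\<in>S. x k * c k) - wi i * tW N i * tW N i"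
  have U: "D (tU N m) = (if m = 0 then tU N i else 0) + a' * tU N m + b' * tW N m" for m
  proof -
    have "D (tU N m) = (\<Sum>k\<in>S. x k * (if m = k then tU N i else 0)) + (\<Sum>k\<in>S. x k * a k) * tU N m + (\<Sum>k\<in>S. x k * b k) * tW N m"
      unfolding D_def sum_distrib_right sum.distrib[symmetric]
      by (intro sum.cong refl) (simp only: abc(1) distrib_left mult.assoc)
    then show ?thesis unfolding pick by (simp add: a'_def b'_def x_def tB_def algebra_simps)
  qed
  have W: "D (tW N m) = (if m = 0 then tW N i else 0) + c' * tU N m - a' * tW N m" for m
  proof -
    have "D (tW N m) = (\<Sum>k\<in>S. x k * (if m = k then tW N i else 0)) + (\<Sum>k\<in>S. x k * c k) * tU N m - (\<Sum>k\<in>S. x k * a k) * tW N m"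
      unfolding D_def sum_distrib_right sum.distrib[symmetric] sum_subtractf[symmetric]
      by (intro sum.cong refl) (simp only: abc(2) distrib_left right_diff_distrib mult.assoc)
    then show ?thesis unfolding pick by (simp add: a'_def c'_def x_def tB_def algebra_simps)
  qed
  have "good N i 0 D" by (rule goodI[OF der U W CT0])
  then show ?thesis by blast
qed

lemma good_exists:
  assumes "N \<ge> 2" "i < N" "j < N"
  shows "\<exists>D. good N i j D"
proof (cases "j = 0")
  case True
  then show ?thesis using good_corner_diagonal good_corner assms by (cases "i = 0") auto
next
  case False
  then show ?thesis using good_diagonal[of j N] good_off_diagonal[of j N i] assms by (cases "i = j") auto
qed

definition tform :: "nat \<Rightarrow> plpoly \<Rightarrow> tring" where
  "tform N P = poly_subst LC (\<lambda>(i, j). tB N i j) P"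

lemma lie_derivation_exists:
  assumes "N \<ge> 2"
  shows "\<exists>D. derivation D \<and> (\<forall>k<N. \<forall>l<N. D (tB N k l) = (\<Sum>m<N. LC (X k m) * tB N m l + LC (X l m) * tB N k m)) \<and>
    (\<forall>h. CT (Phi N * D h) = - 2 * (\<Sum>i<N. X i i) * CT (Phi N * h)) \<and>
    (\<forall>k l. N \<le> k \<or> N \<le> l \<longrightarrow> tB N k l = 0)"
proof -
  have "\<forall>i\<in>{..<N}. \<forall>m\<in>{..<N}. \<exists>D. good N m i D" using good_exists[OF assms] by blast
  then obtain E where E: "\<And>i m. i < N \<Longrightarrow> m < N \<Longrightarrow> good N m i (E i m)" by (metis lessThan_iff)
  define D where "D h = (\<Sum>i<N. \<Sum>m<N. LC (X i m) * E i m h)" for h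
  have "derivation D" unfolding D_def
    by (intro derivation_sum derivation_mult good_derivation[OF E]) auto
  moreover have "D (tB N k l) = (\<Sum>m<N. LC (X k m) * tB N m l + LC (X l m) * tB N k m)" if "k < N" "l < N" for k l
  proof -
    have "D (tB N k l) = (\<Sum>m<N. \<Sum>i<N. LC (X i m) * ((if k = i then tB N m l else 0) + (if l = i then tB N k m else 0)))"
      unfolding D_def by (subst sum.swap) (intro sum.cong refl, simp add: good_bracket[OF E])
    also have "\<dots> = (\<Sum>m<N. LC (X k m) * tB N m l + LC (X l m) * tB N k m)"
    proof (intro sum.cong refl)
      fix m
      have "(\<Sum>i<N. LC (X i m) * ((if k = i then tB N m l else 0) + (if l = i then tB N k m else 0))) =
          (\<Sum>i<N. if i = k then LC (X k m) * tB N m l else 0) + (\<Sum>i<N. if i = l then LC (X l m) * tB N k m else 0)"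
        unfolding sum.distrib[symmetric] by (intro sum.cong refl) (auto simp: distrib_left)
      then show "(\<Sum>i<N. LC (X i m) * ((if k = i then tB N m l else 0) + (if l = i then tB N k m else 0))) =
          LC (X k m) * tB N m l + LC (X l m) * tB N k m" using that by simp
    qed
    finally show ?thesis .
  qed
  moreover have "CT (Phi N * D h) = - 2 * (\<Sum>i<N. X i i) * CT (Phi N * h)" for h
  proof -
    have "CT (Phi N * D h) = (\<Sum>i<N. \<Sum>m<N. X i m * CT (Phi N * E i m h))"
      by (simp only: D_def sum_distrib_left CT_sum mult.left_commute[of "Phi N"] CT_scale)
    also have "\<dots> = (\<Sum>i<N. \<Sum>m<N. if m = i then X i i * (- 2 * CT (Phi N * h)) else 0)"
      by (intro sum.cong refl) (auto simp: good_CT[OF E])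
    also have "\<dots> = - 2 * (\<Sum>i<N. X i i) * CT (Phi N * h)"
      by (simp add: sum_distrib_left sum_distrib_right sum_negf mult_ac)
    finally show ?thesis .
  qed
  moreover have "tB N k l = 0" if "N \<le> k \<or> N \<le> l" for k l
    using that assms by (auto simp: tB_def tU_def tW_def)
  ultimately show ?thesis by blast
qed

text \<open>An inner side is \<open>d_k w_k w_(k+1)\<close> and the side at 0 is \<open>w_1\<close>;
  the closing side \<open>- w_(N-1)\<close> brings the sign.\<close>

lemma cyclic_product:
  assumes "N \<ge> 2"
  shows "(\<Prod>i<N. tB N i (Suc i mod N)) = - Phi N"
proof -
  have Bk: "tB N k (Suc k) = dv k * wv k * wv (Suc k)" if "1 \<le> k" "Suc k < N" for k
  proof -
    have "zz k = zz (Suc k) + dv k" using that by (simp add: zz_def)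
    then show ?thesis using that by (simp add: tB_def tU_def tW_def) (simp add: algebra_simps)
  qed
  have B0: "tB N 0 (Suc 0) = wv 1" using assms by (simp add: tB_def tU_def tW_def)
  have BN: "tB N (N - 1) 0 = - wv (N - 1)" using assms by (simp add: tB_def tU_def tW_def)
  have lmp: "lm (\<Sum>x\<in>A. g x) = (\<Prod>x\<in>A. lm (g x))" for A :: "nat set" and g
    by (induction A rule: infinite_finite_induct) (simp_all add: lm_add)
  have PN: "Phi M = (\<Prod>k\<in>{1..<M}. wv k * wv k) * (\<Prod>r\<in>{1..<M-1}. dv r)" for M
  proof -
    have "lm (Poly_Mapping.single (Inl k) 2) = wv k * wv k" for k
      unfolding wv_def lm_add[symmetric] single_add[symmetric] by simp
    then show ?thesis by (simp add: Phi_def phi_def lm_add lmp dv_def)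
  qed
  have ind: "wv 1 * (\<Prod>k\<in>{1..<M}. dv k * wv k * wv (Suc k)) * wv M =
      (\<Prod>k\<in>{1..<Suc M}. wv k * wv k) * (\<Prod>r\<in>{1..<M}. dv r)" if "M \<ge> 1" for M
    using that
  proof (induction M rule: nat_induct_at_least)
    case base
    show ?case by simp
  next
    case (Suc M)
    have "wv 1 * (\<Prod>k\<in>{1..<Suc M}. dv k * wv k * wv (Suc k)) * wv (Suc M) =
       (wv 1 * (\<Prod>k\<in>{1..<M}. dv k * wv k * wv (Suc k)) * wv M) * (dv M * wv (Suc M) * wv (Suc M))"
      using Suc.hyps by (simp add: mult_ac)
    then show ?case unfolding Suc.IH using Suc.hyps by (simp add: mult_ac)
  qed
  obtain M where M: "N = Suc M" "M \<ge> 1" using assms by (cases N) auto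
  have "(\<Prod>i<N. tB N i (Suc i mod N)) = (\<Prod>i<M. tB N i (Suc i mod N)) * tB N M 0"
    by (simp add: M(1))
  also have "(\<Prod>i<M. tB N i (Suc i mod N)) = tB N 0 (Suc 0 mod N) * (\<Prod>i\<in>{1..<M}. tB N i (Suc i mod N))"
  proof -
    have "{..<M} = insert 0 {1..<M}" using M(2) by auto
    then show ?thesis by simp
  qed
  also have "(\<Prod>i\<in>{1..<M}. tB N i (Suc i mod N)) = (\<Prod>k\<in>{1..<M}. dv k * wv k * wv (Suc k))"
    using M Bk by (intro prod.cong) auto
  also have "tB N 0 (Suc 0 mod N) = wv 1" using M B0 by simp
  also have "tB N M 0 = - wv M" using BN M by simp
  finally have "(\<Prod>i<N. tB N i (Suc i mod N)) = - (wv 1 * (\<Prod>k\<in>{1..<M}. dv k * wv k * wv (Suc k)) * wv M)" by simp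
  then show ?thesis unfolding ind[OF M(2)] PN by (simp add: M(1))
qed

section \<open>Existence of a formal solution\<close>

lemma tform_hom:
  "tform N (P + Q) = tform N P + tform N Q" "tform N (P * Q) = tform N P * tform N Q"
  "tform N (- P) = - tform N P" "tform N (Const c) = LC c" "tform N 1 = 1" "tform N 0 = 0"
  "tform N (P ^ n) = tform N P ^ n" "tform N (prod g A) = (\<Prod>x\<in>A. tform N (g x))"
  by (simp_all add: tform_def poly_subst_hom)

lemma tform_Var: "tform N (Var (i, j)) = tB N i j"
  by (simp add: tform_def poly_subst_hom)

lemma tform_pl: "tform N (pl i j) = tB N i j"
  by (auto simp: pl_def tform_hom tform_Var tB_def)

lemma leval_tB:
  "(\<And>v. y v \<noteq> 0) \<Longrightarrow> leval y (tB N i j) = br i j (\<lambda>k. leval y (tU N k)) (\<lambda>k. leval y (tW N k))"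
  by (simp add: tB_def br_def leval_diff leval_mult)

lemma leval_tform:
  assumes "\<And>v. y v \<noteq> 0"
  shows "leval y (tform N P) = pe (\<lambda>k. leval y (tU N k)) (\<lambda>k. leval y (tW N k)) P"
  unfolding tform_def pe_def leval_poly_subst[OF assms]
  by (intro poly_subst_cong) (auto simp: leval_tB[OF assms])

text \<open>Both derivatives obey the product rule, so agreement on Plucker coordinates suffices.
  Since \<open>D\<close> is known only on indices below \<open>N\<close>, the induction runs over
  the monomials of \<open>P\<close> instead of all polynomials.\<close>

lemma leval_tangent:
  assumes y: "\<And>v. y v \<noteq> 0" and D: "derivation D"
    and DB: "\<And>k l. k < N \<Longrightarrow> l < N \<Longrightarrow> D (tB N k l) = (\<Sum>m<N. LC (X k m) * tB N m l + LC (X l m) * tB N k m)"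
    and P: "P \<in> forms N d"
  shows "((\<lambda>t. pe (flow N X t (\<lambda>k. leval y (tU N k))) (flow N X t (\<lambda>k. leval y (tW N k))) P)
    has_field_derivative leval y (D (tform N P))) (at 0)"
proof -
  let ?u = "\<lambda>k. leval y (tU N k)" and ?w = "\<lambda>k. leval y (tW N k)"
  define T where "T P \<longleftrightarrow> ((\<lambda>t. pe (flow N X t ?u) (flow N X t ?w) P) has_field_derivative leval y (D (tform N P))) (at 0)" for P
  have f0: "flow N X 0 v = v" for v by (simp add: flow_def)
  have df: "((\<lambda>t. flow N X t v i) has_field_derivative (\<Sum>k<N. X i k * v k)) (at 0)" for v i
    unfolding flow_def by (auto intro!: derivative_eq_intros)
  have V: "T (Var (i, j))" if "i < N" "j < N" for i j
  proof -
    have "((\<lambda>t. br i j (flow N X t ?u) (flow N X t ?w)) has_field_derivative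
        ((\<Sum>k<N. X i k * ?u k) * ?w j + (\<Sum>k<N. X j k * ?w k) * ?u i) -
        ((\<Sum>k<N. X j k * ?u k) * ?w i + (\<Sum>k<N. X i k * ?w k) * ?u j)) (at 0)"
      unfolding br_def
      by (rule DERIV_cong[OF DERIV_diff[OF DERIV_mult[OF df df] DERIV_mult[OF df df]]]) (simp add: f0)
    moreover have "leval y (D (tB N i j)) = ((\<Sum>k<N. X i k * ?u k) * ?w j + (\<Sum>k<N. X j k * ?w k) * ?u i) -
        ((\<Sum>k<N. X j k * ?u k) * ?w i + (\<Sum>k<N. X i k * ?w k) * ?u j)"
    proof -
      have "leval y (D (tB N i j)) = (\<Sum>k<N. X i k * br k j ?u ?w + X j k * br i k ?u ?w)"
        unfolding DB[OF that] leval_sum[OF y] leval_add[OF y] leval_mult[OF y] leval_LC[OF y] leval_tB[OF y] ..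
      then show ?thesis
        unfolding br_def sum_distrib_right sum.distrib[symmetric] sum_subtractf[symmetric]
        by (simp only:) (intro sum.cong refl, simp add: algebra_simps)
    qed
    ultimately show ?thesis by (simp only: T_def pe_Var tform_Var)
  qed
  have C: "T (Const c)" for c
    using derivation_simps(3)[OF D, of c] by (simp add: T_def pe_hom tform_hom leval_def)
  have M: "T (P * Q)" if "T P" "T Q" for P Q
    using DERIV_mult[OF that[unfolded T_def]]
    by (simp only: T_def pe_hom tform_hom derivation_simps[OF D] leval_add[OF y] leval_mult[OF y] leval_tform[OF y] f0)
      (simp add: mult_ac add_ac)
  have A: "T (P + Q)" if "T P" "T Q" for P Q
    using DERIV_add[OF that[unfolded T_def]]
    by (simp only: T_def pe_hom tform_hom derivation_simps[OF D] leval_add[OF y])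
  have T1: "T 1" using C[of 1] by (simp add: Const_def)
  have T0: "T 0" using C[of 0] by (simp add: Const_def)
  have pow: "T (Q ^ n)" if "T Q" for Q n
    by (induction n) (simp_all add: T1 M that)
  have mono: "T (Poly_Mapping.single m c)" if "m \<in> keys P" for m c
  proof -
    have "T (\<Prod>v\<in>A. Var v ^ lookup m v)" if "A \<subseteq> keys m" for A
      using finite_subset[OF that finite_keys] that
    proof (induction A rule: finite_induct)
      case (insert v A)
      obtain i j where v: "v = (i, j)" by fastforce
      have "T (Var v)" unfolding v
        by (rule V; rule forms_indices[OF P \<open>m \<in> keys P\<close>]) (use insert.prems v in auto)
      then show ?case using insert by (simp add: M pow)
    qed (simp add: T1)
    then show ?thesis
      by (subst single_eq_Const_mult) (simp add: C M single_one_prod)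
  qed
  have "T (\<Sum>m\<in>A. Poly_Mapping.single m (lookup P m))" if "A \<subseteq> keys P" for A
    using finite_subset[OF that finite_keys] that
    by (induction A rule: finite_induct) (simp_all add: T0 A mono)
  from this[OF order_refl] have "T P" by (simp only: poly_mapping_decompose[symmetric])
  then show ?thesis by (simp only: T_def)
qed

lemma polynomial_vanishing:
  assumes "finite K" "\<And>c :: complex. (\<Sum>k\<in>K. c ^ k * x k) = 0" "k \<in> K"
  shows "x k = 0"
proof -
  have "(\<Sum>i\<le>Max K. (if i \<in> K then x i else 0) * c ^ i) = (\<Sum>k\<in>K. c ^ k * x k)" for c
    using assms(1) by (intro sum.mono_neutral_cong_right) auto
  then have "\<forall>c. (\<Sum>i\<le>Max K. (if i \<in> K then x i else 0) * c ^ i) = 0" by (simp only: assms(2) simp_thms)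
  then have "\<forall>i\<le>Max K. (if i \<in> K then x i else 0) = 0" by (simp only: polyfun_eq_0)
  then show ?thesis using assms(1,3) by (metis Max_ge)
qed

context plucker_frame
begin

definition tQ :: "'b \<Rightarrow> tring" where "tQ j = tform N (p j)"

definition tF :: tring where "tF = tform N (cyclic_section N)"

definition tFi :: tring where "tFi = - lm (- phi N)"

definition psub :: "'b mpoly \<Rightarrow> tring" where "psub P = poly_subst LC tQ P"

text \<open>The invariant functional is the constant term of \<open>f\<close> times a function; on
  the monomial \<open>m\<close> over \<open>f^(k+1)\<close> this leaves \<open>k\<close> inverse
  powers of \<open>f\<close>, where \<open>k = mdeg m\<close>. The remaining factors undo
  \<open>val\<close> and \<open>mfact\<close>.\<close>

definition cser :: "'b series" where
  "cser m = (-1) ^ mdeg m * fact (mdeg m) * CT (psub (Poly_Mapping.single m 1) * tFi ^ mdeg m) / mfact m"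

lemma tF_eq: "tF = - Phi N"
  using cyclic_product[OF N2] by (simp add: tF_def cyclic_section_def tform_hom tform_pl)

lemma tF_inverse: "tF * tFi = 1"
  by (simp add: tF_eq tFi_def Phi_def flip: lm_add)

lemma leval_tQ: "(\<And>v. y v \<noteq> 0) \<Longrightarrow> leval y (tQ j) = q j (\<lambda>k. leval y (tU N k)) (\<lambda>k. leval y (tW N k))"
  by (simp add: tQ_def leval_tform q_def)

lemma leval_psub:
  "(\<And>v. y v \<noteq> 0) \<Longrightarrow> leval y (psub P) =
    poly_eval (\<lambda>i. q i (\<lambda>k. leval y (tU N k)) (\<lambda>k. leval y (tW N k))) P"
  by (simp add: psub_def leval_poly_subst leval_tQ)

lemma psub_hom:
  "psub (P + R) = psub P + psub R" "psub (P * R) = psub P * psub R" "psub (Const c) = LC c"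
  "psub (\<Sum>x\<in>A. g x) = (\<Sum>x\<in>A. psub (g x))"
  by (simp_all add: psub_def poly_subst_hom)

lemma func_cser:
  assumes "homog k P"
  shows "func cser P = (-1) ^ k * fact k * CT (psub P * tFi ^ k)"
proof -
  have "psub P = psub (\<Sum>m\<in>keys P. Const (lookup P m) * Poly_Mapping.single m 1)"
    by (simp only: single_eq_Const_mult[symmetric] poly_mapping_decompose[symmetric])
  also have "\<dots> = (\<Sum>m\<in>keys P. LC (lookup P m) * psub (Poly_Mapping.single m 1))"
    by (simp only: psub_hom)
  finally have "CT (psub P * tFi ^ k) = (\<Sum>m\<in>keys P. lookup P m * CT (psub (Poly_Mapping.single m 1) * tFi ^ k))"
    by (simp only: sum_distrib_right CT_sum mult.assoc CT_scale)
  moreover have "func cser P = (\<Sum>m\<in>keys P. lookup P m * ((-1) ^ k * fact k * CT (psub (Poly_Mapping.single m 1) * tFi ^ k)))"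
    unfolding func_def alg_eval_def
    by (intro sum.cong refl) (use assms in \<open>simp add: cser_def homog_def\<close>)
  ultimately show ?thesis by (simp add: sum_distrib_left mult.left_commute)
qed

lemma cser_zero: "cser 0 = 1"
proof -
  have "psub (Poly_Mapping.single 0 1) = 1" by (simp add: psub_def poly_subst_hom)
  then show ?thesis by (simp add: cser_def CT_def lookup_one)
qed

text \<open>Varying the scalar on the cone shows that each homogeneous component vanishes there.
  Such a component is zero in the Laurent ring, before any constant term is taken.\<close>

lemma func_cser_vanishing:
  assumes "P \<in> vanishing_ideal a (plucker_cone N)"
  shows "func cser P = 0"
proof -
  define K where "K = mdeg ` keys P"
  define H where "H k = (\<Sum>m\<in>{m \<in> keys P. mdeg m = k}. Poly_Mapping.single m (lookup P m))" for k
  have fK: "finite K" by (simp add: K_def)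
  have "(\<Sum>m\<in>keys P. Poly_Mapping.single m (lookup P m)) = (\<Sum>k\<in>K. H k)"
    unfolding K_def H_def by (rule sum.image_gen) simp
  then have P: "P = (\<Sum>k\<in>K. H k)" by (simp only: poly_mapping_decompose[symmetric])
  have h: "homog k (H k)" for k unfolding H_def by (intro homog_sum homog_single) simp
  have z: "poly_eval (\<lambda>i. q i u w) (H k) = 0" if "k \<in> K" for k u w
  proof (rule polynomial_vanishing[OF fK _ that])
    fix c :: complex
    have "(\<Sum>k\<in>K. c ^ k * poly_eval (\<lambda>i. q i u w) (H k)) = poly_eval (\<lambda>i. c * q i u w) (\<Sum>k\<in>K. H k)"
      by (simp only: homog_eval_scale[OF h] poly_subst_sum[OF coeff_hom_id])
    also have "\<dots> = 0" using assms unfolding vanishing_ideal_iff P[symmetric] by blast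
    finally show "(\<Sum>k\<in>K. c ^ k * poly_eval (\<lambda>i. q i u w) (H k)) = 0" .
  qed
  have "psub (H k) = 0" if "k \<in> K" for k
  proof (rule leval_eq_zero)
    fix y :: "nat + nat \<Rightarrow> complex" assume y: "\<And>v. y v \<noteq> 0"
    show "leval y (psub (H k)) = 0" by (simp only: leval_psub[OF y] z[OF that])
  qed
  then have "func cser (H k) = 0" if "k \<in> K" for k
    unfolding func_cser[OF h] using that by simp
  then have "func cser (\<Sum>k\<in>K. H k) = 0" by (simp add: func_linear)
  then show ?thesis by (simp only: P[symmetric])
qed

lemma func_cser_lie:
  assumes "(x, s) \<in> lie_alg N"
  shows "func cser (deriv_monom (tc (x, s)) m) +
    func cser (deriv_lin (tc (x, s)) (\<lambda>i. a i (cyclic_section N)) * Poly_Mapping.single m 1) +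
    s * (mfact m * cser m) = 0"
proof -
  let ?f = "\<lambda>i. a i (cyclic_section N)" and ?\<tau> = "tc (x, s)" and ?b = "Poly_Mapping.single m (1 :: complex)"
  have x: "x \<in> carrier_mat N N" and tr: "(\<Sum>i<N. x $$ (i, i)) = 0" using assms by (auto simp: lie_alg_def)
  define X where "X = (\<lambda>i k. x $$ (i, k))"
  from lie_derivation_exists[OF N2, of X] obtain D where D: "derivation D"
    and DB: "\<And>k l. k < N \<Longrightarrow> l < N \<Longrightarrow> D (tB N k l) = (\<Sum>m<N. LC (X k m) * tB N m l + LC (X l m) * tB N k m)"
    and CT0: "\<And>h. CT (Phi N * D h) = - 2 * (\<Sum>i<N. X i i) * CT (Phi N * h)" by blast
  have CT: "CT (tF * D h) = 0" for h using CT0[of h] tr by (simp add: tF_eq CT_uminus X_def)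
  note ds = derivation_simps[OF D]
  have DQ: "leval y (D (tQ j)) = (\<Sum>i\<in>UNIV. ?\<tau> j i * leval y (tQ i)) - s * leval y (tQ j)" if y: "\<And>v. y v \<noteq> 0" for y j
  proof -
    let ?u = "\<lambda>k. leval y (tU N k)" and ?w = "\<lambda>k. leval y (tW N k)"
    have "((\<lambda>t. q j (flow N X t ?u) (flow N X t ?w)) has_field_derivative leval y (D (tQ j))) (at 0)"
      unfolding q_def tQ_def by (rule leval_tangent[OF y D DB p_forms])
    moreover have "((\<lambda>t. q j (flow N X t ?u) (flow N X t ?w)) has_field_derivative
        (\<Sum>i\<in>UNIV. ?\<tau> j i * q i ?u ?w) - s * q j ?u ?w) (at 0)"
      unfolding X_def by (rule flow_derivative[OF x])
    ultimately have "leval y (D (tQ j)) = (\<Sum>i\<in>UNIV. ?\<tau> j i * q i ?u ?w) - s * q j ?u ?w" by (rule DERIV_unique)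
    then show ?thesis by (simp only: leval_tQ[OF y])
  qed
  define G where "G = psub ?b"
  define k where "k = mdeg m"
  have DG: "leval y (D G) = (\<Sum>j\<in>UNIV. of_nat (lookup m j) * monom_eval (\<lambda>i. leval y (tQ i)) (m - Poly_Mapping.single j 1) * leval y (D (tQ j)))"
    if y: "\<And>v. y v \<noteq> 0" for y
  proof -
    let ?u = "\<lambda>k. leval y (tU N k)" and ?w = "\<lambda>k. leval y (tW N k)"
    define M where "M = monom_eval p m"
    have MM: "M = (\<Prod>v\<in>keys m. p v ^ lookup m v)" by (simp add: M_def monom_eval_def)
    have "M \<in> forms N (\<Sum>v\<in>keys m. lookup m v * N)" unfolding MM
      by (intro forms_prod forms_power p_forms) auto
    from leval_tangent[OF y D DB this]
    have "((\<lambda>t. pe (flow N X t ?u) (flow N X t ?w) M) has_field_derivative leval y (D (tform N M))) (at 0)" .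
    moreover have "tform N M = G"
      by (simp add: G_def psub_def poly_subst_single MM monom_eval_def tform_hom tQ_def LC_simps)
    moreover have "pe u w M = monom_eval (\<lambda>i. q i u w) m" for u w
    proof -
      have "pe u w (P ^ n) = pe u w P ^ n" for P n by (induction n) (simp_all add: pe_hom)
      then show ?thesis by (simp add: MM pe_hom monom_eval_def q_def)
    qed
    ultimately have 1: "((\<lambda>t. monom_eval (\<lambda>i. q i (flow N X t ?u) (flow N X t ?w)) m) has_field_derivative leval y (D G)) (at 0)"
      by simp
    have f0: "flow N X 0 v = v" for v by (simp add: flow_def)
    have dq: "((\<lambda>t. q j (flow N X t ?u) (flow N X t ?w)) has_field_derivative leval y (D (tQ j))) (at 0)" for j
      unfolding q_def tQ_def by (rule leval_tangent[OF y D DB p_forms])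
    have 2: "((\<lambda>t. monom_eval (\<lambda>i. q i (flow N X t ?u) (flow N X t ?w)) m) has_field_derivative
      (\<Sum>j\<in>UNIV. of_nat (lookup m j) * monom_eval (\<lambda>i. q i (flow N X 0 ?u) (flow N X 0 ?w)) (m - Poly_Mapping.single j 1) * leval y (D (tQ j)))) (at 0)"
      by (rule monom_eval_derivative[of "\<lambda>t i. q i (flow N X t ?u) (flow N X t ?w)"]) (rule dq)
    from DERIV_unique[OF 1 2] show ?thesis unfolding f0 leval_tQ[OF y] .
  qed
  have leval_b: "leval y G = monom_eval (\<lambda>i. leval y (tQ i)) m" if y: "\<And>v. y v \<noteq> 0" for y
    by (simp add: G_def leval_psub[OF y] leval_tQ[OF y] poly_subst_single)
  \<comment> \<open>The surplus over \<open>D G\<close> is the scalar part \<open>s\<close>, counted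
    once for each of the \<open>k\<close> factors.\<close>
  have E1: "psub (deriv_monom ?\<tau> m) = D G + LC (s * of_nat k) * G"
  proof (rule leval_eqI)
    fix y :: "nat + nat \<Rightarrow> complex" assume y: "\<And>v. y v \<noteq> 0"
    let ?n = "\<lambda>j. of_nat (lookup m j) * monom_eval (\<lambda>i. leval y (tQ i)) (m - Poly_Mapping.single j 1)"
    have "?n j * leval y (tQ j) = of_nat (lookup m j) * monom_eval (\<lambda>i. leval y (tQ i)) m" for j
    proof (cases "lookup m j = 0")
      case False
      have "monom_eval (\<lambda>i. leval y (tQ i)) m = monom_eval (\<lambda>i. leval y (tQ i)) (Poly_Mapping.single j 1 + (m - Poly_Mapping.single j 1))"
        by (simp only: minus_single_add[OF False])
      then show ?thesis by (simp add: monom_eval_add mult_ac)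
    qed simp
    then have "(\<Sum>j\<in>UNIV. ?n j * leval y (tQ j)) = of_nat (\<Sum>j\<in>UNIV. lookup m j) * leval y G"
      by (simp only: leval_b[OF y] sum_distrib_right of_nat_sum)
    also have "(\<Sum>j\<in>UNIV. lookup m j) = k"
      unfolding k_def mdeg_def by (intro sum.mono_neutral_right) (auto simp: in_keys_iff)
    finally have s1: "(\<Sum>j\<in>UNIV. ?n j * leval y (tQ j)) = of_nat k * leval y G" .
    have "leval y (psub (deriv_monom ?\<tau> m)) = (\<Sum>j\<in>UNIV. ?n j * (\<Sum>i\<in>UNIV. ?\<tau> j i * leval y (tQ i)))"
      by (simp only: leval_psub[OF y] leval_tQ[OF y] poly_eval_deriv_monom)
    also have "\<dots> = (\<Sum>j\<in>UNIV. ?n j * (leval y (D (tQ j)) + s * leval y (tQ j)))"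
      by (intro sum.cong refl) (simp add: DQ[OF y])
    also have "\<dots> = leval y (D G) + s * (\<Sum>j\<in>UNIV. ?n j * leval y (tQ j))"
      unfolding DG[OF y] sum_distrib_left sum.distrib[symmetric] by (intro sum.cong refl) (simp add: algebra_simps)
    also have "\<dots> = leval y (D G) + s * (of_nat k * leval y G)" by (simp only: s1)
    finally show "leval y (psub (deriv_monom ?\<tau> m)) = leval y (D G + LC (s * of_nat k) * G)"
      by (simp add: leval_add[OF y] leval_mult[OF y] leval_LC[OF y])
  qed
  have F: "tF = (\<Sum>j\<in>UNIV. LC (?f j) * tQ j)"
  proof (rule leval_eqI)
    fix y :: "nat + nat \<Rightarrow> complex" assume y: "\<And>v. y v \<noteq> 0"
    show "leval y tF = leval y (\<Sum>j\<in>UNIV. LC (?f j) * tQ j)"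
      unfolding tF_def leval_tform[OF y] pe_expand[OF cyclic_section_forms] leval_sum[OF y] leval_mult[OF y]
        leval_LC[OF y] leval_tQ[OF y] by (intro sum.cong refl) (rule mult.commute)
  qed
  have E2: "psub (deriv_lin ?\<tau> ?f) = D tF + LC s * tF"
  proof (rule leval_eqI)
    fix y :: "nat + nat \<Rightarrow> complex" assume y: "\<And>v. y v \<noteq> 0"
    have "leval y (psub (deriv_lin ?\<tau> ?f)) = (\<Sum>j\<in>UNIV. ?f j * (\<Sum>i\<in>UNIV. ?\<tau> j i * leval y (tQ i)))"
      by (simp only: leval_psub[OF y] leval_tQ[OF y] poly_eval_deriv_lin)
    also have "\<dots> = (\<Sum>j\<in>UNIV. ?f j * leval y (D (tQ j)) + s * (?f j * leval y (tQ j)))"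
      by (intro sum.cong refl) (simp add: DQ[OF y] algebra_simps)
    also have "\<dots> = leval y (D tF + LC s * tF)"
      unfolding F ds(2,3,8) mult_zero_left add_0 leval_sum[OF y] leval_add[OF y] leval_mult[OF y] leval_LC[OF y]
        sum_distrib_left sum.distrib ..
    finally show "leval y (psub (deriv_lin ?\<tau> ?f)) = leval y (D tF + LC s * tF)" .
  qed
  have DFi: "D (tFi ^ n) = - (of_nat n * (tFi ^ Suc n * D tF))" for n
  proof (induction n)
    case (Suc n)
    have "D tF * tFi + tF * D tFi = 0" using ds(2)[of tF tFi] by (simp add: tF_inverse ds(5))
    then have "tFi * (D tF * tFi) + (tF * tFi) * D tFi = 0"
      by (metis (no_types, opaque_lifting) distrib_left mult.assoc mult.commute mult_zero_right)
    then have "D tFi = - (tFi * (D tF * tFi))" by (simp add: tF_inverse eq_neg_iff_add_eq_0 add.commute)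
    then show ?case by (simp add: ds(2) Suc algebra_simps)
  qed (simp add: ds)
  let ?K = "(-1) ^ k * fact k :: complex"
  let ?g = "CT (G * tFi ^ k)"
  \<comment> \<open>This is the vanishing constant term of \<open>tF * D (G * tFi ^ Suc k)\<close>,
    expanded by the product rule; it vanishes because \<open>x\<close> is traceless.\<close>
  have key: "CT (D G * tFi ^ k) - of_nat (k + 1) * CT (D tF * G * tFi ^ Suc k) = 0"
  proof -
    have r: "tF * tFi ^ Suc n = tFi ^ n" for n
      by (simp add: mult.assoc[symmetric] tF_inverse)
    have "tF * D (G * tFi ^ Suc k) = D G * (tF * tFi ^ Suc k) - of_nat (Suc k) * (D tF * G * (tF * tFi ^ Suc (Suc k)))"
      unfolding ds(2) DFi by (simp add: algebra_simps)
    then have "tF * D (G * tFi ^ Suc k) = D G * tFi ^ k - LC (of_nat (Suc k)) * (D tF * G * tFi ^ Suc k)"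
      by (simp only: r LC_def single_of_nat)
    then have "CT (D G * tFi ^ k) - of_nat (Suc k) * CT (D tF * G * tFi ^ Suc k) = 0"
      using CT[of "G * tFi ^ Suc k"] by (simp only: CT_diff CT_scale)
    then show ?thesis by simp
  qed
  have h: "homog k (deriv_monom ?\<tau> m)" "homog k ?b" using homog_deriv_monom[of m] by (auto simp: k_def homog_single)
  have "func cser (deriv_monom ?\<tau> m) = ?K * (CT (D G * tFi ^ k) + s * of_nat k * ?g)"
    unfolding func_cser[OF h(1)] E1 by (simp add: distrib_right CT_add mult.assoc CT_scale)
  moreover have "func cser (deriv_lin ?\<tau> ?f * ?b) =
      - ?K * (of_nat (k + 1) * CT (D tF * G * tFi ^ Suc k) + of_nat (k + 1) * s * ?g)"
  proof -
    have "psub (deriv_lin ?\<tau> ?f * ?b) * tFi ^ Suc k = D tF * G * tFi ^ Suc k + LC s * (G * tFi ^ k * (tF * tFi))"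
      unfolding psub_hom E2 G_def[symmetric] by (simp add: algebra_simps)
    then have "CT (psub (deriv_lin ?\<tau> ?f * ?b) * tFi ^ Suc k) = CT (D tF * G * tFi ^ Suc k) + s * ?g"
      by (simp only: tF_inverse mult_1_right CT_add CT_scale)
    moreover have "homog (Suc k) (deriv_lin ?\<tau> ?f * ?b)" using homog_mult[OF homog_deriv_lin h(2)] by simp
    ultimately show ?thesis
      by (simp only: func_cser) (simp add: algebra_simps)
  qed
  moreover have "mfact m * cser m = ?K * ?g" by (simp add: cser_def k_def G_def)
  \<comment> \<open>The terms with \<open>s\<close> cancel since \<open>k - (k + 1) + 1 = 0\<close>;
    the last summand comes from \<open>beta\<close>.\<close>
  ultimately have "func cser (deriv_monom ?\<tau> m) + func cser (deriv_lin ?\<tau> ?f * ?b) + s * (mfact m * cser m) =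
      ?K * (CT (D G * tFi ^ k) - of_nat (k + 1) * CT (D tF * G * tFi ^ Suc k))"
    by (simp only:) (simp add: algebra_simps)
  then show ?thesis unfolding key by simp
qed

theorem cser_annihilated:
  assumes "P \<in> tautological_ideal a (plucker_cone N) (lie_alg N) (lie_rep N) beta"
  shows "weyl_act (\<lambda>i. a i (cyclic_section N)) P cser = 0"
  using assms unfolding tautological_ideal_def
proof (rule weyl_act_left_ideal)
  fix G
  assume "G \<in> (\<lambda>x. lin_operator a (lie_rep N x) + wconst (beta x)) ` lie_alg N \<union>
    poly_partial ` vanishing_ideal a (plucker_cone N)"
  then consider x s where "(x, s) \<in> lie_alg N" "G = lin_operator a (lie_rep N (x, s)) + wconst s"
    | R where "R \<in> vanishing_ideal a (plucker_cone N)" "G = poly_partial R"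
    by (auto simp: beta_def)
  then show "weyl_act (\<lambda>i. a i (cyclic_section N)) G cser = 0"
  proof cases
    case 1
    show ?thesis
    proof (rule ext)
      fix m
      have "mfact m * weyl_act (\<lambda>i. a i (cyclic_section N)) G cser m = 0"
        using weyl_act_lin_operator[of a "lie_rep N (x, s)" "tc (x, s)" m _ s cser] func_cser_lie[OF 1(1), of m] 1(2)
        by (simp add: tc_def)
      then show "weyl_act (\<lambda>i. a i (cyclic_section N)) G cser m = 0 m" by simp
    qed
  next
    case 2
    show ?thesis
    proof (rule ext)
      fix m
      have "Poly_Mapping.single m 1 * R \<in> vanishing_ideal a (plucker_cone N)"
        using 2(1) by (simp add: vanishing_ideal_iff poly_subst_hom)
      then have "mfact m * weyl_act (\<lambda>i. a i (cyclic_section N)) G cser m = 0"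
        unfolding 2(2) weyl_act_poly_partial by (rule func_cser_vanishing)
      then show "weyl_act (\<lambda>i. a i (cyclic_section N)) G cser m = 0 m" by simp
    qed
  qed
qed

end

section \<open>Convergence\<close>

text \<open>The sum norm on coefficients: it is submultiplicative and dominates the constant term,
  which gives geometric bounds for constant terms of products.\<close>

definition nrm :: "'x laurent \<Rightarrow> real" where
  "nrm h = (\<Sum>m\<in>keys h. norm (lookup h m))"

lemma nrm_superset: "finite A \<Longrightarrow> keys h \<subseteq> A \<Longrightarrow> nrm h = (\<Sum>m\<in>A. norm (lookup h m))"
  unfolding nrm_def by (intro sum.mono_neutral_left) (auto simp: in_keys_iff)

lemma nrm_nonneg: "0 \<le> nrm h"
  by (simp add: nrm_def sum_nonneg)

lemma nrm_add: "nrm (g + h) \<le> nrm g + nrm h"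
proof -
  let ?A = "keys g \<union> keys h"
  have A: "finite ?A" "keys (g + h) \<subseteq> ?A" "keys g \<subseteq> ?A" "keys h \<subseteq> ?A"
    using Poly_Mapping.keys_add[of g h] by auto
  show ?thesis
    unfolding nrm_superset[OF A(1,2)] nrm_superset[OF A(1,3)] nrm_superset[OF A(1,4)] sum.distrib[symmetric]
    by (intro sum_mono) (simp add: lookup_add norm_triangle_ineq)
qed

lemma nrm_zero [simp]: "nrm 0 = 0"
  by (simp add: nrm_def)

lemma nrm_sum: "nrm (\<Sum>x\<in>A. g x) \<le> (\<Sum>x\<in>A. nrm (g x))"
proof (induction A rule: infinite_finite_induct)
  case (insert x A)
  then show ?case using nrm_add[of "g x" "\<Sum>x\<in>A. g x"] by simp
qed simp_all

lemma nrm_single: "nrm (Poly_Mapping.single m c) = norm c"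
  using nrm_superset[of "{m}" "Poly_Mapping.single m c"] by simp

lemma nrm_one: "nrm 1 = 1"
  using nrm_single[of 0 1] by simp

lemma nrm_mult: "nrm (g * h) \<le> nrm g * nrm h"
proof -
  define S where "S p m = Poly_Mapping.single m (lookup p m)" for p :: "'a laurent" and m
  have d: "p = (\<Sum>m\<in>keys p. S p m)" for p unfolding S_def by (rule poly_mapping_decompose)
  have "nrm (g * h) = nrm ((\<Sum>m\<in>keys g. S g m) * (\<Sum>n\<in>keys h. S h n))" by (simp only: d[symmetric])
  also have "\<dots> = nrm (\<Sum>m\<in>keys g. \<Sum>n\<in>keys h. S g m * S h n)" by (simp only: sum_product)
  also have "\<dots> \<le> (\<Sum>m\<in>keys g. \<Sum>n\<in>keys h. nrm (S g m * S h n))"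
    by (rule order_trans[OF nrm_sum]) (intro sum_mono nrm_sum)
  also have "\<dots> = nrm g * nrm h"
    unfolding S_def mult_single nrm_single norm_mult unfolding nrm_def sum_product ..
  finally show ?thesis .
qed

lemma nrm_power: "nrm (h ^ n) \<le> nrm h ^ n"
proof (induction n)
  case (Suc n)
  have "nrm (h ^ Suc n) \<le> nrm h * nrm (h ^ n)" by (simp add: nrm_mult)
  also have "\<dots> \<le> nrm h * nrm h ^ n" by (intro mult_left_mono Suc nrm_nonneg)
  finally show ?case by simp
qed (simp add: nrm_one)

lemma nrm_prod: "nrm (\<Prod>x\<in>A. g x) \<le> (\<Prod>x\<in>A. nrm (g x))"
proof (induction A rule: infinite_finite_induct)
  case (insert x A)
  have "nrm (\<Prod>x\<in>insert x A. g x) \<le> nrm (g x) * nrm (\<Prod>x\<in>A. g x)" using insert(1,2) by (simp add: nrm_mult)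
  also have "\<dots> \<le> nrm (g x) * (\<Prod>x\<in>A. nrm (g x))" by (intro mult_left_mono insert.IH nrm_nonneg)
  finally show ?case using insert(1,2) by simp
qed (simp_all add: nrm_one)

lemma norm_CT_le: "norm (CT h) \<le> nrm h"
proof (cases "0 \<in> keys h")
  case True
  then show ?thesis unfolding CT_def nrm_def
    by (intro member_le_sum[of 0 "keys h" "\<lambda>m. norm (lookup h m)"]) auto
qed (simp add: CT_def nrm_nonneg in_keys_iff)

text \<open>A multinomial coefficient is bounded by the sum of all of them, a power of the number of
  variables; variables are added one at a time through the binomial theorem.\<close>

lemma multinomial_le:
  "finite A \<Longrightarrow> (fact (\<Sum>i\<in>A. n i) :: real) \<le> real (card A) ^ (\<Sum>i\<in>A. n i) * (\<Prod>i\<in>A. fact (n i))"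
proof (induction A rule: finite_induct)
  case (insert x A)
  define s where "s = (\<Sum>i\<in>A. n i)"
  have b: "real ((n x + s) choose n x) * real (card A) ^ s \<le> (1 + real (card A)) ^ (n x + s)"
  proof -
    have "(1 + real (card A)) ^ (n x + s) = (\<Sum>k\<le>n x + s. real ((n x + s) choose k) * 1 ^ k * real (card A) ^ (n x + s - k))"
      by (rule binomial_ring)
    also have "\<dots> \<ge> real ((n x + s) choose n x) * 1 ^ n x * real (card A) ^ (n x + s - n x)"
      by (rule member_le_sum) auto
    finally show ?thesis by simp
  qed
  have "(fact (n x + s) :: real) = real ((n x + s) choose n x) * fact (n x) * fact s"
  proof -
    have "fact (n x) * fact s * ((n x + s) choose n x) = (fact (n x + s) :: nat)"
      using binomial_fact_lemma[of "n x" "n x + s"] by simp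
    then have "real (fact (n x) * fact s * ((n x + s) choose n x)) = real (fact (n x + s))" by (simp only:)
    then show ?thesis by (simp add: mult_ac)
  qed
  also have "\<dots> \<le> real ((n x + s) choose n x) * fact (n x) * (real (card A) ^ s * (\<Prod>i\<in>A. fact (n i)))"
    using insert.IH by (intro mult_left_mono) (simp_all add: s_def)
  also have "\<dots> = (real ((n x + s) choose n x) * real (card A) ^ s) * (fact (n x) * (\<Prod>i\<in>A. fact (n i)))"
    by (simp add: mult_ac)
  also have "\<dots> \<le> (1 + real (card A)) ^ (n x + s) * (fact (n x) * (\<Prod>i\<in>A. fact (n i)))"
    by (intro mult_right_mono b) (simp add: prod_nonneg)
  finally show ?case using insert(1,2) by (simp add: s_def add.commute)
qed simp

lemma mdeg_UNIV: "mdeg (m :: 'b::finite \<Rightarrow>\<^sub>0 nat) = (\<Sum>i\<in>UNIV. lookup m i)"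
  unfolding mdeg_def by (intro sum.mono_neutral_left) (auto simp: in_keys_iff)

text \<open>A finite set of multi-indices lies in a box, on which the sum factors into geometric
  sums, each at most 2.\<close>

lemma geometric_summable: "(\<lambda>m :: 'b::finite \<Rightarrow>\<^sub>0 nat. (1 / 2 :: real) ^ mdeg m) summable_on UNIV"
proof (rule nonneg_bdd_above_summable_on)
  show "bdd_above (sum (\<lambda>m :: 'b \<Rightarrow>\<^sub>0 nat. (1 / 2 :: real) ^ mdeg m) ` {F. F \<subseteq> UNIV \<and> finite F})"
  proof (rule bdd_aboveI2)
    fix F :: "('b \<Rightarrow>\<^sub>0 nat) set" assume "F \<in> {F. F \<subseteq> UNIV \<and> finite F}"
    then have F: "finite F" by simp
    define M where "M = (\<Sum>m\<in>F. mdeg m)"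
    have lM: "lookup m i \<le> M" if "m \<in> F" for m i
    proof -
      have "lookup m i \<le> mdeg m" unfolding mdeg_UNIV by (rule member_le_sum) auto
      also have "\<dots> \<le> M" unfolding M_def using F that by (intro member_le_sum) auto
      finally show ?thesis .
    qed
    have inj: "inj_on lookup F" by (rule inj_onI) (rule poly_mapping_eq_iff[THEN iffD2])
    have g: "(\<Sum>n\<le>M. (1 / 2 :: real) ^ n) \<le> 2"
    proof -
      have "(\<Sum>n\<le>k. (1 / 2 :: real) ^ n) = 2 - (1 / 2) ^ k" for k by (induction k) auto
      then show ?thesis by simp
    qed
    have "(\<Sum>m\<in>F. (1 / 2 :: real) ^ mdeg m) = (\<Sum>g\<in>lookup ` F. \<Prod>i\<in>UNIV. (1 / 2) ^ g i)"
      by (simp add: sum.reindex[OF inj] mdeg_UNIV power_sum)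
    also have "\<dots> \<le> (\<Sum>g\<in>PiE (UNIV :: 'b set) (\<lambda>_. {..M}). \<Prod>i\<in>UNIV. (1 / 2) ^ g i)"
      by (rule sum_mono2) (use lM in \<open>auto intro!: finite_PiE prod_nonneg\<close>)
    also have "\<dots> = (\<Prod>i\<in>(UNIV :: 'b set). \<Sum>n\<le>M. (1 / 2) ^ n)"
      by (rule prod_sum_PiE[symmetric]) auto
    also have "\<dots> \<le> (\<Prod>i\<in>(UNIV :: 'b set). 2)"
      by (intro prod_mono conjI g sum_nonneg) auto
    finally show "(\<Sum>m\<in>F. (1 / 2 :: real) ^ mdeg m) \<le> 2 ^ CARD('b)" by simp
  qed
qed auto

section \<open>Convergent series as a module over the Weyl algebra\<close>

lemma conv_seriesI:
  assumes "r > 0" "(\<lambda>m. norm (c m) * r ^ mdeg m) summable_on UNIV"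
  shows "c \<in> conv_series"
  using assms by (auto simp: conv_series_def)

lemma summable_on_le:
  fixes g h :: "'a \<Rightarrow> real"
  assumes "h summable_on A" "\<And>x. x \<in> A \<Longrightarrow> g x \<le> h x" "\<And>x. x \<in> A \<Longrightarrow> 0 \<le> g x"
  shows "g summable_on A"
  by (rule summable_on_comparison_test[OF assms])

lemma conv_series_add:
  assumes "c \<in> conv_series" "d \<in> conv_series"
  shows "c + d \<in> conv_series"
proof -
  obtain r s where r: "r > 0" "(\<lambda>m. norm (c m) * r ^ mdeg m) summable_on UNIV"
    and s: "s > 0" "(\<lambda>m. norm (d m) * s ^ mdeg m) summable_on UNIV"
    using assms by (auto simp: conv_series_def)
  show ?thesis
  proof (rule conv_seriesI)
    show "0 < min r s" using r s by simp
    show "(\<lambda>m. norm ((c + d) m) * min r s ^ mdeg m) summable_on UNIV"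
    proof (rule summable_on_le[OF summable_on_add[OF r(2) s(2)]])
      fix m
      have "norm ((c + d) m) * min r s ^ mdeg m \<le> (norm (c m) + norm (d m)) * min r s ^ mdeg m"
        using r(1) s(1) by (intro mult_right_mono) (auto simp: norm_triangle_ineq)
      also have "\<dots> \<le> norm (c m) * r ^ mdeg m + norm (d m) * s ^ mdeg m"
        using r(1) s(1) by (auto simp: distrib_right intro!: add_mono mult_left_mono power_mono)
      finally show "norm ((c + d) m) * min r s ^ mdeg m \<le> norm (c m) * r ^ mdeg m + norm (d m) * s ^ mdeg m" .
    qed (use r s in auto)
  qed
qed

lemma conv_series_scale: "c \<in> conv_series \<Longrightarrow> fscale k c \<in> conv_series"
  by (auto simp: conv_series_def fscale_def norm_mult mult.assoc intro: summable_on_cmult_right)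

lemma conv_series_zero: "0 \<in> conv_series"
  by (rule conv_seriesI[of 1]) simp_all

lemma conv_series_sum: "(\<And>x. x \<in> A \<Longrightarrow> g x \<in> conv_series) \<Longrightarrow> (\<Sum>x\<in>A. g x) \<in> conv_series"
proof (induction A rule: infinite_finite_induct)
  case (insert x A)
  have "g x + (\<Sum>x\<in>A. g x) \<in> conv_series" using insert by (intro conv_series_add) auto
  then show ?case by (simp only: sum.insert[OF insert(1,2)])
qed (simp_all only: sum.infinite sum.empty conv_series_zero not_False_eq_True)

lemma inj_shift: "inj (\<lambda>m :: 'b \<Rightarrow>\<^sub>0 nat. m + Poly_Mapping.single i 1)"
  by (simp add: inj_on_def)

lemma range_shift: "range (\<lambda>m :: 'b \<Rightarrow>\<^sub>0 nat. m + Poly_Mapping.single i 1) = {m. lookup m i \<noteq> 0}"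
proof (intro equalityI subsetI)
  fix m assume "m \<in> {m. lookup m i \<noteq> (0::nat)}"
  then have "m = (m - Poly_Mapping.single i 1) + Poly_Mapping.single i 1"
    using minus_single_add[of m i] by (simp add: add.commute)
  then show "m \<in> range (\<lambda>m. m + Poly_Mapping.single i 1)" by (rule range_eqI)
qed (auto simp: lookup_add)

text \<open>Multiplication by a coordinate keeps the radius. A derivative costs a factor
  \<open>lookup m i + 1 \<le> 2 ^ mdeg m\<close>, which is paid for by halving the radius.\<close>

lemma conv_series_letter:
  assumes "c \<in> conv_series"
  shows "letter_act f l c \<in> conv_series"
proof -
  obtain r where r: "r > 0" "(\<lambda>m. norm (c m) * r ^ mdeg m) summable_on UNIV"
    using assms by (auto simp: conv_series_def)
  show ?thesis
  proof (cases l)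
    case (LCoord i)
    define d where "d m = (if lookup m i = 0 then 0 else c (m - Poly_Mapping.single i 1))" for m
    have "(\<lambda>m. r * (norm (c m) * r ^ mdeg m)) summable_on UNIV"
      using r(2) by (rule summable_on_cmult_right)
    then have "((\<lambda>m. norm (d m) * r ^ mdeg m) \<circ> (\<lambda>m. m + Poly_Mapping.single i 1)) summable_on UNIV"
      by (simp add: o_def d_def lookup_add mdeg_add mult_ac)
    then have "(\<lambda>m. norm (d m) * r ^ mdeg m) summable_on range (\<lambda>m. m + Poly_Mapping.single i 1)"
      by (subst summable_on_reindex[OF inj_shift])
    then have "(\<lambda>m. norm (d m) * r ^ mdeg m) summable_on {m. lookup m i \<noteq> 0}"
      by (simp only: range_shift)
    then have "(\<lambda>m. norm (d m) * r ^ mdeg m) summable_on UNIV"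
      by (rule summable_on_cong_neutral[THEN iffD1, rotated -1]) (auto simp: d_def)
    then have "d \<in> conv_series" using r(1) by (intro conv_seriesI)
    moreover have "letter_act f l c = fscale (f i) c + d"
      by (simp add: LCoord fscale_def d_def fun_eq_iff)
    ultimately show ?thesis by (simp only: conv_series_add conv_series_scale assms)
  next
    case (LPartial i)
    have "(\<lambda>m. norm (c m) * r ^ mdeg m) summable_on range (\<lambda>m. m + Poly_Mapping.single i 1)"
      using r(2) by (rule summable_on_subset_banach) auto
    then have "((\<lambda>m. norm (c m) * r ^ mdeg m) \<circ> (\<lambda>m. m + Poly_Mapping.single i 1)) summable_on UNIV"
      by (subst (asm) summable_on_reindex[OF inj_shift])
    then have s: "(\<lambda>m. 1 / r * (norm (c (m + Poly_Mapping.single i 1)) * r ^ (mdeg m + 1))) summable_on UNIV"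
      by (intro summable_on_cmult_right) (simp add: o_def mdeg_add)
    show ?thesis
    proof (rule conv_seriesI)
      show "0 < r / 2" using r by simp
      show "(\<lambda>m. norm (letter_act f l c m) * (r / 2) ^ mdeg m) summable_on UNIV"
      proof (rule summable_on_le[OF s])
        fix m :: "'a \<Rightarrow>\<^sub>0 nat"
        have "lookup m i \<le> mdeg m"
        proof (cases "i \<in> keys m")
          case True
          then show ?thesis unfolding mdeg_def by (intro member_le_sum) auto
        qed (simp add: in_keys_iff)
        then have "lookup m i < 2 ^ mdeg m" using less_exp[of "mdeg m"] by (rule order_le_less_trans)
        then have "real (lookup m i + 1) \<le> 2 ^ mdeg m"
          by (metis Suc_eq_plus1 Suc_leI of_nat_le_iff of_nat_numeral of_nat_power)
        then have "real (lookup m i + 1) * (r / 2) ^ mdeg m \<le> 2 ^ mdeg m * (r / 2) ^ mdeg m"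
          using r(1) by (intro mult_right_mono) auto
        also have "\<dots> = r ^ mdeg m" by (simp add: power_mult_distrib[symmetric])
        finally have "norm (c (m + Poly_Mapping.single i 1)) * (real (lookup m i + 1) * (r / 2) ^ mdeg m) \<le>
            norm (c (m + Poly_Mapping.single i 1)) * r ^ mdeg m"
          by (rule mult_left_mono) simp
        moreover have "norm (letter_act f l c m) = real (lookup m i + 1) * norm (c (m + Poly_Mapping.single i 1))"
          unfolding LPartial letter_act.simps norm_mult norm_of_nat ..
        ultimately show "norm (letter_act f l c m) * (r / 2) ^ mdeg m \<le>
            1 / r * (norm (c (m + Poly_Mapping.single i 1)) * r ^ (mdeg m + 1))"
          using r(1) by (simp add: mult_ac)
      qed (use r in auto)
    qed
  qed
qed

lemma conv_series_word: "c \<in> conv_series \<Longrightarrow> word_act f w c \<in> conv_series"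
proof -
  assume c: "c \<in> conv_series"
  have "foldr (letter_act f) ls c \<in> conv_series" for ls
    by (induction ls) (simp_all only: foldr.simps id_apply o_apply c conv_series_letter)
  then show ?thesis by (simp add: word_act_def)
qed

lemma conv_series_weyl:
  assumes "c \<in> conv_series"
  shows "weyl_act f P c \<in> conv_series"
proof -
  have "free_act f p c \<in> conv_series" for p
  proof -
    have "free_act f p c = (\<Sum>w\<in>keys p. fscale (lookup p w) (word_act f w c))"
      by (simp add: free_act_def fun_eq_iff sum_fun_eval fscale_def)
    then show ?thesis by (simp only:) (intro conv_series_sum conv_series_scale conv_series_word assms)
  qed
  then show ?thesis by (induction P) (simp add: weyl_act.abs_eq)
qed

lemma weyl_act_series_scale: "weyl_act f P (fscale k c) = fscale k (weyl_act f P c)"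
  by transfer (rule free_act_series_scale)

lemma weyl_act_series_diff: "weyl_act f P (c - d) = weyl_act f P c - weyl_act f P d"
  using weyl_act_series_add[of f P "c - d" d] by simp

context plucker_frame
begin

text \<open>The coefficients grow at most geometrically: \<open>B\<close> comes from the multinomial
  factor and \<open>C\<close> from the norms of the sections divided by \<open>f\<close>.\<close>

lemma cser_convergent: "cser \<in> conv_series"
proof -
  define C where "C = 1 + (\<Sum>j\<in>UNIV. nrm (tQ j * tFi))"
  define B where "B = real CARD('b)"
  have C: "1 \<le> C" by (simp add: C_def sum_nonneg nrm_nonneg)
  have B: "1 \<le> B" by (simp add: B_def Suc_leI)
  have Cj: "nrm (tQ j * tFi) \<le> C" for j
    using member_le_sum[of j UNIV "\<lambda>j. nrm (tQ j * tFi)"] by (simp add: C_def nrm_nonneg add_increasing)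
  have bound: "norm (cser m) \<le> (B * C) ^ mdeg m" for m
  proof -
    have "psub (Poly_Mapping.single m 1) * tFi ^ mdeg m = (\<Prod>j\<in>UNIV. (tQ j * tFi) ^ lookup m j)"
      by (simp add: psub_def poly_subst_single monom_eval_UNIV mdeg_UNIV power_sum power_mult_distrib
          prod.distrib LC_simps)
    then have "norm (CT (psub (Poly_Mapping.single m 1) * tFi ^ mdeg m)) \<le> nrm (\<Prod>j\<in>UNIV. (tQ j * tFi) ^ lookup m j)"
      by (simp only: norm_CT_le)
    also have "\<dots> \<le> (\<Prod>j\<in>UNIV. nrm ((tQ j * tFi) ^ lookup m j))" by (rule nrm_prod)
    also have "\<dots> \<le> (\<Prod>j\<in>UNIV. C ^ lookup m j)"
      by (intro prod_mono conjI nrm_nonneg order_trans[OF nrm_power] power_mono Cj)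
    also have "\<dots> = C ^ mdeg m" by (simp add: mdeg_UNIV power_sum)
    finally have 1: "norm (CT (psub (Poly_Mapping.single m 1) * tFi ^ mdeg m)) \<le> C ^ mdeg m" .
    define F where "F = (\<Prod>i\<in>UNIV. fact (lookup m i) :: real)"
    have F: "F > 0" by (simp add: F_def prod_pos)
    have "norm (mfact m) = F" by (simp add: mfact_def F_def prod_norm[symmetric])
    then have "norm (cser m) = fact (mdeg m) * norm (CT (psub (Poly_Mapping.single m 1) * tFi ^ mdeg m)) / F"
      by (simp add: cser_def norm_divide norm_mult norm_power)
    also have "\<dots> \<le> fact (mdeg m) * C ^ mdeg m / F"
      using 1 F by (intro divide_right_mono mult_left_mono) auto
    also have "\<dots> \<le> B ^ mdeg m * F * C ^ mdeg m / F"
      using multinomial_le[of UNIV "lookup m"] F C unfolding B_def F_def mdeg_UNIV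
      by (intro divide_right_mono mult_right_mono) auto
    also have "\<dots> = (B * C) ^ mdeg m" using F by (simp add: power_mult_distrib)
    finally show ?thesis .
  qed
  \<comment> \<open>Half the reciprocal of the growth rate, so that the terms are dominated by
    powers of \<open>1 / 2\<close>.\<close>
  define r where "r = 1 / (2 * (B * C))"
  have BC: "B * C > 0" using B C by simp
  show ?thesis
  proof (rule conv_seriesI)
    show "0 < r" using BC by (simp add: r_def)
    show "(\<lambda>m. norm (cser m) * r ^ mdeg m) summable_on UNIV"
    proof (rule summable_on_le[OF geometric_summable])
      fix m
      have "norm (cser m) * r ^ mdeg m \<le> (B * C) ^ mdeg m * r ^ mdeg m"
        using bound[of m] BC by (intro mult_right_mono) (auto simp: r_def)
      also have "\<dots> = (B * C * r) ^ mdeg m" by (simp only: power_mult_distrib)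
      also have "B * C * r = 1 / 2" using B C by (simp add: r_def)
      finally show "norm (cser m) * r ^ mdeg m \<le> (1 / 2) ^ mdeg m" .
      show "0 \<le> norm (cser m) * r ^ mdeg m" using BC by (simp add: r_def)
    qed
  qed
qed

end

section \<open>Solutions and homomorphisms\<close>

lemma left_coset_eq:
  "left_coset (left_ideal S) P = left_coset (left_ideal S) P' \<longleftrightarrow> P - P' \<in> left_ideal S"
proof
  assume e: "left_coset (left_ideal S) P = left_coset (left_ideal S) P'"
  have "P \<in> left_coset (left_ideal S) P"
    unfolding left_coset_def using left_ideal.zero by (intro CollectI exI[of _ 0]) simp
  then obtain Q where "P = P' + Q" "Q \<in> left_ideal S" unfolding e by (auto simp: left_coset_def)
  then show "P - P' \<in> left_ideal S" by simp
next
  have sub: "left_coset (left_ideal S) P \<subseteq> left_coset (left_ideal S) P'" if "P - P' \<in> left_ideal S" for P P'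
  proof
    fix R assume "R \<in> left_coset (left_ideal S) P"
    then obtain Q where Q: "R = P + Q" "Q \<in> left_ideal S" by (auto simp: left_coset_def)
    have "R = P' + ((P - P') + Q)" using Q by simp
    then show "R \<in> left_coset (left_ideal S) P'"
      unfolding left_coset_def using left_ideal.add[OF that Q(2)] by blast
  qed
  assume d: "P - P' \<in> left_ideal S"
  have "P' - P \<in> left_ideal S" using left_ideal.mult[OF d, of "- 1"] by simp
  then show "left_coset (left_ideal S) P = left_coset (left_ideal S) P'" using sub d by blast
qed

definition hom_of :: "'b weyl set \<Rightarrow> ('b \<Rightarrow> complex) \<Rightarrow> 'b series \<Rightarrow> 'b weyl set \<Rightarrow> 'b series" where
  "hom_of J f c m = (if m \<in> quotient_module J then weyl_act f (SOME P. m = left_coset J P) c else 0)"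

lemma hom_of_coset:
  assumes "\<And>P. P \<in> left_ideal S \<Longrightarrow> weyl_act f P c = 0"
  shows "hom_of (left_ideal S) f c (left_coset (left_ideal S) P) = weyl_act f P c"
proof -
  let ?J = "left_ideal S"
  define P' where "P' = (SOME P'. left_coset ?J P = left_coset ?J P')"
  have "left_coset ?J P = left_coset ?J P'" unfolding P'_def by (rule someI[of _ P]) (rule refl)
  then have "P - P' \<in> ?J" by (simp only: left_coset_eq)
  then have "weyl_act f (P - P') c = 0" by (rule assms)
  then have "weyl_act f P c = weyl_act f P' c"
    using weyl_act_add[of f "P - P'" P' c] by simp
  then show ?thesis by (simp add: hom_of_def quotient_module_def P'_def)
qed

lemma hom_of_Hom_D:
  assumes "\<And>P. P \<in> left_ideal S \<Longrightarrow> weyl_act f P c = 0" "c \<in> conv_series"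
  shows "hom_of (left_ideal S) f c \<in> Hom_D (left_ideal S) f"
  unfolding Hom_D_def
proof (intro CollectI conjI allI ballI impI)
  fix m assume "m \<notin> quotient_module (left_ideal S)"
  then show "hom_of (left_ideal S) f c m = 0" by (simp add: hom_of_def)
next
  fix m assume "m \<in> quotient_module (left_ideal S)"
  then show "hom_of (left_ideal S) f c m \<in> conv_series"
    by (auto simp: quotient_module_def hom_of_coset[OF assms(1)] conv_series_weyl[OF assms(2)])
qed (simp_all only: hom_of_coset[OF assms(1)] weyl_act_add weyl_act_mult)

text \<open>The module is generated by the class of 1, so a homomorphism amounts to the image
  \<open>c\<close> of that class, a series annihilated by the ideal.\<close>

lemma Hom_D_solution:
  assumes h: "h \<in> Hom_D (left_ideal S) f"
  defines "c \<equiv> h (left_coset (left_ideal S) 1)"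
  shows "h (left_coset (left_ideal S) P) = weyl_act f P c"
    and "P \<in> left_ideal S \<Longrightarrow> weyl_act f P c = 0"
    and "m \<notin> quotient_module (left_ideal S) \<Longrightarrow> h m = 0"
proof -
  have m: "h (left_coset (left_ideal S) (P * Q)) = weyl_act f P (h (left_coset (left_ideal S) Q))" for P Q
    using h by (simp add: Hom_D_def)
  have e: "h (left_coset (left_ideal S) P) = weyl_act f P c" for P
    using m[of P 1] by (simp add: c_def)
  show "h (left_coset (left_ideal S) P) = weyl_act f P c" by (rule e)
  show "m \<notin> quotient_module (left_ideal S) \<Longrightarrow> h m = 0" using h by (simp add: Hom_D_def)
  assume "P \<in> left_ideal S"
  then have "left_coset (left_ideal S) P = left_coset (left_ideal S) 0" by (simp add: left_coset_eq)
  then show "weyl_act f P c = 0" using e[of P] e[of 0] by (simp add: weyl_act_zero)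
qed

theorem theorem8p1:
  fixes N :: nat and a :: "'b::finite \<Rightarrow> plpoly \<Rightarrow> complex"
  assumes "N \<ge> 2"
    and "is_basis a (V_space N)"
  shows "fvec2.dim (Hom_D (tautological_ideal a (plucker_cone N) (lie_alg N) (lie_rep N) beta)
           (\<lambda>i. a i (cyclic_section N))) = 1"
proof -
  obtain p where p: "\<And>j. p j \<in> forms N N" "\<And>i j. a i (p j) = (if i = j then 1 else 0)"
    using dual_forms_exist[OF assms(2)] by blast
  interpret plucker_frame N a p by unfold_locales (use assms p in auto)
  define S where "S = (\<lambda>x. lin_operator a (lie_rep N x) + wconst (beta x)) ` lie_alg N \<union>
    poly_partial ` vanishing_ideal a (plucker_cone N)"
  let ?f = "\<lambda>i. a i (cyclic_section N)"
  have ideal: "tautological_ideal a (plucker_cone N) (lie_alg N) (lie_rep N) beta = left_ideal S"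
    by (simp add: tautological_ideal_def S_def)
  have ann: "weyl_act ?f P cser = 0" if "P \<in> left_ideal S" for P
    using cser_annihilated that unfolding ideal by blast
  define h0 where "h0 = hom_of (left_ideal S) ?f cser"
  have h0: "h0 \<in> Hom_D (left_ideal S) ?f"
    unfolding h0_def by (rule hom_of_Hom_D[OF ann cser_convergent])
  have nz: "h0 \<noteq> 0"
  proof
    assume "h0 = 0"
    then have "h0 (left_coset (left_ideal S) 1) 0 = 0" by simp
    then show False by (simp add: h0_def hom_of_coset[OF ann] weyl_act_one cser_zero)
  qed
  \<comment> \<open>As \<open>cser 0 = 1\<close>, subtracting \<open>c 0\<close> times
    \<open>cser\<close> leaves a solution with constant coefficient 0, to which
    \<open>unique\<close> applies.\<close>
  have span: "h = fscale2 (h (left_coset (left_ideal S) 1) 0) h0" if h: "h \<in> Hom_D (left_ideal S) ?f" for h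
  proof -
    define c where "c = h (left_coset (left_ideal S) 1)"
    note hs = Hom_D_solution[OF h, folded c_def]
    have "weyl_act ?f P (c - fscale (c 0) cser) = 0" if "P \<in> left_ideal S" for P
      unfolding weyl_act_series_diff weyl_act_series_scale hs(2)[OF that] ann[OF that]
      by (simp add: fscale_def fun_eq_iff)
    then interpret solution N a p "c - fscale (c 0) cser"
      by unfold_locales (simp only: ideal)
    have "c - fscale (c 0) cser = 0" by (rule unique) (simp add: fscale_def cser_zero)
    then have c: "c = fscale (c 0) cser" by simp
    show ?thesis
    proof
      fix m
      show "h m = fscale2 (h (left_coset (left_ideal S) 1) 0) h0 m"
      proof (cases "m \<in> quotient_module (left_ideal S)")
        case True
        then obtain P where m: "m = left_coset (left_ideal S) P" by (auto simp: quotient_module_def)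
        have "h m = weyl_act ?f P (fscale (c 0) cser)" unfolding m hs(1) by (subst c) (rule refl)
        then show ?thesis
          unfolding c_def[symmetric] by (simp only: m h0_def hom_of_coset[OF ann] fscale2_def weyl_act_series_scale)
      next
        case False
        then show ?thesis using hs(3)[OF False] by (simp add: h0_def hom_of_def fscale2_def fscale_def fun_eq_iff)
      qed
    qed
  qed
  show ?thesis unfolding ideal
  proof (rule fvec2.dim_unique[of "{h0}"])
    show "{h0} \<subseteq> Hom_D (left_ideal S) ?f" using h0 by simp
    show "Hom_D (left_ideal S) ?f \<subseteq> fvec2.span {h0}"
    proof
      fix h assume "h \<in> Hom_D (left_ideal S) ?f"
      then have "h = fscale2 (h (left_coset (left_ideal S) 1) 0) h0" by (rule span)
      then show "h \<in> fvec2.span {h0}" by (metis fvec2.span_base fvec2.span_scale singletonI)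
    qed
    show "fvec2.independent {h0}" using nz by simp
  qed simp
qed

end
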